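(* Let $L$ be a finite simplicial complex on vertex set $\mathsf V$, let $\chi\colon G_L\twoheadrightarrow\mathbb Z$ be an epimorphism with $m_v=\chi(v)$ for $v\in\mathsf V$, let $\Bbbk$ be a field, and let $f\in\Bbbk[t]$ be an irreducible polynomial with $f(0)\ne0$. Suppose that, for every vertex $v\in\mathsf V$ such that $m_v\ne0$, the polynomial $f$ does not divide $t^{m_v}-1$ (in $\Bbbk[t^{\pm1}]$). Then $H_*(T_L,\Bbbk\mathbb Z_\chi)$ has trivial $f$-primary part.
   Context: Simplices are identified with their vertex sets; every $v\in\mathsf V$ is a vertex of $L$. Give $S^1$ the CW-structure with one $0$-cell $*$ and one $1$-cell. The toric complex is the subcomplex $T_L=\bigcup_{\sigma\in L}\{x: x_v=*\text{ for }v\notin\sigma\}$ of $(S^1)^{\mathsf V}$, with fundamental group the right-angled Artin group $G_L=\langle v\in\mathsf V\mid uv=vu\text{ if }\{u,v\}\text{ is an edge of }L\rangle$. $\Bbbk\mathbb Z=\Bbbk[t^{\pm1}]$, and $\Bbbk\mathbb Z_\chi$ is $\Bbbk\mathbb Z$ viewed as a $\Bbbk G_L$-module via the linear extension of $\chi$. Then $H_i(T_L,\Bbbk\mathbb Z_\chi)\cong H_i(T_L^\chi,\Bbbk)$ as $\Bbbk\mathbb Z$-modules, where $T_L^\chi\to T_L$ is the infinite cyclic cover with fundamental group $\ker\chi$ and $\mathbb Z$ acts by deck transformations. These are finitely generated modules over the PID $\Bbbk[t^{\pm1}]$; the $f$-primary part of such a module is its $f$-power torsion submodule. *)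

theory Defs
  imports
    "HOL-Homology.Simplices"
    "HOL-Algebra.Module"
    "HOL-Algebra.Elementary_Groups"
    "HOL-Library.Poly_Mapping"
    "HOL-Computational_Algebra.Polynomial"
begin

section \<open>Finite simplicial complexes and right-angled Artin groups\<close>

text \<open>Simplices are nonempty vertex sets, and every element of \<open>V\<close> is a vertex.\<close>

definition finite_simplicial_complex :: "'v set \<Rightarrow> 'v set set \<Rightarrow> bool" where
  "finite_simplicial_complex V L \<longleftrightarrow>
     finite V \<and>
     (\<forall>\<sigma>\<in>L. \<sigma> \<subseteq> V \<and> \<sigma> \<noteq> {}) \<and>
     (\<forall>\<sigma>\<in>L. \<forall>\<tau>. \<tau> \<subseteq> \<sigma> \<and> \<tau> \<noteq> {} \<longrightarrow> \<tau> \<in> L) \<and>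
     (\<forall>v\<in>V. {v} \<in> L)"

text \<open>A letter \<open>(v, True)\<close> stands for the generator \<open>v\<close>, and \<open>(v, False)\<close> for its inverse. A pair
  \<open>(r, s)\<close> in \<open>R\<close> is the relation \<open>r = s\<close>.\<close>

type_synonym 'v word = "('v \<times> bool) list"

inductive word_eq :: "'v set \<Rightarrow> ('v word \<times> 'v word) set \<Rightarrow> 'v word \<Rightarrow> 'v word \<Rightarrow> bool"
  for S R where
  refl: "x \<in> lists (S \<times> UNIV) \<Longrightarrow> word_eq S R x x"
| sym: "word_eq S R x y \<Longrightarrow> word_eq S R y x"
| trans: "word_eq S R x y \<Longrightarrow> word_eq S R y z \<Longrightarrow> word_eq S R x z"
| cancel: "x \<in> lists (S \<times> UNIV) \<Longrightarrow> y \<in> lists (S \<times> UNIV) \<Longrightarrow> v \<in> S \<Longrightarrow>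
    word_eq S R (x @ [(v, b), (v, \<not> b)] @ y) (x @ y)"
| rel: "x \<in> lists (S \<times> UNIV) \<Longrightarrow> y \<in> lists (S \<times> UNIV) \<Longrightarrow> (r, s) \<in> R \<Longrightarrow>
    r \<in> lists (S \<times> UNIV) \<Longrightarrow> s \<in> lists (S \<times> UNIV) \<Longrightarrow>
    word_eq S R (x @ r @ y) (x @ s @ y)"

definition word_class :: "'v set \<Rightarrow> ('v word \<times> 'v word) set \<Rightarrow> 'v word \<Rightarrow> 'v word set" where
  "word_class S R x = {y. word_eq S R x y}"

definition presented_group :: "'v set \<Rightarrow> ('v word \<times> 'v word) set \<Rightarrow> 'v word set monoid" where
  "presented_group S R =
     \<lparr>carrier = word_class S R ` lists (S \<times> UNIV),
      monoid.mult = (\<lambda>A B. \<Union>x\<in>A. \<Union>y\<in>B. word_class S R (x @ y)),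
      one = word_class S R []\<rparr>"

definition raag_relations :: "'v set set \<Rightarrow> ('v word \<times> 'v word) set" where
  "raag_relations L =
     {([(u, True), (v, True)], [(v, True), (u, True)]) | u v. u \<noteq> v \<and> {u, v} \<in> L}"

definition raag :: "'v set \<Rightarrow> 'v set set \<Rightarrow> 'v word set monoid" where
  "raag V L = presented_group V (raag_relations L)"

definition raag_gen :: "'v set \<Rightarrow> 'v set set \<Rightarrow> 'v \<Rightarrow> 'v word set" where
  "raag_gen V L v = word_class V (raag_relations L) [(v, True)]"

section \<open>Toric complexes and their infinite cyclic covers\<close>

text \<open>The circle is the unit circle in the complex plane, with \<open>0\<close>-cell \<open>1\<close>. Points of the product
  are extensional functions on \<open>V\<close>.\<close>

definition toric_complex :: "'v set \<Rightarrow> 'v set set \<Rightarrow> ('v \<Rightarrow> complex) topology" where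
  "toric_complex V L =
     subtopology (product_topology (\<lambda>v. top_of_set (sphere 0 1)) V)
       (\<Union>\<sigma>\<in>L. {x. \<forall>v\<in>V - \<sigma>. x v = 1})"

text \<open>The map sending \<open>x\<close> to the product of the \<open>x v\<close> to the power \<open>m v\<close>, from the toric complex to
  the circle, sends the loop of the generator \<open>v\<close> to \<open>m v\<close> times the generator of the fundamental
  group of the circle, so it induces \<open>chi\<close> on fundamental groups when \<open>m v = chi v\<close>. Hence the pullback
  along it of the universal cover \<open>s \<mapsto> cis (2 * pi * s)\<close> of the circle is the infinite cyclic
  cover with fundamental group the kernel of \<open>chi\<close>. The integer \<open>j\<close> acts by \<open>(x, s) \<mapsto> (x, s + j)\<close>;
  the loop of \<open>v\<close> lifts to paths from \<open>(x, s)\<close> to \<open>(x, s + m v)\<close>, so it acts on the fibre as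
  \<open>chi v\<close> does.\<close>

definition toric_cover ::
    "'v set \<Rightarrow> 'v set set \<Rightarrow> ('v word set \<Rightarrow> int) \<Rightarrow> (('v \<Rightarrow> complex) \<times> real) topology" where
  "toric_cover V L chi =
     subtopology (prod_topology (toric_complex V L) euclideanreal)
       {(x, s). (\<Prod>v\<in>V. x v powi chi (raag_gen V L v)) = cis (2 * pi * s)}"

definition deck :: "int \<Rightarrow> 'a \<times> real \<Rightarrow> 'a \<times> real" where
  "deck j = (\<lambda>(x, s). (x, s + of_int j))"

section \<open>Singular homology with field coefficients of a space with an action of the integers\<close>

text \<open>The library's chains have integer coefficients; here a chain is a finitely supported function
  from singular simplices to \<open>'k\<close>.\<close>

type_synonym ('a, 'k) kchain = "((nat \<Rightarrow> real) \<Rightarrow> 'a) \<Rightarrow>\<^sub>0 'k"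

definition lin_extend :: "('a \<Rightarrow> ('b \<Rightarrow>\<^sub>0 'k)) \<Rightarrow> ('a \<Rightarrow>\<^sub>0 'k) \<Rightarrow> ('b \<Rightarrow>\<^sub>0 'k::field)" where
  "lin_extend g c = (\<Sum>x\<in>Poly_Mapping.keys c. Poly_Mapping.map ((*) (Poly_Mapping.lookup c x)) (g x))"

definition kchains :: "nat \<Rightarrow> 'a topology \<Rightarrow> ('a, 'k::field) kchain set" where
  "kchains n X = {c. Poly_Mapping.keys c \<subseteq> singular_simplex_set n X}"

definition kboundary :: "nat \<Rightarrow> ('a, 'k) kchain \<Rightarrow> ('a, 'k::field) kchain" where
  "kboundary n c =
     (if n = 0 then 0
      else lin_extend (\<lambda>\<sigma>. \<Sum>i\<le>n. Poly_Mapping.single (singular_face n i \<sigma>) ((-1) ^ i)) c)"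

definition kcycles :: "nat \<Rightarrow> 'a topology \<Rightarrow> ('a, 'k::field) kchain set" where
  "kcycles n X = {c \<in> kchains n X. kboundary n c = 0}"

definition kboundaries :: "nat \<Rightarrow> 'a topology \<Rightarrow> ('a, 'k::field) kchain set" where
  "kboundaries n X = kboundary (Suc n) ` kchains (Suc n) X"

definition khclass :: "nat \<Rightarrow> 'a topology \<Rightarrow> ('a, 'k) kchain \<Rightarrow> ('a, 'k::field) kchain set" where
  "khclass n X z = {w. w - z \<in> kboundaries n X}"

text \<open>The group ring of the integers over \<open>'k\<close>, that is, Laurent polynomials over \<open>'k\<close>, with the
  convolution product; the power \<open>t ^ j\<close> is \<open>Poly_Mapping.single j 1\<close>.\<close>

type_synonym 'k laurent = "int \<Rightarrow>\<^sub>0 'k"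

definition laurent_t :: "int \<Rightarrow> 'k::field laurent" where
  "laurent_t j = Poly_Mapping.single j 1"

definition laurent_of_poly :: "'k poly \<Rightarrow> 'k::field laurent" where
  "laurent_of_poly f = (\<Sum>i\<le>degree f. Poly_Mapping.single (int i) (coeff f i))"

definition laurent_act ::
    "(int \<Rightarrow> 'a \<Rightarrow> 'a) \<Rightarrow> nat \<Rightarrow> 'k laurent \<Rightarrow> ('a, 'k) kchain \<Rightarrow> ('a, 'k::field) kchain" where
  "laurent_act \<phi> n a c =
     lin_extend (\<lambda>j. lin_extend (\<lambda>\<sigma>. Poly_Mapping.single (simplex_map n (\<phi> j) \<sigma>) 1) c) a"

text \<open>The ring fields \<open>mult\<close> and \<open>one\<close> of the library's module record are irrelevant to modules.\<close>

definition equivariant_homology_module ::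
    "(int \<Rightarrow> 'a \<Rightarrow> 'a) \<Rightarrow> nat \<Rightarrow> 'a topology \<Rightarrow> ('k::field laurent, ('a, 'k) kchain set) module" where
  "equivariant_homology_module \<phi> n X =
     \<lparr>carrier = khclass n X ` kcycles n X,
      monoid.mult = undefined,
      one = undefined,
      ring.zero = khclass n X 0,
      ring.add = (\<lambda>A B. \<Union>x\<in>A. \<Union>y\<in>B. khclass n X (x + y)),
      module.smult = (\<lambda>a A. \<Union>x\<in>A. khclass n X (laurent_act \<phi> n a x))\<rparr>"

text \<open>The homology of the toric complex with coefficients in the Laurent polynomials twisted by
  \<open>chi\<close>, computed as the homology of the infinite cyclic cover.\<close>

definition toric_homology ::
    "nat \<Rightarrow> 'v set \<Rightarrow> 'v set set \<Rightarrow> ('v word set \<Rightarrow> int) \<Rightarrow>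
     ('k::field laurent, (('v \<Rightarrow> complex) \<times> real, 'k) kchain set) module" where
  "toric_homology n V L chi = equivariant_homology_module deck n (toric_cover V L chi)"

definition primary_part :: "'r::comm_ring_1 \<Rightarrow> ('r, 'm) module \<Rightarrow> 'm set" where
  "primary_part f M = {x \<in> carrier M. \<exists>k::nat. module.smult M (f ^ k) x = ring.zero M}"

end

theory Submission
  imports Defs "HOL-Analysis.Complex_Transcendental"
begin

text \<open>Let \<open>R\<close> be the ring of Laurent polynomials. Sweeping once around the circle factor of a vertex \<open>v\<close>
  is an \<open>R\<close>-linear operator \<open>P\<close> that raises degrees by one and satisfies \<open>dP + Pd = t ^ m v - 1\<close>.
  Composites of these operators, applied to a base point, define a chain map from the complex that is
  free over \<open>R\<close> on the simplices (the empty one included), with boundary coefficients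
  \<open>\<plusminus>(t ^ m v - 1)\<close>, to the singular chains of the cover. It is a quasi-isomorphism, by induction on
  the vertices: modulo the part without \<open>v\<close>, the operator \<open>P\<close> identifies the chains of the cover with
  the shifted chains over the link of \<open>v\<close>, which follows from small chains and cutting the circle
  open at two points.

  The boundary coefficients that do not vanish are coprime to \<open>f\<close>. After inverting them and rescaling
  the basis, the coefficients are \<open>0\<close> or \<open>\<plusminus>1\<close>, so that the complex is extended from the field
  and its homology has no \<open>f\<close>-torsion.\<close>

subsection \<open>Linear extension\<close>

text \<open>All work is done on chains, because the induction needs
  \<open>dP + Pd = t ^ m v - 1\<close> as an exact equation between maps linear over
  \<open>R\<close>. Linearity holds because rotations commute with deck transformations and the
  prism operator is natural. The quasi-isomorphism is stated as acyclicity of a mapping cone: this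
  covers injectivity and surjectivity on homology at once and passes from deletion and link to the
  whole. Links may miss vertices or be void, so the induction runs over down-closed families of sets
  and tells the family \<open>{}\<close> (empty space) from \<open>{{}}\<close> (the fibre over the
  base point, a copy of the integers). The ambient space and the equation of the cover stay fixed,
  so the character is never restricted. No localization is built. If \<open>g\<close> is the product
  of the nonvanishing boundary coefficients, then for a cellular chain \<open>c\<close> both
  \<open>g * c\<close> and \<open>F * c\<close> turn out to be boundaries, and a Bezout identity
  recovers \<open>c\<close>. Extension from the field enters through an additive left inverse of the
  multiplication by \<open>F\<close>: it is not linear over \<open>R\<close>, but it commutes with
  coefficients 0 and \<plusminus>1.\<close>

abbreviation scl :: "'k \<Rightarrow> ('a \<Rightarrow>\<^sub>0 'k) \<Rightarrow> ('a \<Rightarrow>\<^sub>0 'k::field)" where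
  "scl a c \<equiv> Poly_Mapping.map ((*) a) c"

lemma lookup_scl [simp]: "Poly_Mapping.lookup (scl a c) x = a * Poly_Mapping.lookup c x"
  by (simp add: Poly_Mapping.map.rep_eq when_def)

lemma keys_scl: "Poly_Mapping.keys (scl a c) \<subseteq> Poly_Mapping.keys c"
  by (auto simp: in_keys_iff)

lemma scl_simps [simp]:
  "scl 0 c = 0" "scl 1 c = c" "scl a (scl b c) = scl (a * b) c"
  "scl a 0 = 0" "scl (-1) c = - c"
  by (auto intro!: poly_mapping_eqI simp: mult.assoc)

lemma scl_add: "scl a (c + d) = scl a c + scl a d"
  and scl_diff: "scl a (c - d) = scl a c - scl a d"
  and scl_add_left: "scl (a + b) c = scl a c + scl b c"
  by (auto intro!: poly_mapping_eqI simp: lookup_add lookup_minus algebra_simps)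

lemma scl_single [simp]: "scl a (Poly_Mapping.single x b) = Poly_Mapping.single x (a * b)"
  by (auto intro!: poly_mapping_eqI simp: lookup_single when_def)

lemma scl_sum: "scl a (sum g I) = (\<Sum>i\<in>I. scl a (g i))"
  by (induction I rule: infinite_finite_induct) (auto simp: scl_add)

lemma lookup_lin_extend:
  "Poly_Mapping.lookup (lin_extend g c) y =
     (\<Sum>x\<in>Poly_Mapping.keys c. Poly_Mapping.lookup c x * Poly_Mapping.lookup (g x) y)"
  by (simp add: lin_extend_def lookup_sum)

lemma lin_extend_superset:
  assumes "finite S" "Poly_Mapping.keys c \<subseteq> S"
  shows "lin_extend g c = (\<Sum>x\<in>S. scl (Poly_Mapping.lookup c x) (g x))"
  unfolding lin_extend_def by (rule sum.mono_neutral_left) (use assms in \<open>auto simp: in_keys_iff\<close>)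

lemma lin_extend_0 [simp]: "lin_extend g 0 = 0"
  by (simp add: lin_extend_def)

lemma lin_extend_single [simp]: "lin_extend g (Poly_Mapping.single x a) = scl a (g x)"
  by (simp add: lin_extend_def)

lemma lin_extend_add: "lin_extend g (c + d) = lin_extend g c + lin_extend g d"
proof -
  let ?S = "Poly_Mapping.keys c \<union> Poly_Mapping.keys d"
  have "Poly_Mapping.keys (c + d) \<subseteq> ?S" by (rule keys_add)
  then show ?thesis
    by (simp add: lin_extend_superset[of ?S] lookup_add scl_add_left sum.distrib)
qed

lemma lin_extend_scl: "lin_extend g (scl a c) = scl a (lin_extend g c)"
  by (simp add: lin_extend_superset[OF _ keys_scl] scl_sum)
     (simp add: lin_extend_def scl_sum)

lemma lin_extend_uminus: "lin_extend g (- c) = - lin_extend g c"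
  using lin_extend_scl[of g "-1" c] by simp

lemma lin_extend_diff: "lin_extend g (c - d) = lin_extend g c - lin_extend g d"
  using lin_extend_add[of g c "- d"] by (simp add: lin_extend_uminus)

lemma lin_extend_sum: "lin_extend g (sum f I) = (\<Sum>i\<in>I. lin_extend g (f i))"
  by (induction I rule: infinite_finite_induct) (auto simp: lin_extend_add)

lemma lin_extend_cong:
  "(\<And>x. x \<in> Poly_Mapping.keys c \<Longrightarrow> g x = h x) \<Longrightarrow> lin_extend g c = lin_extend h c"
  by (simp add: lin_extend_def)

lemma lin_extend_lin_extend:
  "lin_extend h (lin_extend g c) = lin_extend (\<lambda>x. lin_extend h (g x)) c"
  unfolding lin_extend_def[of g] by (simp add: lin_extend_sum lin_extend_scl) (simp add: lin_extend_def)

lemma lin_extend_id: "lin_extend (\<lambda>x. Poly_Mapping.single x 1) c = c"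
  by (rule poly_mapping_eqI)
     (auto simp: lookup_lin_extend lookup_single when_def if_distrib sum.If_cases in_keys_iff cong: if_cong)

lemma lin_extend_add_fun: "lin_extend (\<lambda>x. g x + h x) c = lin_extend g c + lin_extend h c"
  by (simp add: lin_extend_def scl_add sum.distrib)

lemma lin_extend_diff_fun: "lin_extend (\<lambda>x. g x - h x) c = lin_extend g c - lin_extend h c"
  by (simp add: lin_extend_def scl_diff sum_subtractf)

lemma lin_extend_0_fun [simp]: "lin_extend (\<lambda>x. 0) c = 0"
  by (simp add: lin_extend_def)

lemma keys_lin_extend:
  "Poly_Mapping.keys (lin_extend g c) \<subseteq> (\<Union>x\<in>Poly_Mapping.keys c. Poly_Mapping.keys (g x))"
  unfolding lin_extend_def
  by (rule order_trans[OF keys_sum]) (intro UN_mono order_refl keys_scl)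

subsection \<open>Change of coefficients\<close>

definition kof :: "('a \<Rightarrow>\<^sub>0 int) \<Rightarrow> ('a \<Rightarrow>\<^sub>0 'k::field)" where
  "kof = Poly_Mapping.map of_int"

lemma lookup_kof [simp]: "Poly_Mapping.lookup (kof c) x = of_int (Poly_Mapping.lookup c x)"
  by (simp add: kof_def Poly_Mapping.map.rep_eq when_def)

lemma kof_simps [simp]:
  "kof 0 = 0" "kof (c + d) = kof c + kof d" "kof (c - d) = kof c - kof d" "kof (- c) = - kof c"
  "kof (Poly_Mapping.single x 1) = Poly_Mapping.single x 1"
  "kof (frag_cmul n c) = scl (of_int n) (kof c)"
  by (auto intro!: poly_mapping_eqI simp: lookup_add lookup_minus lookup_single when_def)

lemma kof_sum: "kof (sum g I) = (\<Sum>i\<in>I. kof (g i))"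
  by (induction I rule: infinite_finite_induct) auto

lemma keys_kof: "Poly_Mapping.keys (kof c) \<subseteq> Poly_Mapping.keys c"
  by (auto simp: in_keys_iff)

text \<open>The \<open>'k\<close>-linear map that agrees with an operator on integral chains on the basis; identities
  between additive operators on integral chains carry over.\<close>

definition klift :: "(('a \<Rightarrow>\<^sub>0 int) \<Rightarrow> ('b \<Rightarrow>\<^sub>0 int)) \<Rightarrow> ('a \<Rightarrow>\<^sub>0 'k) \<Rightarrow> ('b \<Rightarrow>\<^sub>0 'k::field)" where
  "klift \<Phi> = lin_extend (\<lambda>x. kof (\<Phi> (frag_of x)))"

lemma kof_additive:
  assumes "\<Phi> 0 = 0" "\<And>a b. \<Phi> (a - b) = \<Phi> a - \<Phi> b"
  shows "kof (\<Phi> c) = klift \<Phi> (kof c)"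
proof -
  have "Poly_Mapping.keys c \<subseteq> UNIV" by simp
  then show ?thesis
    by (induction rule: frag_induction) (auto simp: assms klift_def lin_extend_diff)
qed

text \<open>Only the outer operator has to be additive: the inner one is evaluated on basis elements
  alone.\<close>

lemma klift_klift:
  assumes "\<Phi> 0 = 0" "\<And>a b. \<Phi> (a - b) = \<Phi> a - \<Phi> b"
  shows "klift \<Phi> (klift \<Psi> c) = klift (\<Phi> \<circ> \<Psi>) c"
proof -
  have "klift \<Phi> (klift \<Psi> c) = lin_extend (\<lambda>x. klift \<Phi> (kof (\<Psi> (frag_of x)))) c"
    by (simp add: klift_def lin_extend_lin_extend)
  also have "\<dots> = klift (\<Phi> \<circ> \<Psi>) c"
    unfolding klift_def[of "\<Phi> \<circ> \<Psi>"] by (simp flip: kof_additive[of \<Phi>, OF assms])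
  finally show ?thesis .
qed

lemma klift_cong:
  "(\<And>x. x \<in> Poly_Mapping.keys c \<Longrightarrow> \<Phi> (frag_of x) = \<Psi> (frag_of x)) \<Longrightarrow> klift \<Phi> c = klift \<Psi> c"
  unfolding klift_def by (rule lin_extend_cong) simp

lemma klift_add: "klift \<Phi> c + klift \<Psi> c = klift (\<lambda>x. \<Phi> x + \<Psi> x) c"
  by (simp add: klift_def lin_extend_add_fun)

lemma klift_diff: "klift \<Phi> c - klift \<Psi> c = klift (\<lambda>x. \<Phi> x - \<Psi> x) c"
  by (simp add: klift_def lin_extend_diff_fun)

lemma klift_id: "klift (\<lambda>x. x) c = c"
  by (simp add: klift_def lin_extend_id)

section \<open>Chains, boundaries and induced maps with field coefficients\<close>

lemma kchains_klift:
  assumes "\<And>x. x \<in> Poly_Mapping.keys c \<Longrightarrow> singular_chain n X (\<Phi> (frag_of x))"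
  shows "klift \<Phi> c \<in> kchains n X"
  unfolding klift_def kchains_def
proof (intro CollectI subset_trans[OF keys_lin_extend] UN_least)
  fix x assume "x \<in> Poly_Mapping.keys c"
  then show "Poly_Mapping.keys (kof (\<Phi> (frag_of x))) \<subseteq> singular_simplex_set n X"
    using assms[of x] order_trans[OF keys_kof] unfolding singular_chain_def by auto
qed

lemma kboundary_klift: "kboundary n = klift (chain_boundary n)"
proof
  fix c :: "('a, 'k::field) kchain"
  have "kof (chain_boundary n (frag_of \<sigma>)) =
      (\<Sum>i\<le>n. Poly_Mapping.single (singular_face n i \<sigma>) ((-1) ^ i :: 'k))" if "n \<noteq> 0" for \<sigma> :: "(nat \<Rightarrow> real) \<Rightarrow> 'a"
    using that by (simp add: chain_boundary_of kof_sum)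
  then show "kboundary n c = klift (chain_boundary n) c"
    by (cases "n = 0") (simp_all add: kboundary_def klift_def chain_boundary_of)
qed

definition kmap :: "nat \<Rightarrow> ('a \<Rightarrow> 'b) \<Rightarrow> ('a, 'k) kchain \<Rightarrow> ('b, 'k::field) kchain" where
  "kmap n g = lin_extend (\<lambda>\<sigma>. Poly_Mapping.single (simplex_map n g \<sigma>) 1)"

lemma kmap_klift: "kmap n g = klift (chain_map n g)"
  by (simp add: kmap_def klift_def)

lemma kchainsD: "c \<in> kchains n X \<Longrightarrow> x \<in> Poly_Mapping.keys c \<Longrightarrow> singular_simplex n X x"
  by (auto simp: kchains_def)

lemma kchains_0 [simp]: "0 \<in> kchains n X"
  by (simp add: kchains_def)

lemma kchains_add: "c \<in> kchains n X \<Longrightarrow> d \<in> kchains n X \<Longrightarrow> c + d \<in> kchains n X"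
  unfolding kchains_def mem_Collect_eq by (rule order_trans[OF keys_add]) (rule Un_least)

lemma kchains_uminus: "c \<in> kchains n X \<Longrightarrow> - c \<in> kchains n X"
  unfolding kchains_def by simp

lemma kchains_diff: "c \<in> kchains n X \<Longrightarrow> d \<in> kchains n X \<Longrightarrow> c - d \<in> kchains n X"
  using kchains_add[of c n X "- d"] kchains_uminus[of d n X] by simp

lemma kchains_scl: "c \<in> kchains n X \<Longrightarrow> scl a c \<in> kchains n X"
  unfolding kchains_def mem_Collect_eq by (rule order_trans[OF keys_scl])

lemma kchains_sum: "(\<And>i. i \<in> I \<Longrightarrow> g i \<in> kchains n X) \<Longrightarrow> sum g I \<in> kchains n X"
  by (induction I rule: infinite_finite_induct) (auto intro: kchains_add)

lemma kchains_lin_extend: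
  "(\<And>x. x \<in> Poly_Mapping.keys c \<Longrightarrow> g x \<in> kchains n X) \<Longrightarrow> lin_extend g c \<in> kchains n X"
  unfolding lin_extend_def by (intro kchains_sum kchains_scl)

lemma kchains_single: "singular_simplex n X \<sigma> \<Longrightarrow> Poly_Mapping.single \<sigma> a \<in> kchains n X"
  by (simp add: kchains_def)

lemma kchains_mono: "c \<in> kchains n (subtopology X S) \<Longrightarrow> S \<subseteq> T \<Longrightarrow> c \<in> kchains n (subtopology X T)"
  unfolding kchains_def by (auto dest: singular_simplex_mono)

lemma kboundary_simps [simp]:
  "kboundary n 0 = 0" "kboundary 0 c = 0"
  "kboundary n (c + d) = kboundary n c + kboundary n d"
  "kboundary n (c - d) = kboundary n c - kboundary n d"
  "kboundary n (- c) = - kboundary n c"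
  by (auto simp: kboundary_def lin_extend_add lin_extend_diff lin_extend_uminus)

lemma kchains_kboundary: "c \<in> kchains (Suc n) X \<Longrightarrow> kboundary (Suc n) c \<in> kchains n X"
  unfolding kboundary_klift
  by (rule kchains_klift) (auto dest!: kchainsD simp: singular_chain_of intro: singular_chain_boundary_alt)

lemma kboundary_kboundary:
  assumes "c \<in> kchains (Suc n) X" shows "kboundary n (kboundary (Suc n) c) = 0"
proof -
  have "kboundary n (kboundary (Suc n) c) = klift (chain_boundary n \<circ> chain_boundary (Suc n)) c"
    unfolding kboundary_klift by (rule klift_klift) (auto simp: chain_boundary_diff)
  also have "\<dots> = klift (\<lambda>x. 0) c"
    using assms by (intro klift_cong) (auto dest!: kchainsD simp: singular_chain_of intro: chain_boundary_boundary_alt)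
  finally show ?thesis by (simp add: klift_def)
qed

lemma kmap_simps [simp]:
  "kmap n g 0 = 0" "kmap n g (c + d) = kmap n g c + kmap n g d"
  "kmap n g (c - d) = kmap n g c - kmap n g d" "kmap n g (- c) = - kmap n g c"
  by (auto simp: kmap_def lin_extend_add lin_extend_diff lin_extend_uminus)

lemma kchains_kmap: "c \<in> kchains n X \<Longrightarrow> continuous_map X Y g \<Longrightarrow> kmap n g c \<in> kchains n Y"
  unfolding kmap_def
  by (intro kchains_lin_extend kchains_single) (auto dest: kchainsD intro: singular_simplex_simplex_map)

lemma kmap_kmap: "kmap n g (kmap n h c) = kmap n (g \<circ> h) c"
  by (simp add: kmap_def lin_extend_lin_extend simplex_map_compose)

lemma kmap_cong:
  assumes "c \<in> kchains n X" "\<And>x. x \<in> topspace X \<Longrightarrow> g x = h x"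
  shows "kmap n g c = kmap n h c"
  unfolding kmap_def
  by (rule lin_extend_cong) (use assms in \<open>metis kchainsD simplex_map_eq\<close>)

lemma kmap_id:
  assumes "c \<in> kchains n X" "\<And>x. x \<in> topspace X \<Longrightarrow> g x = x"
  shows "kmap n g c = c"
proof -
  have "kmap n g c = lin_extend (\<lambda>x. Poly_Mapping.single x 1) c"
    unfolding kmap_def
    by (rule lin_extend_cong) (use assms in \<open>metis kchainsD simplex_map_id_gen\<close>)
  then show ?thesis by (simp add: lin_extend_id)
qed

lemma kboundary_kmap:
  assumes "c \<in> kchains n X"
  shows "kboundary n (kmap n g c) = kmap (n - 1) g (kboundary n c)"
proof -
  have "kboundary n (kmap n g c) = klift (chain_boundary n \<circ> chain_map n g) c"
    unfolding kboundary_klift kmap_klift by (rule klift_klift) (auto simp: chain_boundary_diff)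
  also have "\<dots> = klift (chain_map (n - 1) g \<circ> chain_boundary n) c"
  proof (rule klift_cong)
    fix x assume "x \<in> Poly_Mapping.keys c"
    then have "singular_chain n X (frag_of x)"
      using assms by (auto simp: singular_chain_of dest: kchainsD)
    then show "(chain_boundary n \<circ> chain_map n g) (frag_of x) = (chain_map (n - 1) g \<circ> chain_boundary n) (frag_of x)"
      using chain_boundary_chain_map by (metis One_nat_def comp_apply)
  qed
  also have "\<dots> = kmap (n - 1) g (kboundary n c)"
    unfolding kboundary_klift kmap_klift by (rule klift_klift[symmetric]) (auto simp: chain_map_diff)
  finally show ?thesis .
qed


subsection \<open>Small chains\<close>

lemma keys_split:
  fixes c :: "'a \<Rightarrow>\<^sub>0 'k::field"
  assumes "Poly_Mapping.keys c \<subseteq> A \<union> B"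
  obtains d e where "c = d + e" "Poly_Mapping.keys d \<subseteq> A" "Poly_Mapping.keys e \<subseteq> B"
proof
  let ?d = "lin_extend (\<lambda>x. if x \<in> A then Poly_Mapping.single x 1 else 0) c"
  let ?e = "lin_extend (\<lambda>x. if x \<in> A then 0 else Poly_Mapping.single x 1) c"
  have "?d + ?e = lin_extend (\<lambda>x. Poly_Mapping.single x 1) c"
    by (subst lin_extend_add_fun[symmetric]) (rule lin_extend_cong, simp)
  then show "c = ?d + ?e" by (simp add: lin_extend_id)
  show "Poly_Mapping.keys ?d \<subseteq> A" by (rule order_trans[OF keys_lin_extend]) (auto split: if_splits)
  show "Poly_Mapping.keys ?e \<subseteq> B" by (rule order_trans[OF keys_lin_extend]) (use assms in \<open>auto split: if_splits\<close>)
qed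

text \<open>Each simplex becomes small after some number of subdivisions and stays so afterwards; a
  chain has finite support, so the maximum of these numbers serves for all its simplices.\<close>

lemma subdivision_splits:
  assumes U: "openin X U" "openin X W" "topspace X \<subseteq> U \<union> W" and c: "c \<in> kchains n X"
  obtains m d e where "klift (singular_subdivision n ^^ m) c = d + e"
    "d \<in> kchains n (subtopology X U)" "e \<in> kchains n (subtopology X W)"
proof -
  have "\<exists>m. \<forall>k\<ge>m. \<forall>f\<in>Poly_Mapping.keys ((singular_subdivision n ^^ k) (frag_of \<sigma>)).
      \<exists>V\<in>{U, W}. f \<in> standard_simplex n \<rightarrow> V" if "\<sigma> \<in> Poly_Mapping.keys c" for \<sigma>
  proof -
    have "singular_chain n X (frag_of \<sigma>)" using that c by (auto simp: singular_chain_of dest: kchainsD)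
    then show ?thesis
      using sufficient_iterated_singular_subdivision_exists[of "{U, W}" X n "frag_of \<sigma>"] U
      by (metis Union_insert ccpo_Sup_singleton insertE singletonD)
  qed
  then obtain m where m: "\<And>\<sigma> k f. \<sigma> \<in> Poly_Mapping.keys c \<Longrightarrow> k \<ge> m \<sigma> \<Longrightarrow>
      f \<in> Poly_Mapping.keys ((singular_subdivision n ^^ k) (frag_of \<sigma>)) \<Longrightarrow> \<exists>V\<in>{U, W}. f \<in> standard_simplex n \<rightarrow> V"
    by metis
  define M where "M = Max (insert 0 (m ` Poly_Mapping.keys c))"
  let ?s = "singular_subdivision n ^^ M"
  have M: "m \<sigma> \<le> M" if "\<sigma> \<in> Poly_Mapping.keys c" for \<sigma>
    using that by (auto simp: M_def)
  have small: "singular_simplex n (subtopology X U) f \<or> singular_simplex n (subtopology X W) f"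
    if "\<sigma> \<in> Poly_Mapping.keys c" "f \<in> Poly_Mapping.keys (?s (frag_of \<sigma>))" for \<sigma> f
  proof -
    have "singular_chain n X (?s (frag_of \<sigma>))"
      using that(1) c by (induction M) (auto simp: singular_chain_of dest: kchainsD intro: singular_chain_singular_subdivision)
    then have "singular_simplex n X f" using that(2) by (auto simp: singular_chain_def)
    then show ?thesis
      using m[OF that(1) M[OF that(1)] that(2)] by (auto simp: singular_simplex_subtopology)
  qed
  have "Poly_Mapping.keys (klift ?s c) \<subseteq> singular_simplex_set n (subtopology X U) \<union> singular_simplex_set n (subtopology X W)"
    unfolding klift_def
    by (intro order_trans[OF keys_lin_extend] UN_least order_trans[OF keys_kof]) (use small in auto)
  then obtain d e where "klift ?s c = d + e" "Poly_Mapping.keys d \<subseteq> singular_simplex_set n (subtopology X U)"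
      "Poly_Mapping.keys e \<subseteq> singular_simplex_set n (subtopology X W)"
    by (rule keys_split)
  then show ?thesis by (intro that[of M d e]) (auto simp: kchains_def)
qed

text \<open>The correction \<open>D\<close> applied to the boundary of \<open>c\<close> does not enlarge supports.\<close>

lemma small_chains:
  fixes c :: "('a, 'k::field) kchain"
  assumes U: "openin X U" "openin X W" "topspace X \<subseteq> U \<union> W" and c: "c \<in> kchains n X"
  obtains d e b D where "c = d + e + kboundary (Suc n) b + D (kboundary n c)"
    "d \<in> kchains n (subtopology X U)" "e \<in> kchains n (subtopology X W)" "b \<in> kchains (Suc n) X"
    "\<And>x y. D (x + y) = D x + (D y :: ('a, 'k) kchain)" "D 0 = 0"
    "\<And>Y x. n > 0 \<Longrightarrow> x \<in> kchains (n - 1) Y \<Longrightarrow> D x \<in> kchains n Y"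
proof -
  obtain m d e where de: "klift (singular_subdivision n ^^ m) c = d + e"
    "d \<in> kchains n (subtopology X U)" "e \<in> kchains n (subtopology X W)"
    using subdivision_splits[OF assms] by metis
  \<comment> \<open>The same \<open>h\<close> works for all spaces at once, hence it respects every
    subspace that carries its argument.\<close>
  obtain h where h: "\<And>p. h p 0 = (0 :: 'a chain)" "\<And>p c1 c2. h p (c1-c2) = h p c1 - h p c2"
      "\<And>p X c. singular_chain p X c \<Longrightarrow> singular_chain (Suc p) X (h p c)"
      "\<And>p X c. singular_chain p X c
         \<Longrightarrow> chain_boundary (Suc p) (h p c) + h (p - Suc 0) (chain_boundary p c) = (singular_subdivision p ^^ m) c - c"
    using chain_homotopic_iterated_singular_subdivision by blast
  let ?H = "\<lambda>p. klift (h p) :: ('a, 'k) kchain \<Rightarrow> ('a, 'k) kchain"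
  have Hch: "?H p x \<in> kchains (Suc p) Y" if "x \<in> kchains p Y" for p Y x
    using that by (intro kchains_klift h) (auto dest: kchainsD simp: singular_chain_of)
  have "kboundary (Suc n) (?H n c) + ?H (n - Suc 0) (kboundary n c) =
      klift (chain_boundary (Suc n) \<circ> h n) c + klift (h (n - Suc 0) \<circ> chain_boundary n) c"
    unfolding kboundary_klift by (subst (1 2) klift_klift) (auto simp: h chain_boundary_diff)
  also have "\<dots> = klift (\<lambda>x. (singular_subdivision n ^^ m) x - x) c"
    unfolding klift_add
  proof (rule klift_cong)
    fix x assume "x \<in> Poly_Mapping.keys c"
    then have "singular_chain n X (frag_of x)" using c by (auto dest: kchainsD simp: singular_chain_of)
    then show "(chain_boundary (Suc n) \<circ> h n) (frag_of x) + (h (n - Suc 0) \<circ> chain_boundary n) (frag_of x) =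
       (singular_subdivision n ^^ m) (frag_of x) - frag_of x"
      using h(4) by simp
  qed
  also have "\<dots> = d + e - c"
    by (simp add: de klift_id flip: klift_diff)
  finally have eq: "kboundary (Suc n) (?H n c) + ?H (n - Suc 0) (kboundary n c) = d + e - c" .
  show ?thesis
  \<comment> \<open>For \<open>n = 0\<close> the truncated \<open>n - Suc 0\<close> is 0 and the
    operator would land in degree 1. It then meets only the boundary 0, which is why supports are
    claimed for \<open>n > 0\<close> and \<open>D 0 = 0\<close> is recorded apart.\<close>
  proof (rule that[of d e "- ?H n c" "\<lambda>x. - ?H (n - Suc 0) x"])
    show "c = d + e + kboundary (Suc n) (- ?H n c) + - ?H (n - Suc 0) (kboundary n c)"
      using eq by (simp add: algebra_simps)
    show "- ?H (n - Suc 0) x \<in> kchains n Y" if "n > 0" "x \<in> kchains (n - 1) Y" for x Y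
      using Hch[of x "n - 1" Y] that by (auto intro: kchains_uminus)
  qed (use de Hch[OF c] in \<open>auto simp: klift_def lin_extend_add kchains_uminus\<close>)
qed

subsection \<open>The prism operator\<close>

abbreviation simplex_space :: "nat \<Rightarrow> (nat \<Rightarrow> real) topology" where
  "simplex_space n \<equiv> subtopology (powertop_real UNIV) (standard_simplex n)"

abbreviation unit_interval :: "real topology" where
  "unit_interval \<equiv> top_of_set {0..1}"

abbreviation iota :: "nat \<Rightarrow> (nat \<Rightarrow> real) chain" where
  "iota n \<equiv> frag_of (restrict id (standard_simplex n))"

text \<open>\<open>P\<close> is a chain on the product of the interval with the standard simplex;
  carrying it along each simplex makes the operator natural by construction.\<close>

definition prism_op ::
    "((real \<times> (nat \<Rightarrow> real)) chain) \<Rightarrow> nat \<Rightarrow> 'a chain \<Rightarrow> (real \<times> 'a) chain" where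
  "prism_op P n = frag_extend (\<lambda>\<sigma>. chain_map (Suc n) (map_prod id \<sigma>) P)"

lemma prism_op_simps [simp]:
  "prism_op P n 0 = 0" "prism_op P n (a - b) = prism_op P n a - prism_op P n b"
  "prism_op P n (frag_of \<sigma>) = chain_map (Suc n) (map_prod id \<sigma>) P"
  by (auto simp: prism_op_def frag_extend_diff)

lemma contractible_simplex_space: "contractible_space (simplex_space n)"
proof -
  define a :: "nat \<Rightarrow> real" where "a = (\<lambda>j. if j = 0 then 1 else 0)"
  have a: "a \<in> standard_simplex n" by (simp add: a_def)
  let ?h = "\<lambda>(t::real, x) i::nat. (1 - t) * x i + t * a i"
  have "continuous_map (prod_topology unit_interval (simplex_space n)) (simplex_space n) ?h"
    unfolding continuous_map_in_subtopology
  proof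
    have t: "continuous_map (prod_topology unit_interval (simplex_space n)) euclideanreal fst"
      using continuous_map_fst continuous_map_into_fulltopology by blast
    have "continuous_map (prod_topology unit_interval (simplex_space n)) (powertop_real UNIV) snd"
      using continuous_map_snd continuous_map_into_fulltopology by blast
    then have x: "continuous_map (prod_topology unit_interval (simplex_space n)) euclideanreal (\<lambda>z. snd z i)" for i
      by (auto simp: continuous_map_componentwise_UNIV)
    show "continuous_map (prod_topology unit_interval (simplex_space n)) (powertop_real UNIV) ?h"
      unfolding continuous_map_componentwise_UNIV
      by (auto simp: case_prod_unfold intro!: continuous_intros continuous_map_add continuous_map_diff continuous_map_real_mult t x)
    show "?h \<in> topspace (prod_topology unit_interval (simplex_space n)) \<rightarrow> standard_simplex n"
      using convex_standard_simplex[OF _ a] by auto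
  qed
  then have "homotopic_with (\<lambda>x. True) (simplex_space n) (simplex_space n) id (\<lambda>x. a)"
    unfolding homotopic_with_def by (intro exI[of _ ?h]) auto
  then show ?thesis unfolding contractible_space_def by blast
qed

text \<open>A contraction makes the cycle homologous to its image under a constant map, which lives
  on a one-point space, where cycles of positive degree bound.\<close>

lemma singular_boundary_contractible:
  assumes X: "contractible_space X" and c: "singular_relcycle n X {} c" and n: "n \<ge> 1"
  shows "\<exists>d. singular_chain (Suc n) X d \<and> chain_boundary (Suc n) d = c"
proof (cases "topspace X = {}")
  case True
  then have "c = 0" using c by (simp add: singular_cycle singular_chain_empty)
  then show ?thesis by (intro exI[of _ 0]) auto
next
  case False
  obtain a where a: "homotopic_with (\<lambda>x. True) X X id (\<lambda>x. a)"
    using X unfolding contractible_space_def by blast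
  then have cont: "continuous_map X X (\<lambda>x. a)" using homotopic_with_imp_continuous_maps by blast
  then have aX: "a \<in> topspace X" using False by (auto simp: continuous_map_def)
  have "homologous_rel n X {} (chain_map n id c) (chain_map n (\<lambda>x. a) c)"
    by (rule homotopic_imp_homologous_rel_chain_maps[OF _ c]) (use a in \<open>simp add: Pi_def\<close>)
  moreover have "chain_map n id c = c"
    using c by (auto simp: singular_cycle intro: chain_map_ident)
  ultimately have 1: "singular_relboundary n X {} (c - chain_map n (\<lambda>x. a) c)"
    by (simp add: homologous_rel_def)
  have "singular_relcycle n (subtopology X {a}) {} (chain_map n (\<lambda>x. a) c)"
    by (rule singular_relcycle_chain_map[OF c]) (use cont in \<open>auto simp: continuous_map_in_subtopology\<close>)
  then have "singular_relboundary n (subtopology X {a}) {} (chain_map n (\<lambda>x. a) c)"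
    using singular_boundary_eq_cycle_singleton[of "subtopology X {a}" a n] aX n by auto
  then have "singular_relboundary n (subtopology X UNIV) {} (chain_map n (\<lambda>x. a) c)"
    using singular_boundary_mono[of "{a}" UNIV n X] by blast
  then have "singular_relboundary n X {} (chain_map n (\<lambda>x. a) c)" by simp
  then have "singular_relboundary n X {} c"
    using singular_relboundary_add[OF 1] by force
  then show ?thesis by (simp add: singular_boundary)
qed

lemma singular_simplex_identity: "singular_simplex n (simplex_space n) (restrict id (standard_simplex n))"
  using simplicial_imp_singular_simplex simplicial_simplex_id by blast

lemma continuous_map_map_prod_singular:
  assumes "singular_simplex n X \<sigma>"
  shows "continuous_map (prod_topology unit_interval (simplex_space n)) (prod_topology unit_interval X) (map_prod id \<sigma>)"
  using assms unfolding singular_simplex_def map_prod_def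
  by (simp add: continuous_map_prod_top id_def)

lemma singular_chain_prism_op:
  assumes P: "singular_chain (Suc n) (prod_topology unit_interval (simplex_space n)) P"
    and c: "singular_chain n X c"
  shows "singular_chain (Suc n) (prod_topology unit_interval X) (prism_op P n c)"
  unfolding prism_op_def
proof (rule singular_chain_extend)
  fix \<sigma> assume "\<sigma> \<in> Poly_Mapping.keys c"
  then have "singular_simplex n X \<sigma>" using c by (auto simp: singular_chain_def)
  then show "singular_chain (Suc n) (prod_topology unit_interval X) (chain_map (Suc n) (map_prod id \<sigma>) P)"
    by (intro singular_chain_chain_map[OF P] continuous_map_map_prod_singular)
qed

lemma prism_op_natural:
  assumes P: "singular_chain (Suc n) (prod_topology unit_interval (simplex_space n)) P"
    and c: "singular_chain n X c"
  shows "chain_map (Suc n) (map_prod id g) (prism_op P n c) = prism_op P n (chain_map n g c)"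
  using c unfolding singular_chain_def
proof (induction rule: frag_induction)
  case (one \<sigma>)
  have "chain_map (Suc n) (map_prod id g \<circ> map_prod id \<sigma>) P = chain_map (Suc n) (map_prod id (simplex_map n g \<sigma>)) P"
    by (rule chain_map_eq[OF P]) (auto simp: simplex_map_def)
  then show ?case by (simp only: prism_op_simps chain_map_of chain_map_compose o_apply)
qed (auto simp: chain_map_diff)

text \<open>In degree 0 the truncated \<open>n - 1\<close> refers back to \<open>P 0\<close> itself,
  harmlessly: the boundary of a 0-chain is 0.\<close>

definition is_prism ::
    "(nat \<Rightarrow> (real \<times> (nat \<Rightarrow> real)) chain) \<Rightarrow> nat \<Rightarrow> bool" where
  "is_prism P n \<longleftrightarrow>
     singular_chain (Suc n) (prod_topology unit_interval (simplex_space n)) (P n) \<and>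
     chain_boundary (Suc n) (P n) =
       chain_map n (Pair 1) (iota n) - chain_map n (Pair 0) (iota n)
         - prism_op (P (n - 1)) (n - 1) (chain_boundary n (iota n))"

text \<open>The equation in \<open>is_prism\<close> concerns the identity simplex only; naturality
  carries it to every other simplex.\<close>

lemma chain_boundary_prism_op:
  assumes n: "is_prism P n" and m: "is_prism P (n - 1)" and c: "singular_chain n X c"
  shows "chain_boundary (Suc n) (prism_op (P n) n c) =
    chain_map n (Pair 1) c - chain_map n (Pair 0) c - prism_op (P (n - 1)) (n - 1) (chain_boundary n c)"
  using c unfolding singular_chain_def
proof (induction rule: frag_induction)
  case (one \<sigma>)
  then have \<sigma>: "singular_simplex n X \<sigma>" by simp
  have Pn: "singular_chain (Suc n) (prod_topology unit_interval (simplex_space n)) (P n)"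
    and Pm: "singular_chain (Suc (n - 1)) (prod_topology unit_interval (simplex_space (n - 1))) (P (n - 1))"
    using n m by (auto simp: is_prism_def)
  have iota: "singular_chain n (simplex_space n) (iota n)"
    using singular_simplex_identity by (simp add: singular_chain_of)
  have pair: "chain_map n (map_prod id \<sigma>) (chain_map n (Pair t) (iota n)) = chain_map n (Pair t) (frag_of \<sigma>)" for t :: real
  proof -
    have "chain_map n (map_prod id \<sigma>) (chain_map n (Pair t) (iota n)) = chain_map n (map_prod id \<sigma> \<circ> Pair t) (iota n)"
      by (simp add: chain_map_compose)
    also have "map_prod id \<sigma> \<circ> Pair t = Pair t \<circ> \<sigma>" by auto
    also have "chain_map n (Pair t \<circ> \<sigma>) (iota n) = chain_map n (Pair t) (chain_map n \<sigma> (iota n))"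
      by (simp add: chain_map_compose)
    finally show ?thesis unfolding singular_simplex_chain_map_id[OF \<sigma>] .
  qed
  have bd: "chain_map n (map_prod id \<sigma>) (prism_op (P (n - 1)) (n - 1) (chain_boundary n (iota n)))
      = prism_op (P (n - 1)) (n - 1) (chain_boundary n (frag_of \<sigma>))"
  proof (cases "n = 0")
    case True then show ?thesis by (simp add: chain_boundary_def)
  next
    case False
    then have "singular_chain (n - 1) (simplex_space n) (chain_boundary n (iota n))"
      using singular_chain_boundary[OF iota] by simp
    from prism_op_natural[OF Pm this, of \<sigma>] False
    have "chain_map n (map_prod id \<sigma>) (prism_op (P (n - 1)) (n - 1) (chain_boundary n (iota n)))
      = prism_op (P (n - 1)) (n - 1) (chain_map (n - 1) \<sigma> (chain_boundary n (iota n)))" by simp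
    also have "chain_map (n - 1) \<sigma> (chain_boundary n (iota n)) = chain_boundary n (chain_map n \<sigma> (iota n))"
      using chain_boundary_chain_map[OF iota, of \<sigma>] by simp
    also have "chain_map n \<sigma> (iota n) = frag_of \<sigma>" by (rule singular_simplex_chain_map_id[OF \<sigma>])
    finally show ?thesis .
  qed
  have "chain_boundary (Suc n) (prism_op (P n) n (frag_of \<sigma>)) = chain_map n (map_prod id \<sigma>) (chain_boundary (Suc n) (P n))"
    using chain_boundary_chain_map[OF Pn] by simp
  also have "chain_boundary (Suc n) (P n) = chain_map n (Pair 1) (iota n) - chain_map n (Pair 0) (iota n)
         - prism_op (P (n - 1)) (n - 1) (chain_boundary n (iota n))"
    using n by (simp add: is_prism_def)
  finally show ?case unfolding chain_map_diff pair bd .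
next
  case (diff a b) then show ?case by (simp add: chain_boundary_diff chain_map_diff)
qed auto

text \<open>Acyclic models: the prisms are built by recursion on the degree, from the contractibility of the
  product of the interval with a simplex.\<close>

lemma prism_exists: "\<exists>P. \<forall>n. is_prism P n"
proof -
  let ?R = "\<lambda>n Q p. singular_chain (Suc n) (prod_topology unit_interval (simplex_space n)) p \<and>
     chain_boundary (Suc n) p = chain_map n (Pair 1) (iota n) - chain_map n (Pair 0) (iota n)
         - prism_op Q (n - 1) (chain_boundary n (iota n))"
  have iota: "singular_chain n (simplex_space n) (iota n)" for n
    using singular_simplex_identity by (simp add: singular_chain_of)
  have contp: "continuous_map (simplex_space n) (prod_topology unit_interval (simplex_space n)) (Pair t)"
    if "t \<in> {0..1}" for n and t :: real
    using that continuous_map_id[of "simplex_space n", unfolded id_def] by (auto simp: continuous_map_pairedI)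
  have contr: "contractible_space (prod_topology unit_interval (simplex_space n))" for n
    using contractible_simplex_space[of n] convex_imp_contractible[of "{0..1::real}"]
    by (auto simp: contractible_space_prod_topology is_interval_convex_1)
  \<comment> \<open>Degree 0 is separate, as a 0-cycle in a contractible space need not bound. Here
    the difference of the two ends bounds because the two inclusions are homotopic.\<close>
  have base: "\<exists>p. ?R 0 Q p" for Q
  proof -
    have i01: "homotopic_with (\<lambda>x. True) (simplex_space 0) (prod_topology unit_interval (simplex_space 0)) (Pair 1) (Pair 0)"
      by (rule homotopic_into_contractible_space) (use contp[of 1 0] contp[of 0 0] contr[of 0] in auto)
    have "homologous_rel 0 (prod_topology unit_interval (simplex_space 0)) {} (chain_map 0 (Pair 1) (iota 0)) (chain_map 0 (Pair 0) (iota 0))"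
      by (rule homotopic_imp_homologous_rel_chain_maps[of "{}" "{}"])
         (use i01 iota[of 0] in \<open>auto simp: singular_cycle chain_boundary_def Pi_def\<close>)
    then show ?thesis
      by (auto simp: homologous_rel_def singular_boundary chain_boundary_def)
  qed
  \<comment> \<open>The prescribed boundary is a cycle, by the prism equation one degree lower, so
    it bounds in the contractible product.\<close>
  have step: "\<exists>q. ?R (Suc n) p q" if P: "is_prism P n" "is_prism P (n - 1)" "p = P n" for P p n
  proof -
    let ?X = "prod_topology unit_interval (simplex_space (Suc n))"
    let ?B = "chain_map (Suc n) (Pair 1) (iota (Suc n)) - chain_map (Suc n) (Pair 0) (iota (Suc n))
         - prism_op p n (chain_boundary (Suc n) (iota (Suc n)))"
    have p: "singular_chain (Suc n) (prod_topology unit_interval (simplex_space n)) p"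
      using P by (simp add: is_prism_def)
    have bi: "singular_chain n (simplex_space (Suc n)) (chain_boundary (Suc n) (iota (Suc n)))"
      by (rule singular_chain_boundary_alt[OF iota])
    have "singular_chain (Suc n) ?X ?B"
      by (intro singular_chain_diff singular_chain_chain_map[OF iota] contp singular_chain_prism_op[OF p bi]) auto
    moreover have "chain_boundary (Suc n) ?B = 0"
      using chain_boundary_prism_op[OF P(1,2) bi] chain_boundary_boundary_alt[OF iota]
      by (simp only: chain_boundary_diff chain_boundary_chain_map[OF iota] P(3)) simp
    ultimately show ?thesis
      using singular_boundary_contractible[OF contr, of "Suc n" "Suc n" ?B] by (auto simp: singular_cycle)
  qed
  define P where "P = rec_nat (SOME p. ?R 0 0 p) (\<lambda>n Q. SOME p. ?R (Suc n) Q p)"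
  have P0: "P 0 = (SOME p. ?R 0 0 p)" and PS: "P (Suc n) = (SOME p. ?R (Suc n) (P n) p)" for n
    by (simp_all add: P_def)
  have "is_prism P n \<and> is_prism P (n - 1)" for n
  proof (induction n)
    case 0
    have "?R 0 0 (P 0)" unfolding P0 by (rule someI_ex[OF base])
    then show ?case by (simp add: is_prism_def chain_boundary_def)
  next
    case (Suc n)
    have "?R (Suc n) (P n) (P (Suc n))" unfolding PS by (rule someI_ex[OF step[of P n]]) (use Suc in auto)
    then show ?case using Suc by (simp add: is_prism_def)
  qed
  then show ?thesis by blast
qed

definition prism :: "nat \<Rightarrow> (real \<times> (nat \<Rightarrow> real)) chain" where
  "prism = (SOME P. \<forall>n. is_prism P n)"

lemma is_prism_prism: "is_prism prism n"
  using someI_ex[OF prism_exists] unfolding prism_def by blast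

text \<open>One fixed natural operator serves all homotopies; a chain homotopy chosen separately for
  each map need not commute with deck transformations.\<close>

definition hop :: "nat \<Rightarrow> (real \<times> 'a \<Rightarrow> 'b) \<Rightarrow> ('a, 'k) kchain \<Rightarrow> ('b, 'k::field) kchain" where
  "hop n h = klift (chain_map (Suc n) h \<circ> prism_op (prism n) n)"

lemma hop_simps [simp]:
  "hop n h 0 = 0" "hop n h (c + d) = hop n h c + hop n h d" "hop n h (c - d) = hop n h c - hop n h d"
  "hop n h (- c) = - hop n h c"
  by (auto simp: hop_def klift_def lin_extend_add lin_extend_diff lin_extend_uminus)

lemma kchains_hop:
  assumes "c \<in> kchains n X" "continuous_map (prod_topology unit_interval X) Y h"
  shows "hop n h c \<in> kchains (Suc n) Y"
  unfolding hop_def o_def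
proof (rule kchains_klift)
  fix x assume "x \<in> Poly_Mapping.keys c"
  then have "singular_chain n X (frag_of x)" using assms by (auto simp: singular_chain_of dest: kchainsD)
  then show "singular_chain (Suc n) Y (chain_map (Suc n) h (prism_op (prism n) n (frag_of x)))"
    using is_prism_prism[of n] unfolding is_prism_def
    by (intro singular_chain_chain_map[OF singular_chain_prism_op assms(2)]) auto
qed

lemma kboundary_hop:
  assumes c: "c \<in> kchains n X"
  shows "kboundary (Suc n) (hop n h c) =
    kmap n (\<lambda>x. h (1, x)) c - kmap n (\<lambda>x. h (0, x)) c - hop (n - 1) h (kboundary n c)"
proof -
  have "kboundary (Suc n) (hop n h c) = klift (chain_boundary (Suc n) \<circ> (chain_map (Suc n) h \<circ> prism_op (prism n) n)) c"
    unfolding hop_def kboundary_klift by (rule klift_klift) (auto simp: chain_boundary_diff)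
  also have "\<dots> = klift (\<lambda>x. chain_map n (\<lambda>x. h (1, x)) x - chain_map n (\<lambda>x. h (0, x)) x -
      ((chain_map (Suc (n - 1)) h \<circ> prism_op (prism (n - 1)) (n - 1)) \<circ> chain_boundary n) x) c"
  proof (rule klift_cong)
    fix x assume "x \<in> Poly_Mapping.keys c"
    then have x: "singular_chain n X (frag_of x)" using c by (auto simp: singular_chain_of dest: kchainsD)
    have p: "singular_chain (Suc n) (prod_topology unit_interval X) (prism_op (prism n) n (frag_of x))"
      using is_prism_prism[of n] x unfolding is_prism_def by (intro singular_chain_prism_op) auto
    have pair: "chain_map n h (chain_map n (Pair t) (frag_of x)) = chain_map n (\<lambda>x. h (t, x)) (frag_of x)" for t
    proof -
      have "h \<circ> Pair t = (\<lambda>x. h (t, x))" by auto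
      moreover have "chain_map n (h \<circ> Pair t) (frag_of x) = chain_map n h (chain_map n (Pair t) (frag_of x))"
        by (simp only: chain_map_compose o_apply)
      ultimately show ?thesis by (simp only:)
    qed
    have "chain_boundary (Suc n) (chain_map (Suc n) h (prism_op (prism n) n (frag_of x)))
       = chain_map n h (chain_boundary (Suc n) (prism_op (prism n) n (frag_of x)))"
      using chain_boundary_chain_map[OF p] by simp
    also have "\<dots> = chain_map n (\<lambda>x. h (1, x)) (frag_of x) - chain_map n (\<lambda>x. h (0, x)) (frag_of x)
         - chain_map n h (prism_op (prism (n - 1)) (n - 1) (chain_boundary n (frag_of x)))"
      unfolding chain_boundary_prism_op[OF is_prism_prism is_prism_prism x] chain_map_diff pair ..
    also have "chain_map n h (prism_op (prism (n - 1)) (n - 1) (chain_boundary n (frag_of x)))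
        = chain_map (Suc (n - 1)) h (prism_op (prism (n - 1)) (n - 1) (chain_boundary n (frag_of x)))"
      by (cases "n = 0") (auto simp: chain_boundary_def)
    finally show "(chain_boundary (Suc n) \<circ> (chain_map (Suc n) h \<circ> prism_op (prism n) n)) (frag_of x)
      = chain_map n (\<lambda>x. h (1, x)) (frag_of x) - chain_map n (\<lambda>x. h (0, x)) (frag_of x) -
      ((chain_map (Suc (n - 1)) h \<circ> prism_op (prism (n - 1)) (n - 1)) \<circ> chain_boundary n) (frag_of x)"
      by simp
  qed
  also have "\<dots> = kmap n (\<lambda>x. h (1, x)) c - kmap n (\<lambda>x. h (0, x)) c - hop (n - 1) h (kboundary n c)"
    unfolding hop_def kboundary_klift kmap_klift
    by (subst klift_klift) (auto simp: chain_map_diff klift_diff)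
  finally show ?thesis .
qed

text \<open>Applied later with \<open>g\<close> and \<open>g'\<close> a deck transformation and
  \<open>h\<close>, \<open>h'\<close> the same rotation, where it yields linearity over the Laurent
  polynomials.\<close>

lemma kmap_hop:
  assumes c: "c \<in> kchains n X" and eq: "\<And>t x. g (h (t, x)) = h' (t, g' x)"
  shows "kmap (Suc n) g (hop n h c) = hop n h' (kmap n g' c)"
proof -
  have "kmap (Suc n) g (hop n h c) = klift (chain_map (Suc n) g \<circ> (chain_map (Suc n) h \<circ> prism_op (prism n) n)) c"
    unfolding hop_def kmap_klift by (rule klift_klift) (auto simp: chain_map_diff)
  also have "\<dots> = klift ((chain_map (Suc n) h' \<circ> prism_op (prism n) n) \<circ> chain_map n g') c"
  proof (rule klift_cong)
    fix x assume "x \<in> Poly_Mapping.keys c"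
    then have x: "singular_chain n X (frag_of x)" using c by (auto simp: singular_chain_of dest: kchainsD)
    have "g \<circ> h = h' \<circ> map_prod id g'" using eq by auto
    then have "chain_map (Suc n) g (chain_map (Suc n) h y) = chain_map (Suc n) h' (chain_map (Suc n) (map_prod id g') y)" for y
      by (metis chain_map_compose comp_apply)
    then show "(chain_map (Suc n) g \<circ> (chain_map (Suc n) h \<circ> prism_op (prism n) n)) (frag_of x) =
      (chain_map (Suc n) h' \<circ> prism_op (prism n) n \<circ> chain_map n g') (frag_of x)"
      using prism_op_natural[of n "prism n" X "frag_of x" g'] is_prism_prism[of n] x
      by (simp only: o_apply is_prism_def)
  qed
  also have "\<dots> = hop n h' (kmap n g' c)"
    unfolding hop_def kmap_klift by (rule klift_klift[symmetric]) (auto simp: chain_map_diff)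
  finally show ?thesis .
qed


subsection \<open>Chains in integer degrees\<close>

text \<open>Passing to a link lowers degrees, so integer degrees with zero spaces below 0 spare case
  distinctions. The truncation by \<open>nat\<close> in \<open>bd\<close> does no harm, since
  \<open>kboundary 0\<close> vanishes.\<close>

definition chain_space :: "int \<Rightarrow> 'a topology \<Rightarrow> ('a, 'k::field) kchain set" where
  "chain_space i X = (if i < 0 then {0} else kchains (nat i) X)"

definition bd :: "int \<Rightarrow> ('a, 'k) kchain \<Rightarrow> ('a, 'k::field) kchain" where
  "bd i = kboundary (nat i)"

definition push :: "int \<Rightarrow> ('a \<Rightarrow> 'b) \<Rightarrow> ('a, 'k) kchain \<Rightarrow> ('b, 'k::field) kchain" where
  "push i = kmap (nat i)"

definition homotop :: "int \<Rightarrow> (real \<times> 'a \<Rightarrow> 'b) \<Rightarrow> ('a, 'k) kchain \<Rightarrow> ('b, 'k::field) kchain" where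
  "homotop i = hop (nat i)"

lemma bd_simps [simp]:
  "bd i 0 = 0" "bd i (c + d) = bd i c + bd i d" "bd i (c - d) = bd i c - bd i d" "bd i (- c) = - bd i c"
  by (auto simp: bd_def)

lemma push_simps [simp]:
  "push i g 0 = 0" "push i g (c + d) = push i g c + push i g d"
  "push i g (c - d) = push i g c - push i g d" "push i g (- c) = - push i g c"
  by (auto simp: push_def)

lemma homotop_simps [simp]:
  "homotop i h 0 = 0" "homotop i h (c + d) = homotop i h c + homotop i h d"
  "homotop i h (c - d) = homotop i h c - homotop i h d" "homotop i h (- c) = - homotop i h c"
  by (auto simp: homotop_def)

lemma chain_space_0 [simp]: "0 \<in> chain_space i X"
  by (simp add: chain_space_def)

lemma chain_space_add: "c \<in> chain_space i X \<Longrightarrow> d \<in> chain_space i X \<Longrightarrow> c + d \<in> chain_space i X"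
  and chain_space_diff: "c \<in> chain_space i X \<Longrightarrow> d \<in> chain_space i X \<Longrightarrow> c - d \<in> chain_space i X"
  and chain_space_uminus: "c \<in> chain_space i X \<Longrightarrow> - c \<in> chain_space i X"
  by (auto simp: chain_space_def kchains_add kchains_diff kchains_uminus split: if_splits)

lemmas chain_space_ops = chain_space_add chain_space_diff chain_space_uminus

lemma chain_space_mono: "c \<in> chain_space i (subtopology X S) \<Longrightarrow> S \<subseteq> T \<Longrightarrow> c \<in> chain_space i (subtopology X T)"
  by (auto simp: chain_space_def intro: kchains_mono split: if_splits)

lemma chain_space_bd: "c \<in> chain_space i X \<Longrightarrow> bd i c \<in> chain_space (i - 1) X"
  using kchains_kboundary[of c "nat (i - 1)" X]
  by (cases "i \<ge> 1") (auto simp: chain_space_def bd_def Suc_nat_eq_nat_zadd1 split: if_splits)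

lemma bd_bd: "c \<in> chain_space i X \<Longrightarrow> bd (i - 1) (bd i c) = 0"
  using kboundary_kboundary[of c "nat (i - 1)" X]
  by (cases "i \<ge> 1") (auto simp: chain_space_def bd_def Suc_nat_eq_nat_zadd1 split: if_splits)

lemma chain_space_push: "c \<in> chain_space i X \<Longrightarrow> continuous_map X Y g \<Longrightarrow> push i g c \<in> chain_space i Y"
  by (auto simp: chain_space_def push_def kchains_kmap split: if_splits)

lemma push_push: "push i g (push i h c) = push i (g \<circ> h) c"
  by (simp add: push_def kmap_kmap)

lemma push_id: "c \<in> chain_space i X \<Longrightarrow> (\<And>x. x \<in> topspace X \<Longrightarrow> g x = x) \<Longrightarrow> push i g c = c"
  by (auto simp: chain_space_def push_def kmap_id split: if_splits)

lemma push_cong: "c \<in> chain_space i X \<Longrightarrow> (\<And>x. x \<in> topspace X \<Longrightarrow> g x = h x) \<Longrightarrow> push i g c = push i h c"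
  by (auto simp: chain_space_def push_def intro: kmap_cong split: if_splits)

lemma bd_push: "c \<in> chain_space i X \<Longrightarrow> bd i (push i g c) = push (i - 1) g (bd i c)"
  by (auto simp: chain_space_def push_def bd_def kboundary_kmap nat_diff_distrib' split: if_splits)

lemma chain_space_homotop:
  "c \<in> chain_space i X \<Longrightarrow> continuous_map (prod_topology unit_interval X) Y h \<Longrightarrow> homotop i h c \<in> chain_space (i + 1) Y"
  using kchains_hop[of c "nat i" X Y h]
  by (auto simp: chain_space_def homotop_def Suc_nat_eq_nat_zadd1 add.commute split: if_splits)

lemma bd_homotop:
  "c \<in> chain_space i X \<Longrightarrow>
    bd (i + 1) (homotop i h c) = push i (\<lambda>x. h (1, x)) c - push i (\<lambda>x. h (0, x)) c - homotop (i - 1) h (bd i c)"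
  using kboundary_hop[of c "nat i" X h]
  by (auto simp: chain_space_def homotop_def bd_def push_def Suc_nat_eq_nat_zadd1 add.commute nat_diff_distrib' split: if_splits)

lemma push_homotop:
  "c \<in> chain_space i X \<Longrightarrow> (\<And>t x. g (h (t, x)) = h' (t, g' x)) \<Longrightarrow>
    push (i + 1) g (homotop i h c) = homotop i h' (push i g' c)"
  using kmap_hop[of c "nat i" X g h h' g']
  by (auto simp: chain_space_def homotop_def push_def Suc_nat_eq_nat_zadd1 add.commute split: if_splits)

lemma chain_space_Int:
  "c \<in> chain_space i (subtopology E U) \<Longrightarrow> c \<in> chain_space i (subtopology E W) \<Longrightarrow> c \<in> chain_space i (subtopology E (U \<inter> W))"
  by (force simp: chain_space_def kchains_def singular_simplex_subtopology split: if_splits)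

lemma small_chains_int:
  fixes y :: "('a, 'k::field) kchain"
  assumes U: "openin (subtopology E T) U" "openin (subtopology E T) W" "T \<inter> topspace E \<subseteq> U \<union> W"
    and y: "y \<in> chain_space i (subtopology E T)"
  obtains d e x D where "y = d + e + bd (i + 1) x + D (bd i y)"
    "d \<in> chain_space i (subtopology E U)" "e \<in> chain_space i (subtopology E W)" "x \<in> chain_space (i + 1) (subtopology E T)"
    "\<And>x y. D (x + y) = D x + (D y :: ('a, 'k) kchain)"
    "\<And>Y x. x \<in> chain_space (i - 1) Y \<Longrightarrow> D x \<in> chain_space i Y"
proof (cases "i < 0")
  case True
  show ?thesis by (rule that[of 0 0 0 "\<lambda>x. 0"]) (use y True in \<open>auto simp: chain_space_def\<close>)
next
  case False
  have sub: "subtopology (subtopology E T) U = subtopology E U" "subtopology (subtopology E T) W = subtopology E W"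
    using U by (metis subtopology_subtopology inf.absorb_iff2 openin_imp_subset)+
  have top: "topspace (subtopology E T) \<subseteq> U \<union> W" using U(3) by auto
  have "y \<in> kchains (nat i) (subtopology E T)" using y False by (simp add: chain_space_def)
  then show ?thesis
  proof (rule small_chains[OF U(1,2) top, unfolded sub])
    fix d e x and D :: "('a, 'k) kchain \<Rightarrow> ('a, 'k) kchain"
    assume *: "y = d + e + kboundary (Suc (nat i)) x + D (kboundary (nat i) y)"
      "d \<in> kchains (nat i) (subtopology E U)" "e \<in> kchains (nat i) (subtopology E W)"
      "x \<in> kchains (Suc (nat i)) (subtopology E T)" "\<And>x y. D (x + y) = D x + D y" "D 0 = 0"
      "\<And>Y x. nat i > 0 \<Longrightarrow> x \<in> kchains (nat i - 1) Y \<Longrightarrow> D x \<in> kchains (nat i) Y"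
    have "D x \<in> chain_space i Y" if "x \<in> chain_space (i - 1) Y" for Y x
      using that False *(6) *(7)[of x Y]
      by (cases "i = 0") (auto simp: chain_space_def nat_diff_distrib')
    then show ?thesis
      using that[of d e x D] * False by (auto simp: chain_space_def bd_def Suc_nat_eq_nat_zadd1 add.commute)
  qed
qed

text \<open>The image of a simplex is connected, so it cannot meet both of two disjoint open sets
  that cover it.\<close>

lemma singular_simplex_disjoint_open:
  assumes "openin (subtopology E T) A" "openin (subtopology E T) B" "A \<inter> B = {}"
    and \<sigma>: "singular_simplex n (subtopology E (A \<union> B)) \<sigma>"
  shows "singular_simplex n (subtopology E A) \<sigma> \<or> singular_simplex n (subtopology E B) \<sigma>"
proof -
  have AT: "A \<union> B \<subseteq> T" using assms by (auto dest: openin_imp_subset)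
  have sE: "singular_simplex n E \<sigma>" and sAB: "\<sigma> ` standard_simplex n \<subseteq> A \<union> B"
    using \<sigma> by (auto simp: singular_simplex_subtopology)
  then have "singular_simplex n (subtopology E T) \<sigma>"
    using AT by (auto simp: singular_simplex_subtopology)
  then have "connectedin (subtopology E T) (\<sigma> ` standard_simplex n)"
    unfolding singular_simplex_def
    by (metis connectedin_absolute connectedin_continuous_map_image connectedin_standard_simplex)
  then have "\<sigma> ` standard_simplex n \<inter> A = {} \<or> \<sigma> ` standard_simplex n \<inter> B = {}"
    using assms(1-3) sAB unfolding connectedin by blast
  then show ?thesis using sE sAB by (auto simp: singular_simplex_subtopology)
qed

lemma chain_space_disjoint_union:
  assumes "openin (subtopology E T) A" "openin (subtopology E T) B" "A \<inter> B = {}"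
    and c: "c \<in> chain_space i (subtopology E (A \<union> B))"
  obtains a b where "c = a + b" "a \<in> chain_space i (subtopology E A)" "b \<in> chain_space i (subtopology E B)"
proof (cases "i < 0")
  case True then show ?thesis using that[of 0 0] c by (auto simp: chain_space_def)
next
  case False
  have "Poly_Mapping.keys c \<subseteq> singular_simplex_set (nat i) (subtopology E A) \<union> singular_simplex_set (nat i) (subtopology E B)"
    using c False singular_simplex_disjoint_open[OF assms(1-3)] by (auto simp: chain_space_def kchains_def)
  then show ?thesis
    by (rule keys_split) (use that False in \<open>auto simp: chain_space_def kchains_def\<close>)
qed

text \<open>The summands are negatives of each other, hence supported in
  \<open>A \<inter> B\<close>, where there are no singular simplices.\<close>

lemma chain_space_disjoint_sum_0:
  assumes "A \<inter> B = {}" "a \<in> chain_space i (subtopology E A)" "b \<in> chain_space i (subtopology E B)" "a + b = 0"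
  shows "a = 0" "b = 0"
proof -
  have "a \<in> chain_space i (subtopology E B)" using assms(3,4) by (simp add: chain_space_uminus eq_neg_iff_add_eq_0[symmetric])
  then have "a \<in> chain_space i (subtopology E {})" using chain_space_Int assms(1,2) by metis
  then have False if "x \<in> Poly_Mapping.keys a" for x
    using that singular_simplex_empty[of trivial_topology] by (auto simp: chain_space_def kchains_def split: if_splits)
  then show "a = 0" by (metis all_not_in_conv keys_eq_empty)
  with assms(4) show "b = 0" by simp
qed

subsection \<open>Cutting a circle of copies of a space\<close>

definition homotopy_on :: "'a topology \<Rightarrow> 'a set \<Rightarrow> 'a set \<Rightarrow> (real \<times> 'a \<Rightarrow> 'a) \<Rightarrow> bool" where
  "homotopy_on E S T h \<longleftrightarrow>
     continuous_map (prod_topology unit_interval (subtopology E S)) (subtopology E T) h"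

definition map_on :: "'a topology \<Rightarrow> 'a set \<Rightarrow> 'a set \<Rightarrow> ('a \<Rightarrow> 'a) \<Rightarrow> bool" where
  "map_on E S T f \<longleftrightarrow> continuous_map (subtopology E S) (subtopology E T) f"

text \<open>The turn is cut into three arcs so that each arc stays inside one of two open sets; only
  then can corrections from subdivision be sorted by support.\<close>

definition homotop3 ::
    "(real \<times> 'a \<Rightarrow> 'a) \<Rightarrow> (real \<times> 'a \<Rightarrow> 'a) \<Rightarrow> (real \<times> 'a \<Rightarrow> 'a) \<Rightarrow>
     int \<Rightarrow> ('a, 'k) kchain \<Rightarrow> ('a, 'k::field) kchain" where
  "homotop3 hA hB hC i c = homotop i hA c + homotop i hB c + homotop i hC c"

lemma homotop3_simps [simp]:
  "homotop3 hA hB hC i 0 = 0" "homotop3 hA hB hC i (c + d) = homotop3 hA hB hC i c + homotop3 hA hB hC i d"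
  "homotop3 hA hB hC i (c - d) = homotop3 hA hB hC i c - homotop3 hA hB hC i d"
  "homotop3 hA hB hC i (- c) = - homotop3 hA hB hC i c"
  by (auto simp: homotop3_def)

text \<open>The space \<open>T\<close> is the union of \<open>Z\<close> and of the translates of \<open>Y\<close> along a circle; the open set \<open>U\<close> is
  a collar of \<open>Z\<close>, and \<open>W\<close> consists of the translates that avoid \<open>Z\<close>. The homotopy \<open>hA\<close>, then \<open>hB\<close>,
  then \<open>hC\<close> carries \<open>Y\<close> once around the circle, back into \<open>Z\<close> by way of \<open>\<tau>\<close>; the pieces \<open>A1\<close> and \<open>A2\<close>
  of the overlap of \<open>U\<close> and \<open>W\<close> contain the translates \<open>r1 Y\<close> and \<open>r2 Y\<close>.\<close>

locale circle_cut =
  fixes E :: "'a topology" and T U W A1 A2 Y Z :: "'a set"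
    and r1 r2 \<tau> q r :: "'a \<Rightarrow> 'a" and hA hB hC G1 G2 H :: "real \<times> 'a \<Rightarrow> 'a"
  assumes open_sets: "openin (subtopology E T) U" "openin (subtopology E T) W"
      "openin (subtopology E T) A1" "openin (subtopology E T) A2"
    and cover: "T \<subseteq> U \<union> W" "U \<inter> W = A1 \<union> A2" "A1 \<inter> A2 = {}"
    and subs: "Y \<subseteq> Z" "Z \<subseteq> U"
    and hA: "homotopy_on E Y U hA" "\<And>x. x \<in> Y \<Longrightarrow> hA (0, x) = x" "\<And>x. x \<in> Y \<Longrightarrow> hA (1, x) = r1 x"
    and hB: "homotopy_on E Y W hB" "\<And>x. x \<in> Y \<Longrightarrow> hB (0, x) = r1 x" "\<And>x. x \<in> Y \<Longrightarrow> hB (1, x) = r2 x"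
    and hC: "homotopy_on E Y U hC" "\<And>x. x \<in> Y \<Longrightarrow> hC (0, x) = r2 x" "\<And>x. x \<in> Y \<Longrightarrow> hC (1, x) = \<tau> x"
    and maps: "map_on E Y A1 r1" "map_on E Y A2 r2" "map_on E Y Z \<tau>" "map_on E W Y q" "map_on E U Z r"
    and q: "\<And>x. x \<in> Y \<Longrightarrow> q (r1 x) = x" "\<And>x. x \<in> Y \<Longrightarrow> q (r2 x) = x"
    and G1: "homotopy_on E W W G1" "homotopy_on E A1 A1 G1"
      "\<And>x. x \<in> W \<Longrightarrow> G1 (0, x) = x" "\<And>x. x \<in> W \<Longrightarrow> G1 (1, x) = r1 (q x)"
    and G2: "homotopy_on E A2 A2 G2" "\<And>x. x \<in> A2 \<Longrightarrow> G2 (0, x) = x" "\<And>x. x \<in> A2 \<Longrightarrow> G2 (1, x) = r2 (q x)"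
    and H: "homotopy_on E U T H" "homotopy_on E Z Z H" "\<And>x. x \<in> U \<Longrightarrow> H (0, x) = x" "\<And>x. x \<in> U \<Longrightarrow> H (1, x) = r x"
begin

abbreviation C :: "int \<Rightarrow> 'a set \<Rightarrow> ('a, 'k::field) kchain set" where
  "C i S \<equiv> chain_space i (subtopology E S)"

lemma C_push: "c \<in> C i S \<Longrightarrow> map_on E S S' g \<Longrightarrow> push i g c \<in> C i S'"
  unfolding map_on_def by (rule chain_space_push)

lemma C_homotop: "c \<in> C i S \<Longrightarrow> homotopy_on E S S' h \<Longrightarrow> homotop i h c \<in> C (i + 1) S'"
  unfolding homotopy_on_def by (rule chain_space_homotop)

lemma C_homotop': "c \<in> C (i - 1) S \<Longrightarrow> homotopy_on E S S' h \<Longrightarrow> homotop (i - 1) h c \<in> C i S'"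
  using C_homotop[of c "i - 1"] by simp

lemma C_bd_homotop:
  assumes "c \<in> C i S" "\<And>x. x \<in> S \<Longrightarrow> h (0, x) = f x" "\<And>x. x \<in> S \<Longrightarrow> h (1, x) = g x"
  shows "bd (i + 1) (homotop i h c) = push i g c - push i f c - homotop (i - 1) h (bd i c)"
proof -
  have "push i (\<lambda>x. h (1, x)) c = push i g c" "push i (\<lambda>x. h (0, x)) c = push i f c"
    using assms by (auto intro!: push_cong[OF assms(1)])
  then show ?thesis using bd_homotop[OF assms(1), of h] by simp
qed

lemma C_push_id: "c \<in> C i S \<Longrightarrow> (\<And>x. x \<in> S \<Longrightarrow> g x = x) \<Longrightarrow> push i g c = c"
  by (rule push_id) auto

abbreviation sweep :: "int \<Rightarrow> ('a, 'k) kchain \<Rightarrow> ('a, 'k::field) kchain" where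
  "sweep \<equiv> homotop3 hA hB hC"

lemma sets_sub: "U \<subseteq> T" "W \<subseteq> T" "A1 \<subseteq> U" "A1 \<subseteq> W" "A2 \<subseteq> U" "A2 \<subseteq> W"
  using open_sets cover by (auto dest: openin_imp_subset)

lemma sweep_C: "c \<in> C i Y \<Longrightarrow> sweep i c \<in> C (i + 1) T"
  unfolding homotop3_def
  by (intro chain_space_add) (rule chain_space_mono[OF C_homotop[of c]], assumption, (rule hA hB hC sets_sub)+)+

lemma bd_sweep:
  assumes c: "c \<in> C i Y"
  shows "bd (i + 1) (sweep i c) = push i \<tau> c - c - sweep (i - 1) (bd i c)"
proof -
  have "push i id c = c" by (rule C_push_id[OF c]) simp
  then show ?thesis
    unfolding homotop3_def
    using C_bd_homotop[OF c, of hA id r1] C_bd_homotop[OF c, of hB r1 r2] C_bd_homotop[OF c, of hC r2 \<tau>] hA hB hC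
    by simp
qed

text \<open>The sweep is a quasi-isomorphism from the chains of \<open>Y\<close> to those of \<open>T\<close> modulo \<open>Z\<close>. The inverse sends
  \<open>y\<close> to the part in \<open>A2\<close> of the boundary of its portion in \<open>W\<close>, projected to \<open>Y\<close>.\<close>

lemma relative_sweep:
  fixes y w :: "('a, 'k::field) kchain"
  assumes y: "y \<in> C i T" and w: "w \<in> C (i - 2) Y" and bw: "bd (i - 2) w = 0"
    and yw: "bd i y - sweep (i - 2) w \<in> C (i - 1) Z"
  obtains b x z where "b \<in> C (i - 1) Y" "w = - bd (i - 1) b" "x \<in> C (i + 1) T" "z \<in> C i Z"
    "y - sweep (i - 1) b = bd (i + 1) x + z"
proof -
  define c0 where "c0 = bd i y - sweep (i - 2) w"
  have c0: "c0 \<in> C (i - 1) Z" "c0 \<in> C (i - 1) U" using yw subs chain_space_mono by (auto simp: c0_def)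
  have ZU: "\<And>c j. c \<in> C j Z \<Longrightarrow> c \<in> C j U" using subs chain_space_mono by blast
  have mono: "\<And>c j. c \<in> C j A1 \<Longrightarrow> c \<in> C j U" "\<And>c j. c \<in> C j A1 \<Longrightarrow> c \<in> C j W" "\<And>c j. c \<in> C j A2 \<Longrightarrow> c \<in> C j U"
      "\<And>c j. c \<in> C j A2 \<Longrightarrow> c \<in> C j W" "\<And>c j. c \<in> C j U \<Longrightarrow> c \<in> C j T" "\<And>c j. c \<in> C j W \<Longrightarrow> c \<in> C j T"
      "\<And>c j. c \<in> C j Y \<Longrightarrow> c \<in> C j Z"
    using chain_space_mono sets_sub subs by blast+
  have Aw: "homotop (i - 2) hA w \<in> C (i - 1) U" and Bw: "homotop (i - 2) hB w \<in> C (i - 1) W"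
    and Cw: "homotop (i - 2) hC w \<in> C (i - 1) U"
    using C_homotop[OF w hA(1)] C_homotop[OF w hB(1)] C_homotop[OF w hC(1)] by auto
  obtain yU yW x D where D: "y = yU + yW + bd (i + 1) x + D (bd i y)"
    "yU \<in> C i U" "yW \<in> C i W" "x \<in> C (i + 1) T"
    "\<And>x y. D (x + y) = D x + (D y :: ('a, 'k) kchain)"
    "\<And>Y x. x \<in> chain_space (i - 1) Y \<Longrightarrow> D x \<in> chain_space i Y"
    using small_chains_int[OF open_sets(1,2) _ y] cover(1) by (metis inf.coboundedI1)
  have bdy: "bd i y = homotop (i - 2) hA w + homotop (i - 2) hB w + homotop (i - 2) hC w + c0"
    by (simp add: c0_def homotop3_def)
  \<comment> \<open>The correction \<open>D (bd i y)\<close> is distributed by support: the outer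
    arcs and \<open>c0\<close> go to \<open>U\<close>, the middle arc goes to
    \<open>W\<close>.\<close>
  define vU where "vU = yU + D (homotop (i - 2) hA w) + D (homotop (i - 2) hC w) + D c0"
  define vW where "vW = yW + D (homotop (i - 2) hB w)"
  have vU: "vU \<in> C i U" unfolding vU_def by (intro chain_space_add D Aw Cw c0)
  have vW: "vW \<in> C i W" unfolding vW_def by (intro chain_space_add D Bw)
  have y_eq: "y = vU + vW + bd (i + 1) x"
    using D(1) unfolding bdy by (simp add: D(5) vU_def vW_def algebra_simps)
  have bbx: "bd i (bd (i + 1) x) = 0" using bd_bd[OF D(4)] by simp
  \<comment> \<open>The boundary of \<open>vW\<close> apart from the middle arc over
    \<open>w\<close>. It equals a chain in \<open>U\<close> as well, hence lives on the overlap and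
    splits over its two disjoint pieces.\<close>
  define e where "e = bd i vW - homotop (i - 2) hB w"
  have eW: "e \<in> C (i - 1) W" unfolding e_def by (intro chain_space_diff chain_space_bd vW Bw)
  have "bd i y = bd i vU + bd i vW" by (subst y_eq) (simp add: bbx)
  then have "e = c0 + homotop (i - 2) hA w + homotop (i - 2) hC w - bd i vU"
    using bdy by (simp add: e_def algebra_simps)
  also have "\<dots> \<in> C (i - 1) U" by (intro chain_space_diff chain_space_add chain_space_bd vU Aw Cw c0)
  finally have "e \<in> C (i - 1) (A1 \<union> A2)" using chain_space_Int[OF _ eW] cover(2) by metis
  then obtain a1 a2 where a: "e = a1 + a2" "a1 \<in> C (i - 1) A1" "a2 \<in> C (i - 1) A2"
    by (rule chain_space_disjoint_union[OF open_sets(3,4) cover(3)])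
  have ba: "bd (i - 1) a1 \<in> C (i - 2) A1" "bd (i - 1) a2 \<in> C (i - 2) A2"
    using chain_space_bd[OF a(2)] chain_space_bd[OF a(3)] by auto
  have rw: "push (i - 2) r1 w \<in> C (i - 2) A1" "push (i - 2) r2 w \<in> C (i - 2) A2"
    using C_push[OF w] maps by auto
  have "bd (i - 1) e = - (push (i - 2) r2 w - push (i - 2) r1 w)"
    using C_bd_homotop[OF w hB(2,3)] bd_bd[OF vW] bw by (simp add: e_def)
  \<comment> \<open>Disjointness turns this single equation into one for each end of the middle
    arc.\<close>
  then have "(bd (i - 1) a1 - push (i - 2) r1 w) + (bd (i - 1) a2 + push (i - 2) r2 w) = 0"
    by (simp add: a(1) algebra_simps)
  from chain_space_disjoint_sum_0[OF cover(3) chain_space_diff[OF ba(1) rw(1)] chain_space_add[OF ba(2) rw(2)] this]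
  have bda: "bd (i - 1) a1 = push (i - 2) r1 w" "bd (i - 1) a2 = - push (i - 2) r2 w"
    by (auto simp: eq_neg_iff_add_eq_0)
  define b where "b = push (i - 1) q a2"
  have b: "b \<in> C (i - 1) Y" unfolding b_def by (rule C_push[OF mono(4)[OF a(3)] maps(4)])
  have qr2: "push j q (push j r2 c) = c" if "c \<in> C j Y" for j and c :: "('a, 'k) kchain"
    unfolding push_push by (rule C_push_id[OF that]) (simp add: q)
  have bdb: "bd (i - 1) b = - w"
    using bd_push[OF a(3), of q] qr2[OF w] by (simp add: b_def bda)
  \<comment> \<open>Once the middle arc over \<open>b\<close> is removed from \<open>vW\<close>, the
    boundary that remains is \<open>\<alpha>1 + \<alpha>2\<close>, where \<open>\<alpha>2\<close> is
    a cycle annihilated by \<open>q\<close>.\<close>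
  define \<alpha>1 where "\<alpha>1 = a1 + push (i - 1) r1 b"
  define \<alpha>2 where "\<alpha>2 = a2 - push (i - 1) r2 b"
  have \<alpha>1: "\<alpha>1 \<in> C (i - 1) A1" unfolding \<alpha>1_def by (intro chain_space_add a C_push[OF b maps(1)])
  have \<alpha>2: "\<alpha>2 \<in> C (i - 1) A2" unfolding \<alpha>2_def by (intro chain_space_diff a C_push[OF b maps(2)])
  define V where "V = vW - homotop (i - 1) hB b"
  have V: "V \<in> C i W" unfolding V_def by (intro chain_space_diff vW C_homotop'[OF b hB(1)])
  have bdV: "bd i V = \<alpha>1 + \<alpha>2"
  proof -
    have "bd i vW = a1 + a2 + homotop (i - 2) hB w" using a(1) unfolding e_def by (simp add: algebra_simps)
    then show ?thesis
      using C_bd_homotop[OF b hB(2,3)] by (simp add: V_def \<alpha>1_def \<alpha>2_def bdb algebra_simps)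
  qed
  have bd\<alpha>2: "bd (i - 1) \<alpha>2 = 0"
    using bd_push[OF b, of r2] by (simp add: \<alpha>2_def bda bdb)
  have q\<alpha>2: "push (i - 1) q \<alpha>2 = 0"
    using qr2[OF b] by (simp add: \<alpha>2_def) (simp add: b_def)
  \<comment> \<open>\<open>G2\<close> deforms \<open>\<alpha>2\<close> inside \<open>A2\<close> to
    its image under \<open>r2\<close> after \<open>q\<close>, which is 0; so \<open>J\<close> fills
    \<open>\<alpha>2\<close> up to sign.\<close>
  define J where "J = homotop (i - 1) G2 \<alpha>2"
  have J: "J \<in> C i A2" unfolding J_def by (rule C_homotop'[OF \<alpha>2 G2(1)])
  have pushid: "push j id c = c" if "c \<in> C j S" for j S and c :: "('a, 'k) kchain"
    by (rule C_push_id[OF that]) simp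
  have bdJ: "bd i J = - \<alpha>2"
    using C_bd_homotop[OF \<alpha>2, of G2 id "r2 \<circ> q"] G2
    by (simp add: J_def bd\<alpha>2 q\<alpha>2 pushid[OF \<alpha>2] flip: push_push)
  define V' where "V' = V + J"
  have V': "V' \<in> C i W" unfolding V'_def by (intro chain_space_add V mono(4)[OF J])
  have bdV': "bd i V' = \<alpha>1" by (simp add: V'_def bdV bdJ)
  have GV': "homotop i G1 V' \<in> C (i + 1) W" by (rule C_homotop[OF V' G1(1)])
  \<comment> \<open>The boundary of \<open>V'\<close> lies in \<open>A1\<close>, which
    \<open>G1\<close> preserves. Hence collapsing \<open>W\<close> to the translate by
    \<open>r1\<close> moves \<open>V'\<close> into \<open>A1\<close>, up to a boundary.\<close>
  have V'_eq: "V' = push i r1 (push i q V') - homotop (i - 1) G1 \<alpha>1 - bd (i + 1) (homotop i G1 V')"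
    using C_bd_homotop[OF V', of G1 id "r1 \<circ> q"] G1
    by (simp add: bdV' pushid[OF V'] flip: push_push)
  define N where "N = vU - homotop (i - 1) hA b - homotop (i - 1) hC b - J + push i r1 (push i q V') - homotop (i - 1) G1 \<alpha>1"
  have N: "N \<in> C i U"
    unfolding N_def
    by (intro chain_space_diff chain_space_add vU mono(1,3) J C_push[OF C_push[OF V' maps(4)] maps(1)]
        C_homotop'[OF b hA(1)] C_homotop'[OF b hC(1)] C_homotop'[OF \<alpha>1 G1(2)])
  define x' where "x' = x - homotop i G1 V'"
  have x': "x' \<in> C (i + 1) T" unfolding x'_def by (intro chain_space_diff D mono(6) GV')
  have main: "y - sweep (i - 1) b = N + bd (i + 1) x'"
  proof -
    have "vW = V' - J + homotop (i - 1) hB b" by (simp add: V'_def V_def)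
    then have "y - sweep (i - 1) b = vU - homotop (i - 1) hA b - homotop (i - 1) hC b - J + V' + bd (i + 1) x"
      by (simp add: y_eq homotop3_def algebra_simps)
    also have "\<dots> = N + bd (i + 1) x'"
      by (subst V'_eq) (simp add: N_def x'_def algebra_simps)
    finally show ?thesis .
  qed
  have "bd i (bd (i + 1) x') = 0" using bd_bd[OF x'] by simp
  then have "bd i N = bd i (y - sweep (i - 1) b)" unfolding main by simp
  also have "\<dots> = c0 - push (i - 1) \<tau> b + b"
    using bd_sweep[OF b] by (simp add: c0_def bdb)
  finally have "bd i N = c0 - push (i - 1) \<tau> b + b" .
  then have bdN: "bd i N \<in> C (i - 1) Z"
    by (simp only:) (intro chain_space_add chain_space_diff c0 mono(7) b C_push[OF b maps(3)])
  \<comment> \<open>\<open>H\<close> moves \<open>N\<close> from \<open>U\<close> into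
    \<open>Z\<close> and preserves \<open>Z\<close>, where the boundary of \<open>N\<close> already
    lies.\<close>
  define z where "z = push i r N - homotop (i - 1) H (bd i N)"
  have "N = z - bd (i + 1) (homotop i H N)"
    using C_bd_homotop[OF N, of H id r] H by (simp add: z_def pushid[OF N])
  then have "y - sweep (i - 1) b = bd (i + 1) (x' - homotop i H N) + z"
    using main by simp
  moreover have "z \<in> C i Z" unfolding z_def by (intro chain_space_diff C_push[OF N maps(5)] C_homotop'[OF bdN H(2)])
  moreover have "x' - homotop i H N \<in> C (i + 1) T" by (intro chain_space_diff x' C_homotop[OF N H(1)])
  ultimately show ?thesis using that[of b "x' - homotop i H N" z] b bdb by simp
qed

end


subsection \<open>The action of Laurent polynomials on chains\<close>

abbreviation lact :: "int \<Rightarrow> 'k laurent \<Rightarrow> ('a \<times> real, 'k) kchain \<Rightarrow> ('a \<times> real, 'k::field) kchain" where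
  "lact i \<equiv> laurent_act deck (nat i)"

lemma lact_def: "lact i a c = lin_extend (\<lambda>j. push i (deck j) c) a"
  by (simp add: laurent_act_def push_def kmap_def)

lemma push_lin_extend: "push i g (lin_extend h a) = lin_extend (\<lambda>j. push i g (h j)) a"
  by (simp add: push_def kmap_def lin_extend_lin_extend)

lemma bd_lin_extend: "bd i (lin_extend h a) = lin_extend (\<lambda>j. bd i (h j)) a"
  by (simp add: bd_def kboundary_klift klift_def lin_extend_lin_extend)

lemma homotop_lin_extend: "homotop i k (lin_extend h a) = lin_extend (\<lambda>j. homotop i k (h j)) a"
  by (simp add: homotop_def hop_def klift_def lin_extend_lin_extend)

lemma chain_space_lin_extend:
  fixes h :: "'c \<Rightarrow> ('a, 'k::field) kchain"
  shows "(\<And>j. j \<in> Poly_Mapping.keys a \<Longrightarrow> h j \<in> chain_space i X) \<Longrightarrow> lin_extend h a \<in> chain_space i X"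
proof -
  assume *: "\<And>j. j \<in> Poly_Mapping.keys a \<Longrightarrow> h j \<in> chain_space i X"
  have scl: "scl b d \<in> chain_space i X" if "d \<in> chain_space i X" for b d
    using that by (auto simp: chain_space_def kchains_scl split: if_splits)
  have sum: "sum g I \<in> chain_space i X" if "\<And>j. j \<in> I \<Longrightarrow> g j \<in> chain_space i X" for g and I :: "'c set"
    using that by (induction I rule: infinite_finite_induct) (auto simp: chain_space_add)
  show ?thesis unfolding lin_extend_def by (intro sum scl *)
qed

lemma deck_deck: "deck j \<circ> deck l = deck (j + l)"
  by (auto simp: deck_def)

lemma lact_simps [simp]:
  "lact i 0 c = 0" "lact i a 0 = 0"
  by (simp_all add: lact_def)

lemma lact_diff_left: "lact i (a - b) c = lact i a c - lact i b c"
  and lact_add: "lact i a (c + d) = lact i a c + lact i a d"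
  by (simp_all add: lact_def lin_extend_diff lin_extend_add_fun)

lemma times_lin_extend:
  fixes a b :: "'k::field laurent"
  shows "a * b = lin_extend (\<lambda>j. lin_extend (\<lambda>l. Poly_Mapping.single (j + l) 1) b) a"
proof -
  have expand: "c = (\<Sum>j\<in>Poly_Mapping.keys c. Poly_Mapping.single j (Poly_Mapping.lookup c j))" for c :: "'k laurent"
    using lin_extend_id[of c] by (simp add: lin_extend_def)
  have "a * b = (\<Sum>j\<in>Poly_Mapping.keys a. \<Sum>l\<in>Poly_Mapping.keys b.
      Poly_Mapping.single (j + l) (Poly_Mapping.lookup a j * Poly_Mapping.lookup b l))"
    by (subst expand[of a], subst expand[of b]) (simp add: sum_product mult_single)
  then show ?thesis by (simp add: lin_extend_def scl_sum)
qed

lemma lact_mult: "lact i (a * b) c = lact i a (lact i b c)"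
  by (simp add: lact_def times_lin_extend lin_extend_lin_extend push_lin_extend push_push deck_deck)

text \<open>\<open>simplex_map\<close> restricts to the standard simplex, so even
  \<open>deck 0\<close> is sure to fix only chains of genuine singular simplices.\<close>

lemma lact_one:
  assumes "c \<in> chain_space i X" shows "lact i 1 c = c"
proof -
  have "push i (deck 0) c = c" by (rule push_id[OF assms]) (auto simp: deck_def)
  then show ?thesis by (simp add: lact_def flip: single_one)
qed

lemma lact_laurent_t: "lact i (laurent_t j) c = push i (deck j) c"
  by (simp add: lact_def laurent_t_def)

lemma chain_space_lact:
  assumes "c \<in> chain_space i X" "\<And>j. continuous_map X X (deck j)" shows "lact i a c \<in> chain_space i X"
  unfolding lact_def by (intro chain_space_lin_extend chain_space_push[OF assms(1)] assms(2))

lemma bd_lact: "c \<in> chain_space i X \<Longrightarrow> bd i (lact i a c) = lact (i - 1) a (bd i c)"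
  by (simp add: lact_def bd_lin_extend bd_push)

lemma lact_homotop:
  assumes "c \<in> chain_space i X" "\<And>j t x. deck j (h (t, x)) = h (t, deck j x)"
  shows "lact (i + 1) a (homotop i h c) = homotop i h (lact i a c)"
proof -
  have "push (i + 1) (deck j) (homotop i h c) = homotop i h (push i (deck j) c)" for j
    using assms by (intro push_homotop) auto
  then show ?thesis by (simp add: lact_def homotop_lin_extend)
qed

subsection \<open>The cellular complex\<close>

text \<open>A cellular chain assigns to every set of vertices the coefficient of the corresponding cell. The
  vertices are ordered by the list \<open>vs\<close>, and \<open>a w\<close> is the coefficient of the facet opposite to \<open>w\<close>.\<close>

definition cell_bd ::
    "('v \<Rightarrow> 'r::comm_ring_1) \<Rightarrow> 'v list \<Rightarrow> ('v set \<Rightarrow> 'r) \<Rightarrow> 'v set \<Rightarrow> 'r" where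
  "cell_bd a vs d \<tau> =
     (\<Sum>w\<in>set vs - \<tau>. (-1) ^ card (\<tau> \<inter> set (takeWhile (\<lambda>x. x \<noteq> w) vs)) * a w * d (insert w \<tau>))"

text \<open>Multiply the identities: every cross term contains \<open>F\<close>. Used for the
  product of boundary coefficients and, with a constant family, for powers of
  \<open>f\<close>.\<close>

lemma bezout_prod:
  fixes b :: "'v \<Rightarrow> 'r::comm_ring_1"
  assumes "finite S" "\<And>v. v \<in> S \<Longrightarrow> \<exists>A B. A * b v + B * F = 1"
  shows "\<exists>A B. A * prod b S + B * F = 1"
  using assms
proof (induction S rule: finite_induct)
  case empty
  show ?case by (intro exI[of _ 1] exI[of _ 0]) simp
next
  case (insert v S)
  obtain A B where AB: "A * prod b S + B * F = 1" using insert by auto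
  obtain A' B' where AB': "A' * b v + B' * F = 1" using insert.prems[of v] by auto
  have "1 = (A * prod b S + B * F) * (A' * b v + B' * F)" using AB AB' by simp
  also have "\<dots> = (A * A') * prod b (insert v S) + (B * (A' * b v + B' * F) + A * prod b S * B') * F"
    using insert.hyps by (simp add: algebra_simps)
  finally show ?case by metis
qed

text \<open>Rescaling the basis by the products \<open>u\<close> turns the boundary into one with coefficients \<open>0\<close> and \<open>1\<close>,
  which commutes with every additive left inverse of the multiplication by \<open>F\<close>.\<close>

lemma cell_bd_divide:
  fixes a :: "'v \<Rightarrow> 'r::comm_ring_1"
  assumes bez: "\<And>v. v \<in> set vs \<Longrightarrow> a v \<noteq> 0 \<Longrightarrow> \<exists>A B. A * a v + B * F = 1"
    and lam: "\<And>x. lam (F * x) = x" "\<And>x y. lam (x + y) = lam x + (lam y :: 'r)"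
    and c: "\<And>\<tau>. F * c \<tau> = cell_bd a vs c' \<tau>"
  obtains c'' where "\<And>\<tau>. c \<tau> = cell_bd a vs c'' \<tau>" "\<And>\<sigma>. c' \<sigma> = 0 \<Longrightarrow> c'' \<sigma> = 0"
proof -
  \<comment> \<open>Vanishing coefficients cannot be inverted; they contribute the factor 1 to the
    rescaling and the coefficient 0 to the rescaled boundary.\<close>
  define b where "b v = (if a v = 0 then 1 else a v)" for v
  define a' where "a' v = (if a v = 0 then 0 else (1::'r))" for v
  have ab: "a v = a' v * b v" for v by (simp add: a'_def b_def)
  \<comment> \<open>Multiplying by \<open>u\<close> leads to coefficients 0 and \<plusminus>1,
    multiplying by the complementary product \<open>w\<close> leads back;
    \<open>w \<tau> * u \<tau>\<close> does not depend on \<open>\<tau>\<close>, so nothing has to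
    be divided.\<close>
  define u where "u \<sigma> = prod b (\<sigma> \<inter> set vs)" for \<sigma>
  define w where "w \<sigma> = prod b (set vs - \<sigma>)" for \<sigma>
  have u: "u (insert v \<tau>) = b v * u \<tau>" if "v \<in> set vs - \<tau>" for v \<tau>
    using that by (simp add: u_def)
  have w: "w \<tau> = b v * w (insert v \<tau>)" if "v \<in> set vs - \<tau>" for v \<tau>
  proof -
    have "set vs - \<tau> = insert v (set vs - insert v \<tau>)" using that by auto
    then show ?thesis unfolding w_def by (metis Diff_iff finite_Diff finite_set insertI1 prod.insert)
  qed
  have uw: "w \<tau> * u \<tau> = prod b (set vs)" for \<tau>
    unfolding u_def w_def by (subst prod.union_disjoint[symmetric]) (auto intro: prod.cong)
  have lam0: "lam 0 = 0" using lam(2)[of 0 0] by simp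
  have lam_minus: "lam (- x) = - lam x" for x
    using lam(2)[of x "- x"] lam0 by (simp add: eq_neg_iff_add_eq_0 add.commute)
  have lam_sum: "lam (sum g I) = (\<Sum>i\<in>I. lam (g i))" for g and I :: "'v set"
    by (induction I rule: infinite_finite_induct) (auto simp: lam0 lam(2))
  have lam_sign: "lam ((-1) ^ k * x) = (-1) ^ k * lam x" for k x
    by (cases "even k") (auto simp: lam_minus)
  have lam_a': "lam (a' v * x) = a' v * lam x" for v x by (simp add: a'_def lam0)
  \<comment> \<open>\<open>lam\<close> need not be linear over the ring; it passes through the
    rescaled boundary only because the coefficients there are 0 and \<plusminus>1.\<close>
  define e where "e \<sigma> = lam (u \<sigma> * c' \<sigma>)" for \<sigma>
  have uc: "u \<tau> * c \<tau> = cell_bd a' vs e \<tau>" for \<tau>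
  proof -
    have "F * (u \<tau> * c \<tau>) = u \<tau> * cell_bd a vs c' \<tau>" by (simp add: c[symmetric])
    also have "\<dots> = cell_bd a' vs (\<lambda>\<sigma>. u \<sigma> * c' \<sigma>) \<tau>"
      unfolding cell_bd_def sum_distrib_left by (rule sum.cong) (auto simp: u ab algebra_simps)
    finally have "u \<tau> * c \<tau> = lam (cell_bd a' vs (\<lambda>\<sigma>. u \<sigma> * c' \<sigma>) \<tau>)" using lam(1) by metis
    then show ?thesis by (simp add: cell_bd_def lam_sum mult.assoc lam_sign lam_a' e_def)
  qed
  have gc: "prod b (set vs) * c \<tau> = cell_bd a vs (\<lambda>\<sigma>. w \<sigma> * e \<sigma>) \<tau>" for \<tau>
  proof -
    have "prod b (set vs) * c \<tau> = w \<tau> * cell_bd a' vs e \<tau>" by (simp add: uc[symmetric] uw[of \<tau>, symmetric] mult.assoc)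
    also have "\<dots> = cell_bd a vs (\<lambda>\<sigma>. w \<sigma> * e \<sigma>) \<tau>"
      unfolding cell_bd_def sum_distrib_left by (rule sum.cong) (auto simp: w[of _ \<tau>] ab algebra_simps)
    finally show ?thesis .
  qed
  have "\<exists>A B. A * b v + B * F = 1" if "v \<in> set vs" for v
  proof (cases "a v = 0")
    case True then show ?thesis by (intro exI[of _ 1] exI[of _ 0]) (simp add: b_def)
  qed (use bez[OF that] in \<open>simp add: b_def\<close>)
  then obtain A B where AB: "A * prod b (set vs) + B * F = 1"
    using bezout_prod[of "set vs" b F] by auto
  show ?thesis
  \<comment> \<open>The first chain has boundary \<open>prod b (set vs) * c\<close> and
    \<open>c'\<close> has boundary \<open>F * c\<close>; the Bezout coefficients combine them. Both
    vanish wherever \<open>c'\<close> does.\<close>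
  proof (rule that[of "\<lambda>\<sigma>. A * (w \<sigma> * e \<sigma>) + B * c' \<sigma>"])
    fix \<tau>
    have "c \<tau> = (A * prod b (set vs) + B * F) * c \<tau>" using AB by simp
    also have "\<dots> = A * (prod b (set vs) * c \<tau>) + B * (F * c \<tau>)" by (simp add: algebra_simps)
    also have "\<dots> = cell_bd a vs (\<lambda>\<sigma>. A * (w \<sigma> * e \<sigma>) + B * c' \<sigma>) \<tau>"
      unfolding gc c cell_bd_def sum_distrib_left sum.distrib[symmetric] by (rule sum.cong) (auto simp: algebra_simps)
    finally show "c \<tau> = cell_bd a vs (\<lambda>\<sigma>. A * (w \<sigma> * e \<sigma>) + B * c' \<sigma>) \<tau>" .
  qed (simp add: e_def lam0)
qed

text \<open>Paired with \<open>cells_with\<close>, this splits a chain on \<open>M\<close> into one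
  on the deletion of \<open>v\<close> and one on its link, the latter a degree lower;
  \<open>cells_join\<close> reassembles them.\<close>

definition cells_without :: "'v \<Rightarrow> ('v set \<Rightarrow> 'r::comm_ring_1) \<Rightarrow> 'v set \<Rightarrow> 'r" where
  "cells_without v d \<sigma> = (if v \<in> \<sigma> then 0 else d \<sigma>)"

definition cells_with :: "'v \<Rightarrow> ('v set \<Rightarrow> 'r::comm_ring_1) \<Rightarrow> 'v set \<Rightarrow> 'r" where
  "cells_with v d \<sigma> = (if v \<in> \<sigma> then 0 else d (insert v \<sigma>))"

definition cells_join :: "'v \<Rightarrow> ('v set \<Rightarrow> 'r::comm_ring_1) \<Rightarrow> ('v set \<Rightarrow> 'r) \<Rightarrow> 'v set \<Rightarrow> 'r" where
  "cells_join v c d \<sigma> = (if v \<in> \<sigma> then d (\<sigma> - {v}) else c \<sigma>)"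

lemma cells_eqI:
  assumes "\<And>\<sigma>. cells_without v c \<sigma> = cells_without v d \<sigma>" "\<And>\<sigma>. cells_with v c \<sigma> = cells_with v d \<sigma>"
  shows "c = d"
proof
  fix \<sigma>
  show "c \<sigma> = d \<sigma>"
  proof (cases "v \<in> \<sigma>")
    case True
    then show ?thesis using assms(2)[of "\<sigma> - {v}"] by (simp add: cells_with_def insert_absorb)
  qed (use assms(1)[of \<sigma>] in \<open>simp add: cells_without_def\<close>)
qed

text \<open>\<open>v\<close> comes first in the order, so the facet opposite to it has sign +1 and,
  on simplices without \<open>v\<close>, the other signs do not see it. With the next lemma this
  presents the complex as the mapping cone of \<open>a v\<close> from the link to the
  deletion.\<close>

lemma cells_without_cell_bd:
  assumes "v \<notin> set vs"
  shows "cells_without v (cell_bd a (v # vs) d) \<tau> = cell_bd a vs (cells_without v d) \<tau> + a v * cells_with v d \<tau>"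
proof (cases "v \<in> \<tau>")
  case True
  then show ?thesis by (simp add: cells_without_def cells_with_def cell_bd_def)
next
  case False
  have "set (v # vs) - \<tau> = insert v (set vs - \<tau>)" using False by auto
  then have "cell_bd a (v # vs) d \<tau> = a v * d (insert v \<tau>) +
      (\<Sum>w\<in>set vs - \<tau>. (-1) ^ card (\<tau> \<inter> set (takeWhile (\<lambda>x. x \<noteq> w) (v # vs))) * a w * d (insert w \<tau>))"
    unfolding cell_bd_def using assms by simp
  also have "(\<Sum>w\<in>set vs - \<tau>. (-1) ^ card (\<tau> \<inter> set (takeWhile (\<lambda>x. x \<noteq> w) (v # vs))) * a w * d (insert w \<tau>))
     = cell_bd a vs (cells_without v d) \<tau>"
    unfolding cell_bd_def
  proof (rule sum.cong)
    fix w assume w: "w \<in> set vs - \<tau>"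
    have "\<tau> \<inter> set (takeWhile (\<lambda>x. x \<noteq> w) (v # vs)) = \<tau> \<inter> set (takeWhile (\<lambda>x. x \<noteq> w) vs)"
      using w assms False by auto
    then show "(-1) ^ card (\<tau> \<inter> set (takeWhile (\<lambda>x. x \<noteq> w) (v # vs))) * a w * d (insert w \<tau>) =
        (-1) ^ card (\<tau> \<inter> set (takeWhile (\<lambda>x. x \<noteq> w) vs)) * a w * cells_without v d (insert w \<tau>)"
      using w assms False by (auto simp: cells_without_def)
  qed simp
  finally show ?thesis using False by (simp add: cells_without_def cells_with_def)
qed

text \<open>\<open>v\<close> precedes every other vertex, hence adds one to each sign exponent when
  it belongs to the face.\<close>

lemma cells_with_cell_bd:
  assumes "v \<notin> set vs"
  shows "cells_with v (cell_bd a (v # vs) d) \<tau> = - cell_bd a vs (cells_with v d) \<tau>"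
proof (cases "v \<in> \<tau>")
  case True
  then show ?thesis by (simp add: cells_with_def cell_bd_def)
next
  case False
  have "set (v # vs) - insert v \<tau> = set vs - \<tau>" using assms by auto
  moreover have "card (insert v \<tau> \<inter> set (takeWhile (\<lambda>x. x \<noteq> w) (v # vs))) = Suc (card (\<tau> \<inter> set (takeWhile (\<lambda>x. x \<noteq> w) vs)))"
    if "w \<in> set vs" for w
  proof -
    have "insert v \<tau> \<inter> set (takeWhile (\<lambda>x. x \<noteq> w) (v # vs)) = insert v (\<tau> \<inter> set (takeWhile (\<lambda>x. x \<noteq> w) vs))"
      using that assms False by (auto dest: set_takeWhileD)
    then show ?thesis using False by simp
  qed
  ultimately have "cell_bd a (v # vs) d (insert v \<tau>) = - cell_bd a vs (cells_with v d) \<tau>"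
    unfolding cell_bd_def
    by (subst sum_negf[symmetric]) (rule sum.cong, use assms False in \<open>auto simp: cells_with_def insert_commute\<close>)
  then show ?thesis using False by (simp add: cells_with_def)
qed

text \<open>The cell of a simplex is a torus whose dimension is the number of vertices, so this
  number is the degree and the empty simplex is the 0-cell. Finiteness must be demanded, as
  \<open>card\<close> is 0 on infinite sets.\<close>

definition cell_chains :: "int \<Rightarrow> 'v set set \<Rightarrow> ('v set \<Rightarrow> 'r::comm_ring_1) set" where
  "cell_chains i M = {d. \<forall>\<sigma>. d \<sigma> \<noteq> 0 \<longrightarrow> \<sigma> \<in> M \<and> finite \<sigma> \<and> int (card \<sigma>) = i}"

definition deletion :: "'v \<Rightarrow> 'v set set \<Rightarrow> 'v set set" where
  "deletion v M = {\<sigma>\<in>M. v \<notin> \<sigma>}"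

definition link :: "'v \<Rightarrow> 'v set set \<Rightarrow> 'v set set" where
  "link v M = {\<sigma>. v \<notin> \<sigma> \<and> insert v \<sigma> \<in> M}"

lemma cell_chains_without: "d \<in> cell_chains i M \<Longrightarrow> cells_without v d \<in> cell_chains i (deletion v M)"
  by (auto simp: cell_chains_def cells_without_def deletion_def)

lemma cell_chains_with: "d \<in> cell_chains i M \<Longrightarrow> cells_with v d \<in> cell_chains (i - 1) (link v M)"
  by (auto simp: cell_chains_def cells_with_def link_def)

lemma cell_chains_join:
  assumes "c \<in> cell_chains i (deletion v M)" "d \<in> cell_chains (i - 1) (link v M)"
  shows "cells_join v c d \<in> cell_chains i M" "cells_without v (cells_join v c d) = c" "cells_with v (cells_join v c d) = d"
proof -
  have c: "\<sigma> \<in> M \<and> v \<notin> \<sigma> \<and> finite \<sigma> \<and> int (card \<sigma>) = i" if "c \<sigma> \<noteq> 0" for \<sigma>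
    using assms(1) that by (auto simp: cell_chains_def deletion_def)
  have d: "insert v \<sigma> \<in> M \<and> v \<notin> \<sigma> \<and> finite \<sigma> \<and> int (card \<sigma>) = i - 1" if "d \<sigma> \<noteq> 0" for \<sigma>
    using assms(2) that by (auto simp: cell_chains_def link_def)
  have "\<sigma> \<in> M \<and> finite \<sigma> \<and> int (card \<sigma>) = i" if "cells_join v c d \<sigma> \<noteq> 0" for \<sigma>
  proof (cases "v \<in> \<sigma>")
    case True
    then have "d (\<sigma> - {v}) \<noteq> 0" using that by (simp add: cells_join_def)
    from d[OF this] True show ?thesis
      by (metis card.remove diff_add_cancel finite_Diff_insert finite.emptyI finite_Diff2 insert_Diff of_nat_Suc add.commute)
  qed (use that c in \<open>auto simp: cells_join_def\<close>)
  then show "cells_join v c d \<in> cell_chains i M" by (simp add: cell_chains_def)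
  show "cells_without v (cells_join v c d) = c"
    using c by (fastforce simp: cells_without_def cells_join_def)
  show "cells_with v (cells_join v c d) = d"
    using d by (fastforce simp: cells_with_def cells_join_def)
qed

lemma cell_chains_ops:
  assumes "c \<in> cell_chains i M" "d \<in> cell_chains i M"
  shows "(\<lambda>\<sigma>. c \<sigma> - x * d \<sigma>) \<in> cell_chains i M" "(\<lambda>\<sigma>. - c \<sigma>) \<in> cell_chains i M" "(\<lambda>\<sigma>. x * c \<sigma>) \<in> cell_chains i M"
  using assms by (force simp: cell_chains_def)+

lemma cell_bd_linear:
  "cell_bd a vs (\<lambda>\<sigma>. c \<sigma> - x * d \<sigma>) \<tau> = cell_bd a vs c \<tau> - x * cell_bd a vs d \<tau>"
  "cell_bd a vs (\<lambda>\<sigma>. - c \<sigma>) \<tau> = - cell_bd a vs c \<tau>"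
  "cell_bd a vs (\<lambda>\<sigma>. x * c \<sigma>) \<tau> = x * cell_bd a vs c \<tau>"
  by (simp_all add: cell_bd_def sum_distrib_left sum_subtractf sum_negf algebra_simps)


subsection \<open>Angles on the circle\<close>

text \<open>A fraction of a full turn, in the interval from 0 to 1. The argument of
  \<open>- z\<close> puts the branch cut at 1, so \<open>angle\<close> is continuous off 1, whereas
  \<open>signed_angle\<close> is continuous off -1.\<close>

definition angle :: "complex \<Rightarrow> real" where
  "angle z = 1 / 2 + Arg (- z) / (2 * pi)"

definition signed_angle :: "complex \<Rightarrow> real" where
  "signed_angle z = Arg z / (2 * pi)"

lemma nonpos_Reals_circle: "norm z = 1 \<Longrightarrow> z \<in> \<real>\<^sub>\<le>\<^sub>0 \<longleftrightarrow> z = - 1" for z :: complex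
  by (auto simp: complex_nonpos_Reals_iff complex_eq_iff cmod_def real_sqrt_eq_1_iff power2_eq_1_iff)

lemma cis_signed_angle: "norm z = 1 \<Longrightarrow> cis (2 * pi * signed_angle z) = z"
  by (cases "z = 0") (auto simp: signed_angle_def cis_Arg sgn_eq)

lemma signed_angle_1 [simp]: "signed_angle 1 = 0"
  by (simp add: signed_angle_def)

lemma cis_angle: "norm z = 1 \<Longrightarrow> cis (2 * pi * angle z) = z"
  by (cases "z = 0") (auto simp: angle_def cis_Arg sgn_eq distrib_left minus_cis[symmetric] simp flip: cis_mult)

lemma angle_bounds:
  assumes "norm z = 1" "z \<noteq> 1" shows "0 < angle z" "angle z < 1"
proof -
  have "Arg (- z) \<noteq> pi" using assms nonpos_Reals_circle[of "- z"]
    by (auto simp: Arg_eq_pi complex_nonpos_Reals_iff)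
  then show "0 < angle z" "angle z < 1"
    using Arg_bounded[of "- z"] by (auto simp: angle_def field_simps)
qed

lemma angle_cis: "0 < t \<Longrightarrow> t < 1 \<Longrightarrow> angle (cis (2 * pi * t)) = t"
proof -
  assume t: "0 < t" "t < 1"
  have "- cis (2 * pi * t) = cis (2 * pi * t - pi)" by (simp add: complex_eq_iff cos_diff sin_diff)
  moreover have "Arg (cis (2 * pi * t - pi)) = 2 * pi * t - pi"
    using t by (intro Arg_cis) (auto simp: mult_less_cancel_left_pos)
  ultimately show ?thesis by (simp add: angle_def field_simps)
qed

lemma continuous_on_signed_angle: "continuous_on (sphere 0 1 - {- 1}) signed_angle"
  unfolding signed_angle_def
  by (intro continuous_intros) (auto simp: nonpos_Reals_circle)

lemma continuous_on_angle: "continuous_on (sphere 0 1 - {1}) angle"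
  unfolding angle_def
proof (intro continuous_intros)
  fix z :: complex assume "z \<in> sphere 0 1 - {1}"
  then show "- z \<notin> \<real>\<^sub>\<le>\<^sub>0" using nonpos_Reals_circle[of "- z"] by auto
qed auto

lemma Im_cis_pos: "0 < t \<Longrightarrow> t < 1 / 2 \<Longrightarrow> Im (cis (2 * pi * t)) > 0"
  by (auto intro!: sin_gt_zero)

lemma Im_cis_neg: "1 / 2 < t \<Longrightarrow> t < 1 \<Longrightarrow> Im (cis (2 * pi * t)) < 0"
  by (auto intro!: sin_lt_zero)

lemma cis_half: "t = 1 / 2 \<Longrightarrow> cis (2 * pi * t) = - 1"
  by (simp only:) simp

lemma cis_neq_1:
  assumes "0 < t" "t < 1" shows "cis (2 * pi * t) \<noteq> 1"
proof -
  consider "t < 1 / 2" | "t = 1 / 2" | "1 / 2 < t" by linarith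
  then show ?thesis
    by cases (use assms Im_cis_pos[of t] Im_cis_neg[of t] cis_half[of t] in \<open>auto simp: complex_eq_iff\<close>)
qed

lemma cis_neq_minus_1:
  assumes "0 \<le> t" "t \<le> 1" "t \<noteq> 1 / 2" shows "cis (2 * pi * t) \<noteq> - 1"
proof -
  consider "t = 0" | "0 < t" "t < 1 / 2" | "1 / 2 < t" "t < 1" | "t = 1" using assms by linarith
  then show ?thesis
    by cases (use Im_cis_pos[of t] Im_cis_neg[of t] in \<open>auto simp: complex_eq_iff\<close>)
qed

lemma angle_less_half:
  assumes "norm z = 1" "Im z > 0" shows "0 < angle z" "angle z < 1 / 2"
proof -
  have "z \<noteq> 1" using assms by auto
  note a = angle_bounds[OF assms(1) this]
  show "0 < angle z" by fact
  show "angle z < 1 / 2"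
  proof (rule ccontr)
    assume "\<not> ?thesis"
    then consider "angle z = 1 / 2" | "1 / 2 < angle z" by linarith
    then have "Im (cis (2 * pi * angle z)) \<le> 0"
      by cases (use a Im_cis_neg[of "angle z"] cis_half[of "angle z"] in \<open>auto simp: complex_eq_iff\<close>)
    then show False using cis_angle[OF assms(1)] assms(2) by simp
  qed
qed

lemma angle_greater_half:
  assumes "norm z = 1" "Im z < 0" shows "1 / 2 < angle z" "angle z < 1"
proof -
  have "z \<noteq> 1" using assms by auto
  note a = angle_bounds[OF assms(1) this]
  show "angle z < 1" by fact
  show "1 / 2 < angle z"
  proof (rule ccontr)
    assume "\<not> ?thesis"
    then consider "angle z = 1 / 2" | "angle z < 1 / 2" by linarith
    then have "Im (cis (2 * pi * angle z)) \<ge> 0"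
      by cases (use a Im_cis_pos[of "angle z"] cis_half[of "angle z"] in \<open>auto simp: complex_eq_iff\<close>)
    then show False using cis_angle[OF assms(1)] assms(2) by simp
  qed
qed

subsection \<open>Rotating one coordinate of the cover\<close>

text \<open>The shift of the real coordinate lifts the rotation to the cover: turning coordinate
  \<open>v\<close> by \<open>t\<close> multiplies the product defining the cover by
  \<open>cis (2 * pi * t) powi k\<close>, for \<open>k\<close> the exponent of
  \<open>v\<close>.\<close>

definition turn :: "'v \<Rightarrow> int \<Rightarrow> real \<Rightarrow> ('v \<Rightarrow> complex) \<times> real \<Rightarrow> ('v \<Rightarrow> complex) \<times> real" where
  "turn v k t z = ((fst z)(v := fst z v * cis (2 * pi * t)), snd z + of_int k * t)"

definition torus_space :: "'v set \<Rightarrow> (('v \<Rightarrow> complex) \<times> real) topology" where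
  "torus_space V = prod_topology (product_topology (\<lambda>v. top_of_set (sphere 0 1)) V) euclideanreal"

text \<open>The covers of all subcomplexes lie in one ambient space and obey one equation; over a
  link of \<open>v\<close> the coordinate at \<open>v\<close> is simply 1. \<open>M\<close> is meant
  to contain the empty simplex, whose cell is the base point.\<close>

definition cover_set :: "'v set \<Rightarrow> ('v \<Rightarrow> int) \<Rightarrow> 'v set set \<Rightarrow> (('v \<Rightarrow> complex) \<times> real) set" where
  "cover_set V m M = {(x, s). x \<in> PiE V (\<lambda>_. sphere 0 1) \<and> (\<exists>\<sigma>\<in>M. \<forall>v\<in>V - \<sigma>. x v = 1) \<and>
     (\<Prod>v\<in>V. x v powi m v) = cis (2 * pi * s)}"

definition turn_arc :: "'v \<Rightarrow> int \<Rightarrow> real \<Rightarrow> real \<Rightarrow> real \<times> (('v \<Rightarrow> complex) \<times> real) \<Rightarrow> ('v \<Rightarrow> complex) \<times> real" where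
  "turn_arc v k b c = (\<lambda>(u, z). turn v k (b + u * c) z)"

definition around ::
    "'v \<Rightarrow> int \<Rightarrow> int \<Rightarrow> (('v \<Rightarrow> complex) \<times> real, 'k) kchain \<Rightarrow> (('v \<Rightarrow> complex) \<times> real, 'k::field) kchain" where
  "around v k = homotop3 (turn_arc v k 0 (1 / 4)) (turn_arc v k (1 / 4) (1 / 2)) (turn_arc v k (3 / 4) (1 / 4))"

lemma turn_simps [simp]:
  "fst (turn v k t z) v = fst z v * cis (2 * pi * t)" "w \<noteq> v \<Longrightarrow> fst (turn v k t z) w = fst z w"
  by (auto simp: turn_def)

lemma turn_0 [simp]: "turn v k 0 z = z"
  by (simp add: turn_def)

lemma turn_1: "turn v k 1 z = deck k z"
  by (cases z) (simp add: turn_def deck_def)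

lemma turn_turn: "turn v k a (turn v k b z) = turn v k (a + b) z"
  by (simp add: turn_def mult.assoc cis_mult distrib_left add.commute)

lemma deck_turn: "deck j (turn v k t z) = turn v k t (deck j z)"
  by (cases z) (simp add: turn_def deck_def)

lemma topspace_torus_space: "topspace (torus_space V) = PiE V (\<lambda>_. sphere 0 1) \<times> UNIV"
  by (simp add: torus_space_def)

lemma cover_set_topspace: "cover_set V m M \<subseteq> topspace (torus_space V)"
  by (auto simp: cover_set_def topspace_torus_space)

lemma cover_set_mono: "M \<subseteq> N \<Longrightarrow> cover_set V m M \<subseteq> cover_set V m N"
  by (auto simp: cover_set_def)

lemma continuous_map_coordinate:
  assumes "v \<in> V" shows "continuous_map (torus_space V) (top_of_set (sphere 0 1)) (\<lambda>z. fst z v)"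
proof -
  have "continuous_map (torus_space V) (product_topology (\<lambda>v. top_of_set (sphere (0::complex) 1)) V) fst"
    unfolding torus_space_def by (rule continuous_map_fst)
  from continuous_map_compose[OF this continuous_map_product_projection[OF assms]]
  show ?thesis by (simp add: o_def)
qed

lemma continuous_map_turn:
  assumes v: "v \<in> V" and t: "continuous_map X euclideanreal t" and g: "continuous_map X (torus_space V) g"
  shows "continuous_map X (torus_space V) (\<lambda>w. turn v k (t w) (g w))"
proof -
  have coord: "continuous_map X (top_of_set (sphere 0 1)) (\<lambda>w. fst (g w) u)" if "u \<in> V" for u
    using continuous_map_compose[OF g continuous_map_coordinate[OF that]] by (simp add: o_def)
  have gV: "fst (g w) \<in> PiE V (\<lambda>_. sphere 0 1)" if "w \<in> topspace X" for w
  proof -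
    have "g w \<in> topspace (torus_space V)" using that g by (simp add: continuous_map_def Pi_iff)
    then show ?thesis by (simp add: topspace_torus_space mem_Times_iff)
  qed
  have "continuous_map X euclidean (\<lambda>w. fst (g w) v)"
    using coord[OF v] continuous_map_into_fulltopology by blast
  then have pair: "continuous_map X euclidean (\<lambda>w. (fst (g w) v, t w))"
    using t by (simp add: continuous_map_paired flip: prod_topology_euclidean)
  have "continuous_map euclidean euclidean (\<lambda>p. fst p * cis (2 * pi * snd p))"
    unfolding continuous_map_iff_continuous2 cis_conv_exp by (intro continuous_intros)
  from continuous_map_compose[OF pair this]
  have mult: "continuous_map X euclidean (\<lambda>w. fst (g w) v * cis (2 * pi * t w))" by (simp add: o_def)
  have "continuous_map X (product_topology (\<lambda>v. top_of_set (sphere (0::complex) 1)) V)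
      (\<lambda>w. (fst (g w))(v := fst (g w) v * cis (2 * pi * t w)))"
  proof (rule continuous_map_coordinatewise_then_product)
    show "((fst (g w))(v := fst (g w) v * cis (2 * pi * t w))) u = undefined" if "u \<notin> V" "w \<in> topspace X" for u w
      using gV[OF that(2)] that(1) v by (auto simp: PiE_def extensional_def)
    fix u assume u: "u \<in> V"
    show "continuous_map X (top_of_set (sphere 0 1)) (\<lambda>w. ((fst (g w))(v := fst (g w) v * cis (2 * pi * t w))) u)"
    proof (cases "u = v")
      case True
      then show ?thesis
        using mult gV v by (auto simp: continuous_map_in_subtopology norm_mult PiE_def Pi_def)
    qed (use coord[OF u] in simp)
  qed
  moreover have "continuous_map X euclideanreal (\<lambda>w. snd (g w) + of_int k * t w)"
  proof (intro continuous_map_add continuous_map_real_mult t)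
    show "continuous_map X euclideanreal (\<lambda>w. snd (g w))"
      using continuous_map_compose[OF g[unfolded torus_space_def] continuous_map_snd] by (simp add: o_def)
  qed auto
  ultimately show ?thesis
    unfolding torus_space_def turn_def by (simp add: continuous_map_paired)
qed

section \<open>Rotation on the covers of a complex and of the link and deletion of a vertex\<close>

locale toric_vertex =
  fixes V :: "'v set" and m :: "'v \<Rightarrow> int" and M :: "'v set set" and v :: 'v
  assumes fin: "finite V" and v: "v \<in> V"
    and down: "\<And>\<sigma> \<tau>. \<sigma> \<in> M \<Longrightarrow> \<tau> \<subseteq> \<sigma> \<Longrightarrow> \<tau> \<in> M"
begin

abbreviation "X \<equiv> cover_set V m M"
abbreviation "XK \<equiv> cover_set V m (link v M)"
abbreviation "XD \<equiv> cover_set V m (deletion v M)"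
abbreviation "rot \<equiv> turn v (m v)"

lemma norm_coord: "z \<in> cover_set V m N \<Longrightarrow> norm (fst z v) = 1"
  using v by (auto simp: cover_set_def PiE_def Pi_def)

text \<open>The real shift in \<open>turn\<close> keeps the equation of the cover, so only a simplex
  carrying the new point has to be supplied.\<close>

lemma rot_cover_set:
  assumes z: "z \<in> cover_set V m N" and \<sigma>: "\<sigma> \<in> N'" "\<And>w. w \<in> V - \<sigma> \<Longrightarrow> fst (rot t z) w = 1"
  shows "rot t z \<in> cover_set V m N'"
proof -
  obtain x s where xs: "z = (x, s)" by (cases z)
  have x: "x \<in> PiE V (\<lambda>_. sphere 0 1)" and p: "(\<Prod>w\<in>V. x w powi m w) = cis (2 * pi * s)"
    using z by (auto simp: xs cover_set_def)
  have "(\<Prod>w\<in>V. (x(v := x v * cis (2 * pi * t))) w powi m w)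
      = (x v * cis (2 * pi * t)) powi m v * (\<Prod>w\<in>V - {v}. x w powi m w)"
    by (subst prod.remove[OF fin v]) (auto intro: prod.cong)
  also have "\<dots> = cis (2 * pi * t) powi m v * (\<Prod>w\<in>V. x w powi m w)"
    using prod.remove[OF fin v, of "\<lambda>w. x w powi m w"] by (simp add: power_int_mult_distrib mult_ac)
  also have "\<dots> = cis (2 * pi * (s + of_int (m v) * t))"
    by (simp add: p cis_power_int cis_mult algebra_simps)
  finally have prod: "(\<Prod>w\<in>V. (x(v := x v * cis (2 * pi * t))) w powi m w) = cis (2 * pi * (s + of_int (m v) * t))" .
  have "x(v := x v * cis (2 * pi * t)) \<in> PiE V (\<lambda>_. sphere 0 1)"
    using x v by (auto simp: PiE_def Pi_def extensional_def norm_mult)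
  moreover have "\<exists>\<sigma>\<in>N'. \<forall>w\<in>V - \<sigma>. (x(v := x v * cis (2 * pi * t))) w = 1"
    using \<sigma> by (intro bexI[of _ \<sigma>]) (auto simp: xs turn_def)
  ultimately show ?thesis using prod by (simp add: xs turn_def cover_set_def)
qed

lemma cover_setE:
  assumes "z \<in> cover_set V m N"
  obtains \<sigma> where "\<sigma> \<in> N" "\<And>w. w \<in> V - \<sigma> \<Longrightarrow> fst z w = 1"
  using assms unfolding cover_set_def by auto

text \<open>A simplex carrying a point whose coordinate at \<open>v\<close> is not 1 contains
  \<open>v\<close>, so that coordinate may move freely.\<close>

lemma rot_X:
  assumes z: "z \<in> X" "fst z v \<noteq> 1" shows "rot t z \<in> X"
proof -
  obtain \<sigma> where \<sigma>: "\<sigma> \<in> M" "\<And>w. w \<in> V - \<sigma> \<Longrightarrow> fst z w = 1" using z(1) by (rule cover_setE) blast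
  have "v \<in> \<sigma>" using \<sigma>(2)[of v] v z(2) by blast
  then have "fst (rot t z) w = 1" if "w \<in> V - \<sigma>" for w
    using \<sigma>(2)[OF that] that by (cases "w = v") auto
  then show ?thesis using rot_cover_set[OF z(1) \<sigma>(1)] by blast
qed

lemma rot_XK_X: "z \<in> XK \<Longrightarrow> rot t z \<in> X"
proof -
  assume z: "z \<in> XK"
  then obtain \<sigma> where \<sigma>: "\<sigma> \<in> link v M" "\<And>w. w \<in> V - \<sigma> \<Longrightarrow> fst z w = 1" by (rule cover_setE) blast
  show ?thesis
  proof (rule rot_cover_set[OF z])
    show "insert v \<sigma> \<in> M" using \<sigma>(1) by (simp add: link_def)
    show "fst (rot t z) w = 1" if "w \<in> V - insert v \<sigma>" for w using \<sigma>(2)[of w] that by simp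
  qed
qed

lemma coord_XK: "z \<in> XK \<Longrightarrow> fst z v = 1"
  using v by (auto simp: cover_set_def link_def)

lemma coord_XD: "z \<in> XD \<Longrightarrow> fst z v = 1"
  using v by (auto simp: cover_set_def deletion_def)

text \<open>The carrying simplex contains \<open>v\<close>. Once the coordinate is back at 1, the
  simplex without \<open>v\<close> carries the point, and it lies in the link.\<close>

lemma rot_X_XK:
  assumes z: "z \<in> X" "fst z v \<noteq> 1" "fst z v * cis (2 * pi * t) = 1" shows "rot t z \<in> XK"
proof -
  obtain \<sigma> where \<sigma>: "\<sigma> \<in> M" "\<And>w. w \<in> V - \<sigma> \<Longrightarrow> fst z w = 1" using z(1) by (rule cover_setE) blast
  have "v \<in> \<sigma>" using \<sigma>(2)[of v] v z(2) by blast
  show ?thesis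
  proof (rule rot_cover_set[OF z(1)])
    show "\<sigma> - {v} \<in> link v M" using \<sigma>(1) \<open>v \<in> \<sigma>\<close> by (simp add: link_def insert_absorb)
    show "fst (rot t z) w = 1" if "w \<in> V - (\<sigma> - {v})" for w
      using \<sigma>(2)[of w] that z(3) by (cases "w = v") auto
  qed
qed

lemma X_XD:
  assumes z: "z \<in> X" "fst z v = 1" shows "z \<in> XD"
proof -
  obtain \<sigma> where \<sigma>: "\<sigma> \<in> M" "\<And>w. w \<in> V - \<sigma> \<Longrightarrow> fst z w = 1" using z(1) by (rule cover_setE) blast
  \<comment> \<open>The turn by 0 is the identity; it serves to exchange the carrying
    simplex.\<close>
  have "rot 0 z \<in> XD"
  proof (rule rot_cover_set[OF z(1)])
    show "\<sigma> - {v} \<in> deletion v M" using \<sigma>(1) down by (auto simp: deletion_def)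
    show "fst (rot 0 z) w = 1" if "w \<in> V - (\<sigma> - {v})" for w
      using \<sigma>(2)[of w] that z(2) by (cases "w = v") auto
  qed
  then show ?thesis by simp
qed

lemma XK_XD: "XK \<subseteq> XD"
  using down by (intro cover_set_mono) (auto simp: link_def deletion_def)

lemma XD_X: "XD \<subseteq> X"
  by (intro cover_set_mono) (auto simp: deletion_def)

abbreviation "U \<equiv> {z \<in> X. fst z v \<noteq> - 1}"
abbreviation "W \<equiv> {z \<in> X. fst z v \<noteq> 1}"
abbreviation "A1 \<equiv> {z \<in> X. Im (fst z v) > 0}"
abbreviation "A2 \<equiv> {z \<in> X. Im (fst z v) < 0}"

lemma openin_coordinate: "open S \<Longrightarrow> openin (subtopology (torus_space V) X) {z \<in> X. fst z v \<in> S}"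
proof -
  assume S: "open S"
  have "continuous_map (subtopology (torus_space V) X) euclidean (\<lambda>z. fst z v)"
    using continuous_map_from_subtopology[OF continuous_map_coordinate[OF v]] continuous_map_into_fulltopology by blast
  then have "openin (subtopology (torus_space V) X) {z \<in> topspace (subtopology (torus_space V) X). fst z v \<in> S}"
    by (rule openin_continuous_map_preimage) (use S in simp)
  moreover have "topspace (subtopology (torus_space V) X) = X"
    using cover_set_topspace[of V m M] by auto
  ultimately show ?thesis by (simp only:)
qed

lemma continuous_map_fun_coordinate:
  assumes S: "S \<subseteq> topspace (torus_space V)" "\<And>z. z \<in> S \<Longrightarrow> fst z v \<in> D" and a: "continuous_on D a"
  shows "continuous_map (subtopology (torus_space V) S) euclideanreal (\<lambda>z. a (fst z v))"
proof -
  have "continuous_map (subtopology (torus_space V) S) euclidean (\<lambda>z. fst z v)"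
    using continuous_map_from_subtopology[OF continuous_map_coordinate[OF v]] continuous_map_into_fulltopology by blast
  then have "continuous_map (subtopology (torus_space V) S) (top_of_set D) (\<lambda>z. fst z v)"
    using S by (auto simp: continuous_map_in_subtopology)
  moreover have "continuous_map (top_of_set D) euclideanreal a" using a by simp
  ultimately have "continuous_map (subtopology (torus_space V) S) euclideanreal (a \<circ> (\<lambda>z. fst z v))"
    by (rule continuous_map_compose)
  then show ?thesis by (simp add: o_def)
qed

lemma map_on_rot:
  assumes S: "S \<subseteq> topspace (torus_space V)" "\<And>z. z \<in> S \<Longrightarrow> fst z v \<in> D" and a: "continuous_on D a"
    and im: "\<And>z. z \<in> S \<Longrightarrow> rot (a (fst z v)) z \<in> S'"
  shows "map_on (torus_space V) S S' (\<lambda>z. rot (a (fst z v)) z)"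
  unfolding map_on_def continuous_map_in_subtopology
proof
  show "continuous_map (subtopology (torus_space V) S) (torus_space V) (\<lambda>z. rot (a (fst z v)) z)"
    by (intro continuous_map_turn v continuous_map_fun_coordinate[OF S a] continuous_map_from_subtopology) auto
qed (use S(1) im in auto)

lemma homotopy_on_rot:
  assumes S: "S \<subseteq> topspace (torus_space V)" "\<And>z. z \<in> S \<Longrightarrow> fst z v \<in> D" and a: "continuous_on D a"
    and im: "\<And>u z. 0 \<le> u \<Longrightarrow> u \<le> 1 \<Longrightarrow> z \<in> S \<Longrightarrow> rot (b + u * (c + a (fst z v))) z \<in> S'"
  shows "homotopy_on (torus_space V) S S' (\<lambda>(u, z). rot (b + u * (c + a (fst z v))) z)"
  unfolding homotopy_on_def continuous_map_in_subtopology
proof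
  let ?P = "prod_topology unit_interval (subtopology (torus_space V) S)"
  have u: "continuous_map ?P euclideanreal fst"
    using continuous_map_fst continuous_map_into_fulltopology by blast
  have z: "continuous_map ?P (torus_space V) snd"
    using continuous_map_snd continuous_map_into_fulltopology by blast
  have "continuous_map ?P euclideanreal (\<lambda>p. a (fst (snd p) v))"
    using continuous_map_compose[OF continuous_map_snd continuous_map_fun_coordinate[OF S a]] by (simp add: o_def)
  then have "continuous_map ?P euclideanreal (\<lambda>p. b + fst p * (c + a (fst (snd p) v)))"
    by (intro continuous_map_add continuous_map_real_mult u) auto
  from continuous_map_turn[OF v this z]
  show "continuous_map ?P (torus_space V) (\<lambda>(u, z). rot (b + u * (c + a (fst z v))) z)"
    by (simp add: case_prod_unfold)
  show "(\<lambda>(u, z). rot (b + u * (c + a (fst z v))) z) \<in> topspace ?P \<rightarrow> S'"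
    using S(1) im by auto
qed

end


context toric_vertex
begin

lemma coord_rot:
  assumes "z \<in> X" shows "fst (rot t z) v = cis (2 * pi * (angle (fst z v) + t))"
    "fst (rot t z) v = cis (2 * pi * (signed_angle (fst z v) + t))"
  using cis_angle[OF norm_coord[OF assms]] cis_signed_angle[OF norm_coord[OF assms]]
  by (simp_all add: distrib_left flip: cis_mult)

lemma in_U: "t \<noteq> 1 / 2 \<Longrightarrow> 0 \<le> t \<Longrightarrow> t \<le> 1 \<Longrightarrow> z \<in> XK \<Longrightarrow> rot t z \<in> U"
  using rot_XK_X[of z t] coord_XK[of z] cis_neq_minus_1[of t] by simp

lemma in_W: "0 < t \<Longrightarrow> t < 1 \<Longrightarrow> z \<in> XK \<Longrightarrow> rot t z \<in> W"
  using rot_XK_X[of z t] coord_XK[of z] cis_neq_1[of t] by simp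

lemma convex_between:
  fixes a b c u l r :: real
  assumes "0 \<le> u" "u \<le> 1" "l < a" "a < r" "l < c" "c < r" shows "l < a + u * (c - a)" "a + u * (c - a) < r"
proof -
  have "a + u * (c - a) = (1 - u) * a + u * c" by (simp add: algebra_simps)
  moreover have "(1 - u) * l + u * l = l" "(1 - u) * r + u * r = r" by (simp_all add: algebra_simps)
  moreover have "(1 - u) * l + u * l < (1 - u) * a + u * c" "(1 - u) * a + u * c < (1 - u) * r + u * r"
    using assms by (cases "u = 0"; auto intro!: add_le_less_mono mult_left_mono)+
  ultimately show "l < a + u * (c - a)" "a + u * (c - a) < r" by linarith+
qed

text \<open>Off coordinate 1 the space is a product of \<open>XK\<close> with an open arc, so
  turning back by \<open>angle\<close> projects to \<open>XK\<close>; off coordinate -1, turning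
  back by \<open>signed_angle\<close> retracts to \<open>XD\<close>. The turns by 1/4 and 3/4 mark a
  point in each open half circle. Terms such as \<open>0 + u * (0 + ...)\<close> match the shape of
  \<open>homotopy_on_rot\<close>.\<close>

lemma circle_cut_toric:
  "circle_cut (torus_space V) X U W A1 A2 XK XD (rot (1 / 4)) (rot (3 / 4)) (rot 1)
     (\<lambda>z. rot (- angle (fst z v)) z) (\<lambda>z. rot (- signed_angle (fst z v)) z)
     (turn_arc v (m v) 0 (1 / 4)) (turn_arc v (m v) (1 / 4) (1 / 2)) (turn_arc v (m v) (3 / 4) (1 / 4))
     (\<lambda>(u, z). rot (0 + u * (1 / 4 + - angle (fst z v))) z)
     (\<lambda>(u, z). rot (0 + u * (3 / 4 + - angle (fst z v))) z)
     (\<lambda>(u, z). rot (0 + u * (0 + - signed_angle (fst z v))) z)"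
proof
  let ?E = "torus_space V"
  note top = order_trans[OF _ cover_set_topspace[of V m M]]
    cover_set_topspace[of V m "link v M"] cover_set_topspace[of V m "deletion v M"] cover_set_topspace[of V m M]
  have "openin (subtopology ?E X) {z \<in> X. fst z v \<in> - {- 1}}" by (rule openin_coordinate) auto
  then show "openin (subtopology ?E X) U" by simp
  have "openin (subtopology ?E X) {z \<in> X. fst z v \<in> - {1}}" by (rule openin_coordinate) auto
  then show "openin (subtopology ?E X) W" by simp
  have "openin (subtopology ?E X) {z \<in> X. fst z v \<in> {x. Im x > 0}}" by (rule openin_coordinate[OF open_halfspace_Im_gt])
  then show "openin (subtopology ?E X) A1" by simp
  have "openin (subtopology ?E X) {z \<in> X. fst z v \<in> {x. Im x < 0}}" by (rule openin_coordinate[OF open_halfspace_Im_lt])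
  then show "openin (subtopology ?E X) A2" by simp
  show "X \<subseteq> U \<union> W" by auto
  show "A1 \<inter> A2 = {}" by auto
  \<comment> \<open>The only real points of the unit circle are 1 and -1.\<close>
  have "Im (fst z v) \<noteq> 0 \<longleftrightarrow> fst z v \<noteq> 1 \<and> fst z v \<noteq> - 1" if "z \<in> X" for z
    using norm_coord[OF that] by (auto simp: complex_eq_iff cmod_def real_sqrt_eq_1_iff power2_eq_1_iff)
  then show "U \<inter> W = A1 \<union> A2" by force
  show "XK \<subseteq> XD" by (rule XK_XD)
  show "XD \<subseteq> U" using XD_X coord_XD by fastforce
  have sweep: "homotopy_on ?E XK S (turn_arc v (m v) b c)" if "\<And>u z. 0 \<le> u \<Longrightarrow> u \<le> 1 \<Longrightarrow> z \<in> XK \<Longrightarrow> rot (b + u * c) z \<in> S" for b c S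
    using homotopy_on_rot[where S = XK and S' = S and b = b and c = c and a = "\<lambda>_. 0" and D = UNIV] top that
    by (simp add: turn_arc_def)
  show "homotopy_on ?E XK U (turn_arc v (m v) 0 (1 / 4))" by (rule sweep, rule in_U) auto
  show "homotopy_on ?E XK W (turn_arc v (m v) (1 / 4) (1 / 2))" by (rule sweep, rule in_W) auto
  show "homotopy_on ?E XK U (turn_arc v (m v) (3 / 4) (1 / 4))" by (rule sweep, rule in_U) auto
  show "turn_arc v (m v) 0 (1 / 4) (0, x) = x" for x by (simp add: turn_arc_def)
  show "turn_arc v (m v) 0 (1 / 4) (1, x) = rot (1 / 4) x" for x by (simp add: turn_arc_def)
  show "turn_arc v (m v) (1 / 4) (1 / 2) (0, x) = rot (1 / 4) x" for x by (simp add: turn_arc_def)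
  show "turn_arc v (m v) (1 / 4) (1 / 2) (1, x) = rot (3 / 4) x" for x by (simp add: turn_arc_def)
  show "turn_arc v (m v) (3 / 4) (1 / 4) (0, x) = rot (3 / 4) x" for x by (simp add: turn_arc_def)
  show "turn_arc v (m v) (3 / 4) (1 / 4) (1, x) = rot 1 x" for x by (simp add: turn_arc_def)
  have const: "map_on ?E XK S (rot t)" if "\<And>z. z \<in> XK \<Longrightarrow> rot t z \<in> S" for t S
    using map_on_rot[where S = XK and S' = S and a = "\<lambda>_. t" and D = UNIV] top that by simp
  show "map_on ?E XK A1 (rot (1 / 4))"
    by (rule const) (use rot_XK_X coord_XK in \<open>simp add: cos_45 sin_45\<close>)
  show "map_on ?E XK A2 (rot (3 / 4))"
  proof (rule const)
    fix z assume "z \<in> XK"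
    then show "rot (3 / 4) z \<in> A2" using rot_XK_X[of z "3 / 4"] coord_XK[of z] Im_cis_neg[of "3 / 4"] by simp
  qed
  show "map_on ?E XK XD (rot 1)"
  proof (rule const)
    fix z assume z: "z \<in> XK"
    then show "rot 1 z \<in> XD" by (intro X_XD) (auto simp: rot_XK_X coord_XK)
  qed
  have W1: "fst z v \<in> sphere 0 1 - {1}" if "z \<in> W" for z using that norm_coord[of z M] by simp
  have U1: "fst z v \<in> sphere 0 1 - {- 1}" if "z \<in> U" for z using that norm_coord[of z M] by simp
  have minus_angle: "continuous_on (sphere 0 1 - {1}) (\<lambda>x. - angle x)"
    by (intro continuous_intros continuous_on_angle)
  have minus_signed: "continuous_on (sphere 0 1 - {- 1}) (\<lambda>x. - signed_angle x)"
    by (intro continuous_intros continuous_on_signed_angle)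
  show "map_on ?E W XK (\<lambda>z. rot (- angle (fst z v)) z)"
  proof (rule map_on_rot[where a = "\<lambda>x. - angle x", OF _ W1 minus_angle])
    fix z assume z: "z \<in> W"
    then show "rot (- angle (fst z v)) z \<in> XK"
      using coord_rot(1)[of z "- angle (fst z v)"] by (intro rot_X_XK) auto
  qed (use top in auto)
  \<comment> \<open>At coordinate 1 the rotation is trivial; elsewhere it lands even in the smaller
    set \<open>XK\<close>.\<close>
  have to_XD: "rot (- signed_angle (fst z v)) z \<in> XD" if z: "z \<in> U" for z
  proof (cases "fst z v = 1")
    case True then show ?thesis using X_XD z by simp
  next
    case False
    then have "rot (- signed_angle (fst z v)) z \<in> XK"
      using coord_rot(2)[of z "- signed_angle (fst z v)"] z by (intro rot_X_XK) auto
    then show ?thesis using XK_XD by blast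
  qed
  show "map_on ?E U XD (\<lambda>z. rot (- signed_angle (fst z v)) z)"
    by (rule map_on_rot[where a = "\<lambda>x. - signed_angle x", OF _ U1 minus_signed]) (use top to_XD in auto)
  have q: "rot (- angle (fst (rot t x) v)) (rot t x) = x" if "0 < t" "t < 1" "x \<in> XK" for t x
    using that by (simp add: coord_XK angle_cis turn_turn)
  show "rot (- angle (fst (rot (1 / 4) x) v)) (rot (1 / 4) x) = x" if "x \<in> XK" for x by (rule q) (use that in auto)
  show "rot (- angle (fst (rot (3 / 4) x) v)) (rot (3 / 4) x) = x" if "x \<in> XK" for x by (rule q) (use that in auto)
  have G: "homotopy_on ?E S S (\<lambda>(u, z). rot (0 + u * (c + - angle (fst z v))) z)"
    if S: "S \<subseteq> W" "\<And>u z. 0 \<le> u \<Longrightarrow> u \<le> 1 \<Longrightarrow> z \<in> S \<Longrightarrow> rot (u * (c - angle (fst z v))) z \<in> S" for S c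
  proof (rule homotopy_on_rot[where D = "sphere 0 1 - {1}" and a = "\<lambda>x. - angle x", OF _ _ minus_angle])
    show "S \<subseteq> topspace ?E" by (rule top(1)) (use S(1) in auto)
  qed (use S W1 in auto)
  have rotc: "fst (rot (u * (c - angle (fst z v))) z) v = cis (2 * pi * (angle (fst z v) + u * (c - angle (fst z v))))"
    if "z \<in> W" for u c z using that by (simp only: coord_rot(1)[of z] mem_Collect_eq)
  show "homotopy_on ?E W W (\<lambda>(u, z). rot (0 + u * (1 / 4 + - angle (fst z v))) z)"
  proof (rule G)
    fix u z assume u: "0 \<le> u" "u \<le> (1::real)" and z: "z \<in> W"
    have "cis (2 * pi * (angle (fst z v) + u * (1 / 4 - angle (fst z v)))) \<noteq> 1"
      by (rule cis_neq_1; rule convex_between[where l = 0 and r = 1]) (use u z angle_bounds[of "fst z v"] norm_coord[of z M] in auto)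
    then show "rot (u * (1 / 4 - angle (fst z v))) z \<in> W"
      using rotc[OF z] rot_X z by simp
  qed simp
  show "homotopy_on ?E A1 A1 (\<lambda>(u, z). rot (0 + u * (1 / 4 + - angle (fst z v))) z)"
  proof (rule G)
    show A1W: "A1 \<subseteq> W" by auto
    fix u z assume u: "0 \<le> u" "u \<le> (1::real)" and z: "z \<in> A1"
    have "Im (cis (2 * pi * (angle (fst z v) + u * (1 / 4 - angle (fst z v))))) > 0"
      by (rule Im_cis_pos; rule convex_between[where l = 0 and r = "1 / 2"]) (use u z angle_less_half[of "fst z v"] norm_coord[of z M] in auto)
    then show "rot (u * (1 / 4 - angle (fst z v))) z \<in> A1"
      using rotc[OF subsetD[OF A1W z]] rot_X[of z] subsetD[OF A1W z] by simp
  qed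
  show "homotopy_on ?E A2 A2 (\<lambda>(u, z). rot (0 + u * (3 / 4 + - angle (fst z v))) z)"
  proof (rule G)
    show A2W: "A2 \<subseteq> W" by auto
    fix u z assume u: "0 \<le> u" "u \<le> (1::real)" and z: "z \<in> A2"
    have "Im (cis (2 * pi * (angle (fst z v) + u * (3 / 4 - angle (fst z v))))) < 0"
      by (rule Im_cis_neg; rule convex_between[where l = "1 / 2" and r = 1]) (use u z angle_greater_half[of "fst z v"] norm_coord[of z M] in auto)
    then show "rot (u * (3 / 4 - angle (fst z v))) z \<in> A2"
      using rotc[OF subsetD[OF A2W z]] rot_X[of z] subsetD[OF A2W z] by simp
  qed
  show "(\<lambda>(u, z). rot (0 + u * (1 / 4 + - angle (fst z v))) z) (1, x) = rot (1 / 4) (rot (- angle (fst x v)) x)" for x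
    by (simp add: turn_turn)
  show "(\<lambda>(u, z). rot (0 + u * (3 / 4 + - angle (fst z v))) z) (1, x) = rot (3 / 4) (rot (- angle (fst x v)) x)" for x
    by (simp add: turn_turn)
  show "homotopy_on ?E U X (\<lambda>(u, z). rot (0 + u * (0 + - signed_angle (fst z v))) z)"
  proof (rule homotopy_on_rot[where D = "sphere 0 1 - {- 1}" and a = "\<lambda>x. - signed_angle x", OF _ U1 minus_signed])
    fix u z assume "z \<in> U"
    then show "rot (0 + u * (0 + - signed_angle (fst z v))) z \<in> X"
      using rot_X[of z] by (cases "fst z v = 1") auto
  qed (use top in auto)
  \<comment> \<open>On \<open>XD\<close> the signed angle is 0, so this homotopy is
    constant.\<close>
  show "homotopy_on ?E XD XD (\<lambda>(u, z). rot (0 + u * (0 + - signed_angle (fst z v))) z)"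
    by (rule homotopy_on_rot[where D = "sphere 0 1 - {- 1}" and a = "\<lambda>x. - signed_angle x", OF _ _ minus_signed])
       (use top coord_XD in auto)
qed auto

end

subsection \<open>Chains of the fibre over the base point\<close>

definition base_point :: "'v set \<Rightarrow> int \<Rightarrow> ('v \<Rightarrow> complex) \<times> real" where
  "base_point V j = (restrict (\<lambda>_. 1) V, of_int j)"

text \<open>Over the base point the equation of the cover reads \<open>cis (2 * pi * s) = 1\<close>,
  that is, \<open>s\<close> is an integer.\<close>

lemma cover_set_base:
  fixes V :: "'v set"
  assumes "finite V" shows "cover_set V m {{}} = range (base_point V)"
proof (rule Set.set_eqI)
  fix z :: "('v \<Rightarrow> complex) \<times> real"
  obtain x s where z: "z = (x, s)" by (cases z)
  have "cis (2 * pi * s) = 1 \<longleftrightarrow> (\<exists>j. s = of_int j)"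
  proof
    assume "cis (2 * pi * s) = 1"
    then have "cos (2 * pi * s) = 1" by (simp add: complex_eq_iff)
    then show "\<exists>j. s = of_int j" by (auto simp: cos_one_2pi_int)
  next
    assume "\<exists>j. s = of_int j"
    then show "cis (2 * pi * s) = 1" using cis_multiple_2pi by (auto simp: Ints_def)
  qed
  moreover have "x \<in> PiE V (\<lambda>_. sphere 0 1) \<and> (\<forall>v\<in>V. x v = 1) \<longleftrightarrow> x = restrict (\<lambda>_. 1) V"
    by (auto simp: fun_eq_iff PiE_def extensional_def)
  moreover have "(\<Prod>v\<in>V. x v powi m v) = 1" if "\<forall>v\<in>V. x v = 1"
    using that by simp
  ultimately show "z \<in> cover_set V m {{}} \<longleftrightarrow> z \<in> range (base_point V)"
    by (fastforce simp: z cover_set_def base_point_def)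
qed

definition point_simplex :: "'v set \<Rightarrow> nat \<Rightarrow> int \<Rightarrow> (nat \<Rightarrow> real) \<Rightarrow> ('v \<Rightarrow> complex) \<times> real" where
  "point_simplex V n j = restrict (\<lambda>_. base_point V j) (standard_simplex n)"

definition point_chain :: "'v set \<Rightarrow> nat \<Rightarrow> 'k laurent \<Rightarrow> (('v \<Rightarrow> complex) \<times> real, 'k::field) kchain" where
  "point_chain V n = lin_extend (\<lambda>j. Poly_Mapping.single (point_simplex V n j) 1)"

definition point_index :: "((nat \<Rightarrow> real) \<Rightarrow> ('v \<Rightarrow> complex) \<times> real) \<Rightarrow> int" where
  "point_index \<sigma> = \<lfloor>snd (\<sigma> (\<lambda>i. if i = 0 then 1 else 0))\<rfloor>"

lemma point_index_simplex [simp]: "point_index (point_simplex V n j) = j"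
  by (simp add: point_index_def point_simplex_def base_point_def)

lemma singular_simplex_point:
  assumes "finite V"
  shows "singular_simplex n (subtopology (torus_space V) (cover_set V m {{}})) (point_simplex V n j)"
proof -
  have "base_point V j \<in> cover_set V m {{}}" using cover_set_base[OF assms] by blast
  then show ?thesis
    using cover_set_topspace[of V m "{{}}"] unfolding singular_simplex_def point_simplex_def
    by (auto intro!: continuous_map_eq[where f = "\<lambda>_. base_point V j"])
qed

lemma connected_of_int: "connected S \<Longrightarrow> S \<subseteq> range of_int \<Longrightarrow> a \<in> S \<Longrightarrow> b \<in> S \<Longrightarrow> a = (b::real)"
proof (induction a b rule: linorder_wlog)
  case (le a b)
  show ?case
  proof (rule ccontr)
    assume "a \<noteq> b"
    obtain i j where ij: "a = of_int i" "b = of_int j" using le by blast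
    then have "i < j" using le \<open>a \<noteq> b\<close> by auto
    then have "a \<le> a + 1 / 2" "a + 1 / 2 \<le> b" by (auto simp: ij)
    then have "a + 1 / 2 \<in> S" using le connected_contains_Icc[of S a b] by auto
    then obtain k where k: "a + 1 / 2 = of_int k" using le by blast
    then have "of_int (2 * i + 1) = (of_int (2 * k) :: real)" by (simp add: ij)
    then show False by presburger
  qed
qed auto

text \<open>The real coordinate has connected image inside the integers, so the simplex is constant
  and its value at one vertex determines it.\<close>

lemma singular_simplex_over_base:
  assumes "finite V" and \<sigma>: "singular_simplex n (subtopology (torus_space V) (cover_set V m {{}})) \<sigma>"
  shows "\<sigma> = point_simplex V n (point_index \<sigma>)"
proof -
  have im: "\<sigma> x \<in> range (base_point V)" if "x \<in> standard_simplex n" for x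
    using \<sigma> that cover_set_base[OF assms(1), of m] by (auto simp: singular_simplex_subtopology)
  have "continuous_map (simplex_space n) (torus_space V) \<sigma>"
    using \<sigma> by (auto simp: singular_simplex_def continuous_map_in_subtopology)
  then have "continuous_map (simplex_space n) euclideanreal (snd \<circ> \<sigma>)"
    unfolding torus_space_def by (rule continuous_map_compose) (rule continuous_map_snd)
  then have "connectedin euclideanreal ((snd \<circ> \<sigma>) ` standard_simplex n)"
    by (metis connectedin_absolute connectedin_continuous_map_image connectedin_standard_simplex)
  then have con: "connected ((snd \<circ> \<sigma>) ` standard_simplex n)" by simp
  have ints: "(snd \<circ> \<sigma>) ` standard_simplex n \<subseteq> range of_int"
    using im by (fastforce simp: base_point_def)
  let ?e = "\<lambda>i. if i = 0 then 1 else (0::real)"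
  have e: "?e \<in> standard_simplex n" by simp
  show ?thesis
  proof
    fix x
    show "\<sigma> x = point_simplex V n (point_index \<sigma>) x"
    proof (cases "x \<in> standard_simplex n")
      case True
      obtain j where j: "\<sigma> x = base_point V j" using im[OF True] by blast
      have "(snd \<circ> \<sigma>) x = (snd \<circ> \<sigma>) ?e"
        by (rule connected_of_int[OF con ints]) (use True e in blast)+
      then have "of_int j = snd (\<sigma> ?e)" using j by (simp add: base_point_def)
      then have "point_index \<sigma> = j" unfolding point_index_def by (metis floor_of_int)
      then show ?thesis using True j by (simp add: point_simplex_def)
    next
      case False
      then show ?thesis using \<sigma> by (simp add: singular_simplex_def point_simplex_def extensional_def)
    qed
  qed
qed

lemma point_chain_simps [simp]: "point_chain V n 0 = 0" "point_chain V n (a + b) = point_chain V n a + point_chain V n b"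
  by (simp_all add: point_chain_def lin_extend_add)

lemma point_chain_eq_0_iff [simp]: "point_chain V n a = 0 \<longleftrightarrow> a = 0"
proof
  assume "point_chain V n a = 0"
  moreover have "lin_extend (\<lambda>\<sigma>. Poly_Mapping.single (point_index \<sigma>) 1) (point_chain V n a) = a"
    by (simp add: point_chain_def lin_extend_lin_extend lin_extend_id)
  ultimately show "a = 0" by simp
qed simp

lemma kchains_over_base:
  fixes V :: "'v set"
  assumes "finite V"
  shows "(kchains n (subtopology (torus_space V) (cover_set V m {{}})) :: (_, 'k::field) kchain set) = range (point_chain V n)"
proof (intro subset_antisym subsetI)
  fix c :: "(('v \<Rightarrow> complex) \<times> real, 'k) kchain"
  assume c: "c \<in> kchains n (subtopology (torus_space V) (cover_set V m {{}}))"
  have "point_chain V n (lin_extend (\<lambda>\<sigma>. Poly_Mapping.single (point_index \<sigma>) 1) c)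
      = lin_extend (\<lambda>\<sigma>. Poly_Mapping.single \<sigma> 1) c"
    unfolding point_chain_def lin_extend_lin_extend
    by (rule lin_extend_cong) (metis lin_extend_single scl_simps(2) singular_simplex_over_base[OF assms] kchainsD[OF c])
  then show "c \<in> range (point_chain V n)" by (metis lin_extend_id rangeI)
qed (auto simp: point_chain_def intro!: kchains_lin_extend kchains_single singular_simplex_point assms)

text \<open>All \<open>n + 2\<close> faces of a constant simplex agree, and their signs cancel
  unless \<open>n\<close> is odd. The differentials on the fibre are thus alternately 0 and the
  identity, leaving one copy of the ring, in degree 0.\<close>

lemma kboundary_point_chain:
  "kboundary (Suc n) (point_chain V (Suc n) a :: (_, 'k::field) kchain) = (if odd n then point_chain V n a else 0)"
proof -
  have face: "singular_face (Suc n) i (point_simplex V (Suc n) j) = point_simplex V n j" if "i \<le> Suc n" for i j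
    using that simplical_face_in_standard_simplex[of "Suc n" i]
    by (auto simp: singular_face_def point_simplex_def fun_eq_iff)
  have sign: "(\<Sum>i\<le>k. Poly_Mapping.single x ((-1) ^ i :: 'k)) = Poly_Mapping.single x (if even k then 1 else 0)"
    for k and x :: "(nat \<Rightarrow> real) \<Rightarrow> ('a \<Rightarrow> complex) \<times> real"
    by (induction k) (auto simp flip: single_add)
  have "(\<Sum>i\<le>Suc n. Poly_Mapping.single (singular_face (Suc n) i (point_simplex V (Suc n) j)) ((-1) ^ i :: 'k))
      = Poly_Mapping.single (point_simplex V n j) (if even (Suc n) then 1 else 0)" for j
    unfolding sign[symmetric] by (rule sum.cong) (simp_all add: face)
  then show ?thesis
    by (simp add: kboundary_def point_chain_def lin_extend_lin_extend del: sum.atMost_Suc)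
qed

text \<open>The 0-chains of the fibre are free on the base point at 0; the linearity of
  \<open>cell_map\<close> starts here.\<close>

lemma lact_point_chain: "lact 0 a (point_chain V 0 1) = point_chain V 0 a"
proof -
  have 1: "point_chain V 0 (1 :: 'b laurent) = Poly_Mapping.single (point_simplex V 0 0) 1"
    by (simp add: point_chain_def flip: single_one)
  have "simplex_map 0 (deck j) (point_simplex V 0 0) = point_simplex V 0 j" for j
    by (auto simp: simplex_map_def point_simplex_def deck_def base_point_def fun_eq_iff)
  then show ?thesis unfolding lact_def push_def kmap_def 1 by (simp add: point_chain_def)
qed


subsection \<open>Comparison of cellular and singular chains\<close>

definition down_closed :: "'v set set \<Rightarrow> bool" where
  "down_closed M \<longleftrightarrow> (\<forall>\<sigma>\<in>M. \<forall>\<tau>. \<tau> \<subseteq> \<sigma> \<longrightarrow> \<tau> \<in> M)"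

lemma down_closed_deletion: "down_closed M \<Longrightarrow> down_closed (deletion v M)"
  by (auto simp: down_closed_def deletion_def)

lemma down_closed_link: "down_closed M \<Longrightarrow> down_closed (link v M)"
  by (auto simp: down_closed_def link_def) (meson insert_mono)

text \<open>A cell goes to the base point swept around the circles of its vertices, the earliest
  vertex of the list being swept last. So the head of the list can be split off on both sides of the
  comparison.\<close>

primrec cell_map ::
    "'v set \<Rightarrow> ('v \<Rightarrow> int) \<Rightarrow> 'v list \<Rightarrow> int \<Rightarrow> ('v set \<Rightarrow> 'k laurent) \<Rightarrow> (('v \<Rightarrow> complex) \<times> real, 'k::field) kchain" where
  "cell_map V m [] = (\<lambda>i d. if i = 0 then point_chain V 0 (d {}) else 0)"
| "cell_map V m (v # vs) = (\<lambda>i d. cell_map V m vs i (cells_without v d)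
     + around v (m v) (i - 1) (cell_map V m vs (i - 1) (cells_with v d)))"

lemma continuous_map_deck:
  fixes V :: "'v set"
  shows "continuous_map (subtopology (torus_space V) (cover_set V m M)) (subtopology (torus_space V) (cover_set V m M)) (deck j)"
proof -
  have "continuous_map (torus_space V) (torus_space V) (\<lambda>z. (fst z, snd z + of_int j))"
    unfolding torus_space_def continuous_map_pairwise o_def
    by (auto intro!: continuous_map_fst continuous_map_add continuous_map_snd)
  moreover have "(deck j :: ('v \<Rightarrow> complex) \<times> real \<Rightarrow> _) = (\<lambda>z. (fst z, snd z + of_int j))" by (auto simp: deck_def)
  ultimately have "continuous_map (torus_space V) (torus_space V) (deck j)" by (simp only:)
  moreover have "deck j z \<in> cover_set V m M" if "z \<in> cover_set V m M" for z
  proof -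
    have "cis (2 * pi * of_int j) = 1" using cis_multiple_2pi[of "of_int j"] by simp
    then have "cis (2 * pi * (s + of_int j)) = cis (2 * pi * s)" for s
      by (simp add: distrib_left flip: cis_mult)
    then show ?thesis using that by (auto simp: cover_set_def deck_def)
  qed
  ultimately show ?thesis
    by (auto simp: continuous_map_in_subtopology intro: continuous_map_from_subtopology)
qed

section \<open>The comparison map: a chain map, linear over Laurent polynomials, with acyclic
  cone\<close>

locale toric =
  fixes V :: "'v set" and m :: "'v \<Rightarrow> int"
  assumes fin: "finite V"
begin

abbreviation C :: "int \<Rightarrow> 'v set set \<Rightarrow> (('v \<Rightarrow> complex) \<times> real, 'k::field) kchain set" where
  "C i M \<equiv> chain_space i (subtopology (torus_space V) (cover_set V m M))"

abbreviation a :: "'v \<Rightarrow> 'k::field laurent" where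
  "a w \<equiv> laurent_t (m w) - 1"

lemma C_lact: "c \<in> C i M \<Longrightarrow> lact i x c \<in> C i M"
  by (rule chain_space_lact[OF _ continuous_map_deck])

lemma C_mono: "c \<in> C i M \<Longrightarrow> M \<subseteq> N \<Longrightarrow> c \<in> C i N"
  using chain_space_mono cover_set_mono by metis

lemma toric_vertex: "v \<in> V \<Longrightarrow> down_closed M \<Longrightarrow> toric_vertex V M v"
  by unfold_locales (auto simp: fin down_closed_def)

lemma C_around:
  assumes "v \<in> V" "down_closed M" "c \<in> C i (link v M)"
  shows "around v (m v) i c \<in> C (i + 1) M"
  using circle_cut.sweep_C[OF toric_vertex.circle_cut_toric[OF toric_vertex[OF assms(1,2)]] assms(3)]
  by (simp add: around_def)

text \<open>The full turn is the deck transformation by \<open>m v\<close>, so end minus start of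
  the sweep is the action of \<open>t ^ m v - 1\<close>.\<close>

lemma bd_around:
  assumes "v \<in> V" "down_closed M" and c: "c \<in> C i (link v M)"
  shows "bd (i + 1) (around v (m v) i c) = lact i (a v) c - around v (m v) (i - 1) (bd i c)"
proof -
  have "turn v (m v) 1 = deck (m v)" by (rule ext) (rule turn_1)
  then show ?thesis
    using circle_cut.bd_sweep[OF toric_vertex.circle_cut_toric[OF toric_vertex[OF assms(1,2)]] c]
    by (simp add: around_def lact_diff_left lact_laurent_t lact_one[OF c])
qed

lemma lact_around:
  assumes c: "c \<in> C i M" shows "lact (i + 1) x (around v (m v) i c) = around v (m v) i (lact i x c)"
proof -
  have "lact (i + 1) x (homotop i (turn_arc v (m v) b e) c) = homotop i (turn_arc v (m v) b e) (lact i x c)" for b e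
    by (rule lact_homotop[OF c]) (simp add: turn_arc_def deck_turn)
  then show ?thesis by (simp add: around_def homotop3_def lact_add)
qed

lemma around_simps [simp]:
  "around v k i 0 = 0" "around v k i (c + d) = around v k i c + around v k i d"
  "around v k i (c - d) = around v k i c - around v k i d" "around v k i (- c) = - around v k i c"
  by (simp_all add: around_def)

lemma Pow_deletion: "M \<subseteq> Pow (set (v # vs)) \<Longrightarrow> deletion v M \<subseteq> Pow (set vs)"
  and Pow_link: "M \<subseteq> Pow (set (v # vs)) \<Longrightarrow> link v M \<subseteq> Pow (set vs)"
  by (fastforce simp: deletion_def link_def)+

lemma point_chain_C: "i = 0 \<Longrightarrow> {} \<in> M \<Longrightarrow> point_chain V 0 x \<in> C i M"
proof -
  assume i: "i = 0" and M: "{} \<in> M"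
  have "point_chain V 0 x \<in> C i {{}}"
    by (simp add: chain_space_def i kchains_over_base[OF fin])
  then show ?thesis by (rule C_mono) (use M in auto)
qed

lemma cell_map_C:
  "set vs \<subseteq> V \<Longrightarrow> M \<subseteq> Pow (set vs) \<Longrightarrow> down_closed M \<Longrightarrow> d \<in> cell_chains i M \<Longrightarrow> cell_map V m vs i d \<in> C i M"
proof (induction vs arbitrary: M i d)
  case Nil
  show ?case
  proof (cases "i = 0 \<and> d {} \<noteq> 0")
    case True
    then have "{} \<in> M" using Nil by (auto simp: cell_chains_def)
    then show ?thesis using True by (auto intro: point_chain_C)
  qed auto
next
  case (Cons v vs)
  have "cell_map V m vs i (cells_without v d) \<in> C i M"
    by (rule C_mono[OF Cons.IH[OF _ Pow_deletion[OF Cons.prems(2)] down_closed_deletion cell_chains_without]])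
       (use Cons.prems in \<open>auto simp: deletion_def\<close>)
  moreover have "cell_map V m vs (i - 1) (cells_with v d) \<in> C (i - 1) (link v M)"
    by (rule Cons.IH[OF _ Pow_link[OF Cons.prems(2)] down_closed_link cell_chains_with]) (use Cons.prems in auto)
  from C_around[OF _ _ this] have "around v (m v) (i - 1) (cell_map V m vs (i - 1) (cells_with v d)) \<in> C i M"
    using Cons.prems by simp
  ultimately show ?case by (simp add: chain_space_add)
qed

lemma cell_map_add:
  "cell_map V m vs i (\<lambda>\<sigma>. c \<sigma> + d \<sigma>) = cell_map V m vs i c + cell_map V m vs i d"
proof (induction vs arbitrary: i c d)
  case (Cons v vs)
  have "cells_without v (\<lambda>\<sigma>. c \<sigma> + d \<sigma>) = (\<lambda>\<sigma>. cells_without v c \<sigma> + cells_without v d \<sigma>)"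
    "cells_with v (\<lambda>\<sigma>. c \<sigma> + d \<sigma>) = (\<lambda>\<sigma>. cells_with v c \<sigma> + cells_with v d \<sigma>)"
    by (auto simp: cells_without_def cells_with_def)
  then show ?case by (simp add: Cons algebra_simps)
qed simp

lemma cell_map_0: "cell_map V m vs i (\<lambda>\<sigma>. 0) = 0"
  using cell_map_add[of vs i "\<lambda>\<sigma>. 0" "\<lambda>\<sigma>. 0"] by simp

lemma cell_map_uminus: "cell_map V m vs i (\<lambda>\<sigma>. - c \<sigma>) = - cell_map V m vs i c"
proof -
  have "cell_map V m vs i (\<lambda>\<sigma>. - c \<sigma>) + cell_map V m vs i c = cell_map V m vs i (\<lambda>\<sigma>. 0)"
    by (simp flip: cell_map_add)
  then show ?thesis by (simp add: cell_map_0 eq_neg_iff_add_eq_0)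
qed

lemma cell_map_smult:
  "set vs \<subseteq> V \<Longrightarrow> M \<subseteq> Pow (set vs) \<Longrightarrow> down_closed M \<Longrightarrow> d \<in> cell_chains i M \<Longrightarrow>
    cell_map V m vs i (\<lambda>\<sigma>. x * d \<sigma>) = lact i x (cell_map V m vs i d)"
proof (induction vs arbitrary: M i d)
  case Nil
  have "point_chain V 0 (x * y) = lact 0 x (point_chain V 0 y)" for y
    unfolding lact_point_chain[symmetric, where a = "x * y"] lact_mult lact_point_chain ..
  then show ?case by simp
next
  case (Cons v vs)
  have eq: "cells_without v (\<lambda>\<sigma>. x * d \<sigma>) = (\<lambda>\<sigma>. x * cells_without v d \<sigma>)"
    "cells_with v (\<lambda>\<sigma>. x * d \<sigma>) = (\<lambda>\<sigma>. x * cells_with v d \<sigma>)"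
    by (auto simp: cells_without_def cells_with_def)
  have 1: "cell_map V m vs i (\<lambda>\<sigma>. x * cells_without v d \<sigma>) = lact i x (cell_map V m vs i (cells_without v d))"
    by (rule Cons.IH[OF _ Pow_deletion[OF Cons.prems(2)] down_closed_deletion cell_chains_without]) (use Cons.prems in auto)
  have 2: "cell_map V m vs (i - 1) (\<lambda>\<sigma>. x * cells_with v d \<sigma>) = lact (i - 1) x (cell_map V m vs (i - 1) (cells_with v d))"
    by (rule Cons.IH[OF _ Pow_link[OF Cons.prems(2)] down_closed_link cell_chains_with]) (use Cons.prems in auto)
  have "cell_map V m vs (i - 1) (cells_with v d) \<in> C (i - 1) (link v M)"
    by (rule cell_map_C[OF _ Pow_link[OF Cons.prems(2)] down_closed_link cell_chains_with]) (use Cons.prems in auto)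
  from lact_around[OF this, of x v] show ?case by (simp add: eq 1 2 lact_add)
qed

text \<open>By \<open>bd_around\<close> a sweep contributes the coefficient \<open>a v\<close> and a
  minus sign, exactly as \<open>cell_bd\<close> does at the first vertex of the list.\<close>

lemma bd_cell_map:
  "set vs \<subseteq> V \<Longrightarrow> distinct vs \<Longrightarrow> M \<subseteq> Pow (set vs) \<Longrightarrow> down_closed M \<Longrightarrow> d \<in> cell_chains i M \<Longrightarrow>
    bd i (cell_map V m vs i d) = cell_map V m vs (i - 1) (cell_bd a vs d)"
proof (induction vs arbitrary: M i d)
  case Nil
  show ?case by (simp add: cell_bd_def bd_def)
next
  case (Cons v vs)
  have v: "v \<in> V" "v \<notin> set vs" and vs: "set vs \<subseteq> V" "distinct vs" using Cons.prems by auto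
  note del = vs(1) Pow_deletion[OF Cons.prems(3)] down_closed_deletion[OF Cons.prems(4)] cell_chains_without[OF Cons.prems(5)]
  note lnk = vs(1) Pow_link[OF Cons.prems(3)] down_closed_link[OF Cons.prems(4)] cell_chains_with[OF Cons.prems(5)]
  let ?w = "cell_map V m vs (i - 1) (cells_with v d)"
  have w: "?w \<in> C (i - 1) (link v M)" by (rule cell_map_C[OF lnk])
  have 1: "bd i (cell_map V m vs i (cells_without v d)) = cell_map V m vs (i - 1) (cell_bd a vs (cells_without v d))"
    by (rule Cons.IH[OF del(1) vs(2) del(2-4)])
  have 2: "bd (i - 1) ?w = cell_map V m vs (i - 2) (cell_bd a vs (cells_with v d))"
    using Cons.IH[OF lnk(1) vs(2) lnk(2-4)] by simp
  have 3: "bd i (around v (m v) (i - 1) ?w) = lact (i - 1) (a v) ?w - around v (m v) (i - 2) (bd (i - 1) ?w)"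
    using bd_around[OF v(1) Cons.prems(4) w] by simp
  have 4: "lact (i - 1) (a v) ?w = cell_map V m vs (i - 1) (\<lambda>\<sigma>. a v * cells_with v d \<sigma>)"
    by (rule cell_map_smult[OF lnk, symmetric])
  have e1: "cells_without v (cell_bd a (v # vs) d) = (\<lambda>\<tau>. cell_bd a vs (cells_without v d) \<tau> + a v * cells_with v d \<tau>)"
    by (rule ext) (rule cells_without_cell_bd[OF v(2)])
  have e2: "cells_with v (cell_bd a (v # vs) d) = (\<lambda>\<tau>. - cell_bd a vs (cells_with v d) \<tau>)"
    by (rule ext) (rule cells_with_cell_bd[OF v(2)])
  show ?case by (simp add: 1 3 2 4 e1 e2 cell_map_add cell_map_uminus)
qed

text \<open>Without vertices the space is empty or the fibre over the base point, where all chains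
  are Laurent polynomials.\<close>

lemma cellular_exact_base:
  assumes M: "M \<subseteq> {{}}" and d: "d \<in> cell_chains (i - 1) M" and y: "y \<in> C i M"
    and yd: "bd i y = cell_map V m [] (i - 1) (d :: 'v set \<Rightarrow> 'k::field laurent)"
  shows "\<exists>c\<in>cell_chains i M. \<exists>x\<in>C (i + 1) M. cell_bd a [] c = d \<and> y = cell_map V m [] i c + bd (i + 1) x"
proof -
  have bd0: "cell_bd a [] c = (\<lambda>\<sigma>. 0)" for c :: "'v set \<Rightarrow> 'k laurent" by (auto simp: cell_bd_def)
  have zero: "(\<lambda>\<sigma>. 0) \<in> cell_chains i M" by (simp add: cell_chains_def)
  have d_supp: "\<sigma> = {}" if "d \<sigma> \<noteq> 0" for \<sigma> using that d M by (auto simp: cell_chains_def)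
  consider "M = {}" | "M = {{}}" "i < 0" | "M = {{}}" "i = 0" | n where "M = {{}}" "i = int (Suc n)"
    using M by (metis int_cases2 not_less_iff_gr_or_eq of_nat_0 of_nat_less_0_iff gr0_conv_Suc subset_singletonD of_nat_0_less_iff nonneg_int_cases linorder_le_less_linear)
  then show ?thesis
  proof cases
    case 1
    then have "cover_set V m M = {}" by (simp add: cover_set_def)
    then have False if "x \<in> Poly_Mapping.keys y" for x
      using that y singular_simplex_empty[of trivial_topology] by (auto simp: chain_space_def kchains_def split: if_splits)
    then have "y = 0" by (metis all_not_in_conv keys_eq_empty)
    moreover have "d = (\<lambda>\<sigma>. 0)" using d 1 by (auto simp: cell_chains_def)
    ultimately show ?thesis
      by (intro bexI[OF _ zero] bexI[of _ 0]) (auto simp: bd0 cell_map_0)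
  next
    case 2
    then have "y = 0" using y by (simp add: chain_space_def)
    moreover have "d = (\<lambda>\<sigma>. 0)" using d 2 by (auto simp: cell_chains_def)
    ultimately show ?thesis
      by (intro bexI[OF _ zero] bexI[of _ 0]) (auto simp: bd0 cell_map_0)
  next
    case 3
    then obtain b where b: "y = point_chain V 0 b"
      using y by (auto simp: chain_space_def kchains_over_base[OF fin])
    have "d = (\<lambda>\<sigma>. 0)" using d 3 by (auto simp: cell_chains_def)
    then show ?thesis
      using 3 b by (intro bexI[of _ "\<lambda>\<sigma>. if \<sigma> = {} then b else 0"] bexI[of _ 0]) (auto simp: bd0 cell_chains_def)
  next
    case 4
    have i: "nat i = Suc n" "nat (i + 1) = Suc (Suc n)" "\<not> i < 0" "\<not> i + 1 < 0" using 4 by auto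
    obtain b where b: "y = point_chain V (Suc n) b"
      using y 4 i by (auto simp: chain_space_def kchains_over_base[OF fin])
    have bdy: "bd i y = (if odd n then point_chain V n b else 0)"
      by (simp add: bd_def i b kboundary_point_chain)
    \<comment> \<open>\<open>d\<close> has degree \<open>n\<close>, so it can be nonzero only for
      \<open>n = 0\<close>; there the boundary of \<open>y\<close> vanishes and
      \<open>point_chain\<close> is injective.\<close>
    have "d {} = 0"
    proof (cases "n = 0")
      case True
      then have "point_chain V 0 (d {}) = 0" using yd bdy 4 by simp
      then show ?thesis by simp
    next
      case False
      then show ?thesis using d 4 by (auto simp: cell_chains_def)
    qed
    then have d0: "d = (\<lambda>\<sigma>. 0)" using d_supp by (auto simp: fun_eq_iff)
    \<comment> \<open>For odd \<open>n\<close> the differential is injective and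
      \<open>y = 0\<close>; for even \<open>n\<close> the same Laurent polynomial one degree higher
      has boundary \<open>y\<close>.\<close>
    show ?thesis
    proof (cases "odd n")
      case True
      then have "point_chain V n b = 0" using yd bdy by (simp add: d0)
      then have "y = 0" using b by simp
      then show ?thesis by (intro bexI[OF _ zero] bexI[of _ 0]) (auto simp: bd0 d0)
    next
      case False
      have "point_chain V (Suc (Suc n)) b \<in> C (i + 1) M"
        using 4 i by (auto simp: chain_space_def kchains_over_base[OF fin])
      moreover have "y = bd (i + 1) (point_chain V (Suc (Suc n)) b)"
        using False by (simp add: bd_def i(2) b kboundary_point_chain)
      ultimately show ?thesis by (intro bexI[OF _ zero]) (auto simp: bd0 d0)
    qed
  qed
qed

text \<open>The mapping cone of \<open>cell_map\<close> is acyclic. Removing the vertex \<open>v\<close> leaves a complex and the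
  suspension of its link, to both of which the induction hypothesis applies.\<close>

lemma cellular_exact:
  assumes "set vs \<subseteq> V" "distinct vs" "M \<subseteq> Pow (set vs)" "down_closed M"
    and "d \<in> cell_chains (i - 1) M" "y \<in> C i M"
    and "\<And>\<tau>. cell_bd a vs d \<tau> = 0" "bd i y = cell_map V m vs (i - 1) (d :: 'v set \<Rightarrow> 'k::field laurent)"
  shows "\<exists>c\<in>cell_chains i M. \<exists>x\<in>C (i + 1) M. cell_bd a vs c = d \<and> y = cell_map V m vs i c + bd (i + 1) x"
  using assms
proof (induction vs arbitrary: M i d y)
  case Nil
  then show ?case using cellular_exact_base[of M d i y] by simp
next
  case (Cons v vs)
  have v: "v \<in> V" "v \<notin> set vs" and vs: "set vs \<subseteq> V" "distinct vs" using Cons.prems by auto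
  note del = vs(1) Pow_deletion[OF Cons.prems(3)] down_closed_deletion[OF Cons.prems(4)]
  note lnk = vs(1) Pow_link[OF Cons.prems(3)] down_closed_link[OF Cons.prems(4)]
  interpret cut: circle_cut "torus_space V" "cover_set V m M" "{z \<in> cover_set V m M. fst z v \<noteq> - 1}"
     "{z \<in> cover_set V m M. fst z v \<noteq> 1}" "{z \<in> cover_set V m M. Im (fst z v) > 0}" "{z \<in> cover_set V m M. Im (fst z v) < 0}"
     "cover_set V m (link v M)" "cover_set V m (deletion v M)" "turn v (m v) (1 / 4)" "turn v (m v) (3 / 4)" "turn v (m v) 1"
     "\<lambda>z. turn v (m v) (- angle (fst z v)) z" "\<lambda>z. turn v (m v) (- signed_angle (fst z v)) z"
     "turn_arc v (m v) 0 (1 / 4)" "turn_arc v (m v) (1 / 4) (1 / 2)" "turn_arc v (m v) (3 / 4) (1 / 4)"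
     "\<lambda>(u, z). turn v (m v) (0 + u * (1 / 4 + - angle (fst z v))) z"
     "\<lambda>(u, z). turn v (m v) (0 + u * (3 / 4 + - angle (fst z v))) z"
     "\<lambda>(u, z). turn v (m v) (0 + u * (0 + - signed_angle (fst z v))) z"
    by (rule toric_vertex.circle_cut_toric[OF toric_vertex[OF v(1) Cons.prems(4)]])
  let ?d0 = "cells_without v d" and ?d1 = "cells_with v d"
  have d0: "?d0 \<in> cell_chains (i - 1) (deletion v M)" by (rule cell_chains_without[OF Cons.prems(5)])
  have d1: "?d1 \<in> cell_chains (i - 2) (link v M)" using cell_chains_with[OF Cons.prems(5)] by simp
  have bd1: "cell_bd a vs ?d1 \<tau> = 0" and bd0: "cell_bd a vs ?d0 \<tau> = - (a v * ?d1 \<tau>)" for \<tau>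
  proof -
    have "cell_bd a (v # vs) d = (\<lambda>\<tau>. 0)" using Cons.prems(7) by auto
    then show "cell_bd a vs ?d1 \<tau> = 0" "cell_bd a vs ?d0 \<tau> = - (a v * ?d1 \<tau>)"
      using cells_without_cell_bd[OF v(2), of a d \<tau>] cells_with_cell_bd[OF v(2), of a d \<tau>]
      by (simp_all add: cells_without_def cells_with_def eq_neg_iff_add_eq_0)
  qed
  let ?w = "cell_map V m vs (i - 2) ?d1"
  have w: "?w \<in> C (i - 2) (link v M)" by (rule cell_map_C[OF lnk d1])
  have bw: "bd (i - 2) ?w = 0"
  proof -
    have "cell_bd a vs ?d1 = (\<lambda>\<tau>. 0)" by (rule ext) (rule bd1)
    then show ?thesis using bd_cell_map[OF vs lnk(2,3) d1] by (simp add: cell_map_0)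
  qed
  have w0: "cell_map V m vs (i - 1) ?d0 \<in> C (i - 1) (deletion v M)" by (rule cell_map_C[OF del d0])
  have bdy: "bd i y = cell_map V m vs (i - 1) ?d0 + around v (m v) (i - 2) ?w"
    using Cons.prems(8) by simp
  then have "bd i y - cut.sweep (i - 2) ?w \<in> C (i - 1) (deletion v M)"
    using w0 by (simp add: around_def)
  \<comment> \<open>Up to a boundary and modulo the deletion, \<open>y\<close> is the sweep of a
    chain \<open>b\<close> of the link. As \<open>?w = - bd (i - 1) b\<close>, the pair of
    \<open>b\<close> and the negative of \<open>?d1\<close> is a cycle of the cone for the
    link.\<close>
  from cut.relative_sweep[OF Cons.prems(6) w bw this]
  obtain b x z where b: "b \<in> C (i - 1) (link v M)" "?w = - bd (i - 1) b" and x: "x \<in> C (i + 1) M"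
    and z: "z \<in> C i (deletion v M)" and y_eq: "y = around v (m v) (i - 1) b + bd (i + 1) x + z"
    by (auto simp: around_def algebra_simps)
  have "\<exists>c1\<in>cell_chains (i - 1) (link v M). \<exists>x1\<in>C (i - 1 + 1) (link v M).
      cell_bd a vs c1 = (\<lambda>\<sigma>. - ?d1 \<sigma>) \<and> b = cell_map V m vs (i - 1) c1 + bd (i - 1 + 1) x1"
  proof (rule Cons.IH[OF vs lnk(2,3) _ b(1)])
    show "(\<lambda>\<sigma>. - ?d1 \<sigma>) \<in> cell_chains (i - 1 - 1) (link v M)" using cell_chains_ops(2)[OF d1 d1] by simp
    show "cell_bd a vs (\<lambda>\<sigma>. - ?d1 \<sigma>) \<tau> = 0" for \<tau> by (simp add: cell_bd_linear bd1)
    show "bd (i - 1) b = cell_map V m vs (i - 1 - 1) (\<lambda>\<sigma>. - ?d1 \<sigma>)" using b(2) by (simp add: cell_map_uminus)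
  qed
  then obtain c1 x1 where c1: "c1 \<in> cell_chains (i - 1) (link v M)" "cell_bd a vs c1 = (\<lambda>\<sigma>. - ?d1 \<sigma>)"
    and x1: "x1 \<in> C i (link v M)" and b_eq: "b = cell_map V m vs (i - 1) c1 + bd i x1"
    by auto
  let ?s = "cell_map V m vs (i - 1) c1"
  have s: "?s \<in> C (i - 1) (link v M)" by (rule cell_map_C[OF lnk c1(1)])
  have KD: "link v M \<subseteq> deletion v M"
    using Cons.prems(4) unfolding link_def deletion_def down_closed_def by blast
  \<comment> \<open>Up to a boundary, sweeping the boundary of \<open>x1\<close> amounts to
    \<open>t ^ m v - 1\<close> acting on \<open>x1\<close>. That chain lies over the link, hence
    over the deletion, and joins \<open>z\<close>.\<close>
  define z' where "z' = lact i (a v) x1 + z"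
  have z': "z' \<in> C i (deletion v M)"
    unfolding z'_def by (intro chain_space_add z C_mono[OF C_lact[OF x1] KD])
  define x' where "x' = x - around v (m v) i x1"
  have x': "x' \<in> C (i + 1) M" unfolding x'_def by (intro chain_space_diff x C_around v(1) Cons.prems(4) x1)
  have y_eq': "y = around v (m v) (i - 1) ?s + z' + bd (i + 1) x'"
    using bd_around[OF v(1) Cons.prems(4) x1] unfolding y_eq by (simp add: b_eq z'_def x'_def algebra_simps)
  have c1D: "c1 \<in> cell_chains (i - 1) (deletion v M)" using c1(1) KD by (auto simp: cell_chains_def)
  \<comment> \<open>Subtracting the boundary that \<open>c1\<close> contributes through
    \<open>v\<close> leaves a cycle of the cone for the deletion.\<close>
  let ?e = "\<lambda>\<sigma>. ?d0 \<sigma> - a v * c1 \<sigma>"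
  have bds: "bd (i - 1) ?s = - ?w"
    using bd_cell_map[OF vs lnk(2,3) c1(1)] by (simp add: c1(2) cell_map_uminus)
  have bdz: "bd i z' = cell_map V m vs (i - 1) ?e"
  proof -
    have "bd i (bd (i + 1) x') = 0" using bd_bd[OF x'] by simp
    then have "bd i z' = bd i y - bd i (around v (m v) (i - 1) ?s)" by (simp add: y_eq')
    also have "\<dots> = cell_map V m vs (i - 1) ?d0 - lact (i - 1) (a v) ?s"
      using bd_around[OF v(1) Cons.prems(4) s] by (simp add: bdy bds)
    also have "lact (i - 1) (a v) ?s = cell_map V m vs (i - 1) (\<lambda>\<sigma>. a v * c1 \<sigma>)"
      by (rule cell_map_smult[OF lnk c1(1), symmetric])
    also have "cell_map V m vs (i - 1) ?d0 - \<dots> = cell_map V m vs (i - 1) ?e"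
      using cell_map_add[of vs "i - 1" ?d0 "\<lambda>\<sigma>. - (a v * c1 \<sigma>)"] by (simp add: cell_map_uminus)
    finally show ?thesis .
  qed
  have "\<exists>c0\<in>cell_chains i (deletion v M). \<exists>x0\<in>C (i + 1) (deletion v M).
      cell_bd a vs c0 = ?e \<and> z' = cell_map V m vs i c0 + bd (i + 1) x0"
  proof (rule Cons.IH[OF vs del(2,3) _ z' _ bdz])
    show "?e \<in> cell_chains (i - 1) (deletion v M)" by (rule cell_chains_ops(1)[OF d0 c1D])
    show "cell_bd a vs ?e \<tau> = 0" for \<tau> by (simp only: cell_bd_linear bd0 c1(2)) simp
  qed
  then obtain c0 x0 where c0: "c0 \<in> cell_chains i (deletion v M)" "cell_bd a vs c0 = ?e"
    and x0: "x0 \<in> C (i + 1) (deletion v M)" and z'_eq: "z' = cell_map V m vs i c0 + bd (i + 1) x0" by auto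
  let ?c = "cells_join v c0 c1"
  note join = cell_chains_join[OF c0(1) c1(1)]
  show ?case
  proof (intro bexI[OF _ join(1)] bexI[of _ "x0 + x'"] conjI)
    show "x0 + x' \<in> C (i + 1) M"
      by (intro chain_space_add x' C_mono[OF x0]) (auto simp: deletion_def)
    show "cell_bd a (v # vs) ?c = d"
    proof (rule cells_eqI)
      show "cells_without v (cell_bd a (v # vs) ?c) \<sigma> = cells_without v d \<sigma>" for \<sigma>
        unfolding cells_without_cell_bd[OF v(2)] join c0(2) by simp
      show "cells_with v (cell_bd a (v # vs) ?c) \<sigma> = cells_with v d \<sigma>" for \<sigma>
        unfolding cells_with_cell_bd[OF v(2)] join c1(2) by simp
    qed
    show "y = cell_map V m (v # vs) i ?c + bd (i + 1) (x0 + x')"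
      by (simp add: join(2,3) y_eq' z'_eq algebra_simps)
  qed
qed

text \<open>\<open>cellular_exact\<close> is used twice: with \<open>d = 0\<close> it replaces
  \<open>z\<close> by a cellular cycle \<open>c\<close>, and with \<open>d = F * c\<close> it finds
  a cellular chain with that boundary. The division by \<open>F\<close> then takes place among
  cellular chains.\<close>

lemma torsion_divides:
  fixes F :: "'k::field laurent"
  assumes M: "M \<subseteq> Pow V" "down_closed M"
    and bez: "\<And>v. v \<in> V \<Longrightarrow> a v \<noteq> (0 :: 'k laurent) \<Longrightarrow> \<exists>A B. A * a v + B * F = 1"
    and lam: "\<And>x. lam (F * x) = x" "\<And>x y. lam (x + y) = lam x + (lam y :: 'k laurent)"
    and z: "z \<in> C i M" "bd i z = 0" and x: "x \<in> C (i + 1) M" "lact i F z = bd (i + 1) x"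
  shows "\<exists>x\<in>C (i + 1) M. z = bd (i + 1) x"
proof -
  obtain vs where vs: "set vs = V" "distinct vs" using finite_distinct_list[OF fin] by blast
  then have vs': "set vs \<subseteq> V" "distinct vs" "M \<subseteq> Pow (set vs)" using M by auto
  have zero: "(\<lambda>\<sigma>. 0) \<in> cell_chains j M" for j by (simp add: cell_chains_def)
  have bd0: "cell_bd a vs (\<lambda>\<sigma>. 0) \<tau> = 0" for \<tau> by (simp add: cell_bd_def)
  have "bd i z = cell_map V m vs (i - 1) (\<lambda>\<sigma>. 0)" by (simp add: z(2) cell_map_0)
  from cellular_exact[OF vs' M(2) zero z(1) bd0 this]
  obtain c x0 where c: "c \<in> cell_chains i M" "cell_bd a vs c = (\<lambda>\<sigma>. 0)" and x0: "x0 \<in> C (i + 1) M"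
    and z_eq: "z = cell_map V m vs i c + bd (i + 1) x0" by blast
  \<comment> \<open>Accounts for the boundary of \<open>x0\<close>, by which \<open>z\<close>
    differs from the image of \<open>c\<close>.\<close>
  let ?x = "x - lact (i + 1) F x0"
  have x': "?x \<in> C (i + 1) M" by (intro chain_space_diff x C_lact x0)
  have Fc: "(\<lambda>\<sigma>. F * c \<sigma>) \<in> cell_chains i M" using cell_chains_ops(3)[OF c(1) c(1)] .
  have "bd (i + 1) ?x = cell_map V m vs i (\<lambda>\<sigma>. F * c \<sigma>)"
    using x(2) bd_lact[OF x0] cell_map_smult[OF vs'(1,3) M(2) c(1), of F] by (simp add: z_eq lact_add diff_eq_eq)
  then have "\<exists>c'\<in>cell_chains (i + 1) M. \<exists>x''\<in>C (i + 1 + 1) M. cell_bd a vs c' = (\<lambda>\<sigma>. F * c \<sigma>) \<and>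
      ?x = cell_map V m vs (i + 1) c' + bd (i + 1 + 1) x''"
    by (intro cellular_exact[OF vs' M(2) _ x']) (use Fc in \<open>auto simp: cell_bd_linear c(2)\<close>)
  then obtain c' where c': "c' \<in> cell_chains (i + 1) M" "cell_bd a vs c' = (\<lambda>\<sigma>. F * c \<sigma>)" by blast
  obtain c'' where c'': "\<And>\<tau>. c \<tau> = cell_bd a vs c'' \<tau>" "\<And>\<sigma>. c' \<sigma> = 0 \<Longrightarrow> c'' \<sigma> = 0"
    by (rule cell_bd_divide[of vs a F lam c c']) (use bez lam vs c'(2) in auto)
  have c''C: "c'' \<in> cell_chains (i + 1) M" using c'(1) c''(2) by (force simp: cell_chains_def)
  have "cell_bd a vs c'' = c" by (rule ext) (rule c''(1)[symmetric])
  then have "bd (i + 1) (cell_map V m vs (i + 1) c'') = cell_map V m vs i c"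
    using bd_cell_map[OF vs' M(2) c''C] by simp
  then have "z = bd (i + 1) (cell_map V m vs (i + 1) c'' + x0)" by (simp add: z_eq)
  then show ?thesis
    by (intro bexI[of _ "cell_map V m vs (i + 1) c'' + x0"] chain_space_add x0 cell_map_C[OF vs'(1,3) M(2) c''C])
qed

end


subsection \<open>Laurent polynomials\<close>

lemma laurent_of_poly_superset:
  "degree p \<le> n \<Longrightarrow> laurent_of_poly p = (\<Sum>i\<le>n. Poly_Mapping.single (int i) (coeff p i))"
  unfolding laurent_of_poly_def by (rule sum.mono_neutral_left) (auto simp: coeff_eq_0)

lemma laurent_of_poly_0 [simp]: "laurent_of_poly 0 = 0"
  and laurent_of_poly_1 [simp]: "laurent_of_poly 1 = 1"
  by (simp_all add: laurent_of_poly_def)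

lemma laurent_of_poly_add: "laurent_of_poly (p + q) = laurent_of_poly p + laurent_of_poly q"
proof -
  let ?n = "max (degree p) (degree q)"
  show ?thesis
    using degree_add_le_max[of p q]
    by (simp add: laurent_of_poly_superset[of _ ?n] single_add sum.distrib)
qed

lemma laurent_of_poly_smult: "laurent_of_poly (smult b p) = Poly_Mapping.single 0 b * laurent_of_poly p"
  by (simp add: laurent_of_poly_superset[OF degree_smult_le]) (simp add: laurent_of_poly_def sum_distrib_left mult_single)

lemma laurent_of_poly_pCons:
  "laurent_of_poly (pCons b p) = Poly_Mapping.single 0 b + Poly_Mapping.single 1 1 * laurent_of_poly p"
proof -
  have "laurent_of_poly (pCons b p) = (\<Sum>i\<le>Suc (degree p). Poly_Mapping.single (int i) (coeff (pCons b p) i))"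
    by (rule laurent_of_poly_superset) (rule degree_pCons_le)
  also have "\<dots> = Poly_Mapping.single 0 b + Poly_Mapping.single 1 1 * laurent_of_poly p"
    by (subst sum.atMost_Suc_shift) (simp add: laurent_of_poly_def sum_distrib_left mult_single)
  finally show ?thesis .
qed

lemma laurent_of_poly_mult: "laurent_of_poly (p * q) = laurent_of_poly p * laurent_of_poly q"
proof (induction p)
  case (pCons b p)
  then show ?case
    by (simp add: laurent_of_poly_add laurent_of_poly_smult laurent_of_poly_pCons distrib_right mult.assoc)
qed simp

lemma laurent_of_poly_eq_0_iff: "laurent_of_poly p = 0 \<longleftrightarrow> p = 0"
proof
  assume *: "laurent_of_poly p = 0"
  have "coeff p n = 0" if "n \<le> degree p" for n
  proof -
    have "Poly_Mapping.lookup (laurent_of_poly p) (int n) = coeff p n"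
      using that by (simp add: laurent_of_poly_def lookup_sum lookup_single when_def)
    then show ?thesis using * by simp
  qed
  then show "p = 0" by (metis le_refl leading_coeff_0_iff)
qed simp

lemma laurent_of_poly_monom: "laurent_of_poly (monom 1 n) = laurent_t (int n)"
proof (induction n)
  case (Suc n)
  then show ?case by (simp add: monom_Suc laurent_of_poly_pCons laurent_t_def mult_single add.commute)
qed (simp add: laurent_t_def monom_0 flip: single_one one_pCons)

lemma laurent_t_add: "laurent_t (i + j) = laurent_t i * laurent_t j"
  by (simp add: laurent_t_def mult_single)

lemma laurent_t_0 [simp]: "laurent_t 0 = 1"
  by (simp add: laurent_t_def)

text \<open>An element of least degree generates the ideal of \<open>f\<close> and \<open>g\<close>.
  As a divisor of the irreducible \<open>f\<close> it is a unit or an associate of \<open>f\<close>,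
  and the latter would make \<open>f\<close> divide \<open>g\<close>.\<close>

lemma poly_bezout:
  fixes f g :: "'k::field poly"
  assumes f: "irreducible f" and g: "\<not> f dvd g"
  shows "\<exists>A B. A * f + B * g = 1"
proof -
  let ?I = "{A * f + B * g | A B. True}"
  have "f \<in> ?I - {0}" using f by (auto intro: exI[of _ 1] exI[of _ 0])
  then obtain d where d: "d \<in> ?I - {0}" "\<And>p. p \<in> ?I - {0} \<Longrightarrow> degree d \<le> degree p"
    using ex_has_least_nat[of "\<lambda>p. p \<in> ?I - {0}" f degree] by blast
  obtain A B where AB: "d = A * f + B * g" using d(1) by blast
  have dvd: "d dvd A' * f + B' * g" for A' B'
  proof (rule ccontr)
    let ?p = "A' * f + B' * g" and ?q = "(A' * f + B' * g) div d"
    assume "\<not> d dvd ?p"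
    then have nz: "?p mod d \<noteq> 0" by (simp add: mod_eq_0_iff_dvd)
    have "?p mod d = ?p - ?q * d" by (simp add: minus_div_mult_eq_mod)
    also have "\<dots> = (A' - ?q * A) * f + (B' - ?q * B) * g" by (simp add: AB algebra_simps)
    finally have "?p mod d \<in> ?I - {0}" using nz by blast
    then have "degree d \<le> degree (?p mod d)" by (rule d(2))
    moreover have "degree (?p mod d) < degree d" using degree_mod_less'[of d ?p] d(1) nz by auto
    ultimately show False by simp
  qed
  have "d dvd f" "d dvd g" using dvd[of 1 0] dvd[of 0 1] by simp_all
  then obtain e where e: "f = d * e" by (auto elim: dvdE)
  have "\<not> e dvd 1"
  proof
    assume "e dvd 1"
    then obtain e' where "1 = e * e'" by (auto elim: dvdE)
    then have "d = f * e'" using e by (metis mult.assoc mult.right_neutral)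
    then show False using g \<open>d dvd g\<close> by (metis dvd_mult_left)
  qed
  then have "d dvd 1" using irreducibleD[OF f e] by blast
  then obtain u where "1 = d * u" by (auto elim: dvdE)
  then have "(u * A) * f + (u * B) * g = 1" by (simp add: AB algebra_simps)
  then show ?thesis by blast
qed

text \<open>\<open>t ^ k - 1\<close> and \<open>t ^ (- k) - 1\<close> differ by a unit factor, so
  the exponent may be taken positive and the identity found among ordinary polynomials.\<close>

lemma laurent_bezout:
  fixes f :: "'k::field poly"
  assumes f: "irreducible f" and k: "k \<noteq> 0" and nd: "\<not> laurent_of_poly f dvd laurent_t k - 1"
  shows "\<exists>A B. A * laurent_of_poly f + B * (laurent_t k - 1) = 1"
proof -
  let ?g = "monom 1 (nat \<bar>k\<bar>) - 1 :: 'k poly"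
  have g: "laurent_of_poly ?g = laurent_t \<bar>k\<bar> - 1"
    using laurent_of_poly_add[of ?g 1] by (simp add: laurent_of_poly_monom)
  obtain u where u: "laurent_t \<bar>k\<bar> - 1 = u * (laurent_t k - 1 :: 'k laurent)"
  proof (cases "k > 0")
    case True
    then show ?thesis using that[of 1] by simp
  next
    case False
    have "laurent_t (- k) - 1 = - laurent_t (- k) * (laurent_t k - 1 :: 'k laurent)"
      using laurent_t_add[of "- k" k] by (simp add: algebra_simps)
    then show ?thesis using that[of "- laurent_t (- k)"] False by simp
  qed
  obtain u' where u': "laurent_t k - 1 = u' * (laurent_t \<bar>k\<bar> - 1 :: 'k laurent)"
  proof (cases "k > 0")
    case True
    then show ?thesis using that[of 1] by simp
  next
    case False
    have "laurent_t k - 1 = - laurent_t k * (laurent_t (- k) - 1 :: 'k laurent)"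
      using laurent_t_add[of k "- k"] by (simp add: algebra_simps)
    then show ?thesis using that[of "- laurent_t k"] False by simp
  qed
  have "\<not> f dvd ?g"
  proof
    assume "f dvd ?g"
    then obtain h where "?g = f * h" by (auto elim: dvdE)
    then have "laurent_t \<bar>k\<bar> - 1 = laurent_of_poly f * laurent_of_poly h"
      by (metis g laurent_of_poly_mult)
    then show False using nd u' by simp
  qed
  then obtain A B where "A * f + B * ?g = 1" using poly_bezout[OF f] by blast
  then have "laurent_of_poly (A * f + B * ?g) = 1" by simp
  then have "laurent_of_poly A * laurent_of_poly f + (laurent_of_poly B * u) * (laurent_t k - 1) = 1"
    by (simp only: laurent_of_poly_add laurent_of_poly_mult g u mult.assoc)
  then show ?thesis by blast
qed

text \<open>Multiplication by \<open>F\<close> is injective and linear over the field, so a choice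
  of complement gives a left inverse, linear over the field only.\<close>

lemma laurent_left_inverse:
  fixes F :: "'k::field laurent"
  assumes "F \<noteq> 0"
  obtains lam where "\<And>x. lam (F * x) = x" "\<And>x y. lam (x + y) = lam x + (lam y :: 'k laurent)"
proof -
  interpret vector_space_pair "scl :: 'k \<Rightarrow> 'k laurent \<Rightarrow> _" "scl :: 'k \<Rightarrow> 'k laurent \<Rightarrow> _"
    by unfold_locales (auto simp: scl_add scl_add_left)
  have "Vector_Spaces.linear scl scl ((*) F)"
    by unfold_locales (auto simp: distrib_left mult_map_scale_conv_mult mult_ac)
  moreover have "inj ((*) F)" using assms by (simp add: inj_def)
  ultimately obtain g where g: "Vector_Spaces.linear scl scl g" "g \<circ> (*) F = id"
    using linear_injective_left_inverse by blast
  show ?thesis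
  proof (rule that)
    show "g (F * x) = x" for x using g(2) by (metis comp_apply id_apply)
    show "g (x + y) = g x + g y" for x y using g(1) by (rule linear_add)
  qed
qed

subsection \<open>The homology of the infinite cyclic cover\<close>

text \<open>Passing to a face only forces more coordinates to be 1, so closing \<open>L\<close>
  downwards, with the empty simplex added, leaves the union unchanged.\<close>

lemma toric_cover_eq:
  "toric_cover V L chi =
     subtopology (torus_space V) (cover_set V (\<lambda>v. chi (raag_gen V L v)) {\<sigma>. \<exists>\<tau>\<in>L. \<sigma> \<subseteq> \<tau>})"
proof -
  let ?S = "\<Union>\<sigma>\<in>L. {x :: 'a \<Rightarrow> complex. \<forall>v\<in>V - \<sigma>. x v = 1}"
  let ?T = "{(x :: 'a \<Rightarrow> complex, s). (\<Prod>v\<in>V. x v powi chi (raag_gen V L v)) = cis (2 * pi * s)}"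
  have "toric_cover V L chi = subtopology (torus_space V) ((?S \<times> UNIV) \<inter> ?T)"
    unfolding toric_cover_def toric_complex_def torus_space_def
    by (simp add: prod_topology_subtopology(1) subtopology_subtopology)
  also have "\<dots> = subtopology (torus_space V) (topspace (torus_space V) \<inter> ((?S \<times> UNIV) \<inter> ?T))"
    by (rule subtopology_restrict[symmetric])
  also have "topspace (torus_space V) \<inter> ((?S \<times> UNIV) \<inter> ?T) =
      cover_set V (\<lambda>v. chi (raag_gen V L v)) {\<sigma>. \<exists>\<tau>\<in>L. \<sigma> \<subseteq> \<tau>}"
  proof (rule Set.set_eqI)
    fix z :: "('a \<Rightarrow> complex) \<times> real"
    obtain x s where z: "z = (x, s)" by (cases z)
    have "(\<exists>\<sigma>\<in>{\<sigma>. \<exists>\<tau>\<in>L. \<sigma> \<subseteq> \<tau>}. \<forall>v\<in>V - \<sigma>. x v = 1) \<longleftrightarrow> (\<exists>\<sigma>\<in>L. \<forall>v\<in>V - \<sigma>. x v = 1)"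
      by blast
    then show "z \<in> topspace (torus_space V) \<inter> ((?S \<times> UNIV) \<inter> ?T) \<longleftrightarrow>
        z \<in> cover_set V (\<lambda>v. chi (raag_gen V L v)) {\<sigma>. \<exists>\<tau>\<in>L. \<sigma> \<subseteq> \<tau>}"
      by (simp add: z topspace_torus_space cover_set_def)
  qed
  finally show ?thesis .
qed

section \<open>From chains in integer degrees to homology classes\<close>

lemma chain_space_int: "chain_space (int n) X = kchains n X"
  by (simp add: chain_space_def)

lemma chain_space_int_Suc: "chain_space (int n + 1) X = kchains (Suc n) X"
  by (simp add: chain_space_def nat_add_distrib)

lemma bd_int_Suc: "bd (int n + 1) c = kboundary (Suc n) c"
  by (simp add: bd_def nat_add_distrib)

lemma khclass_boundary:
  assumes "c \<in> kboundaries n X" shows "khclass n X c = khclass n X 0"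
proof -
  obtain y where y: "y \<in> kchains (Suc n) X" "c = kboundary (Suc n) y" using assms by (auto simp: kboundaries_def)
  have "w - c \<in> kboundaries n X \<longleftrightarrow> w \<in> kboundaries n X" for w
  proof
    assume "w - c \<in> kboundaries n X"
    then obtain x where "x \<in> kchains (Suc n) X" "w - c = kboundary (Suc n) x" by (auto simp: kboundaries_def)
    then show "w \<in> kboundaries n X"
      using y unfolding kboundaries_def by (intro image_eqI[of _ _ "x + y"]) (auto simp: kchains_add algebra_simps)
  next
    assume "w \<in> kboundaries n X"
    then obtain x where "x \<in> kchains (Suc n) X" "w = kboundary (Suc n) x" by (auto simp: kboundaries_def)
    then show "w - c \<in> kboundaries n X"
      using y unfolding kboundaries_def by (intro image_eqI[of _ _ "x - y"]) (auto simp: kchains_diff)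
  qed
  then show ?thesis by (simp add: khclass_def)
qed

lemma khclass_self: "z \<in> khclass n X z"
  unfolding khclass_def kboundaries_def by (auto intro: image_eqI[of _ _ 0])

theorem proposition5p7:
  fixes V :: "'v set" and L :: "'v set set"
    and chi :: "'v word set \<Rightarrow> int"
    and f :: "'k::field poly"
  assumes "finite_simplicial_complex V L"
    and "chi \<in> epi (raag V L) integer_group"
    and "irreducible f" and "poly f 0 \<noteq> 0"
    and "\<And>v. v \<in> V \<Longrightarrow> chi (raag_gen V L v) \<noteq> 0 \<Longrightarrow>
           \<not> laurent_of_poly f dvd laurent_t (chi (raag_gen V L v)) - 1"
  shows "\<forall>n. primary_part (laurent_of_poly f)
               (toric_homology n V L chi :: ('k laurent, (('v \<Rightarrow> complex) \<times> real, 'k) kchain set) module)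
             = {ring.zero (toric_homology n V L chi)}"
proof
  fix n
  define m where "m = (\<lambda>v. chi (raag_gen V L v))"
  define M where "M = {\<sigma>. \<exists>\<tau>\<in>L. \<sigma> \<subseteq> \<tau>}"
  let ?X = "subtopology (torus_space V) (cover_set V m M)"
  interpret toric V m
    by unfold_locales (use assms(1) in \<open>simp add: finite_simplicial_complex_def\<close>)
  have "\<tau> \<subseteq> V" if "\<tau> \<in> L" for \<tau>
    using assms(1) that by (simp add: finite_simplicial_complex_def)
  then have M: "M \<subseteq> Pow V" unfolding M_def by blast
  have down: "down_closed M" unfolding M_def down_closed_def by blast
  have X: "toric_cover V L chi = ?X" by (simp add: toric_cover_eq m_def M_def)
  let ?H = "toric_homology n V L chi :: ('k laurent, (('v \<Rightarrow> complex) \<times> real, 'k) kchain set) module"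
  have carrier: "carrier ?H = khclass n ?X ` kcycles n ?X" and zero: "ring.zero ?H = khclass n ?X 0"
    and smult: "module.smult ?H x A = (\<Union>z\<in>A. khclass n ?X (lact (int n) x z))" for x A
    by (simp_all add: toric_homology_def equivariant_homology_module_def X)
  have torsion: "z \<in> kboundaries n ?X"
    if z: "z \<in> kcycles n ?X" and eq: "module.smult ?H (laurent_of_poly f ^ k) (khclass n ?X z) = ring.zero ?H"
    for z :: "(('v \<Rightarrow> complex) \<times> real, 'k) kchain" and k :: nat
  proof -
    \<comment> \<open>All powers are handled directly: being coprime to the boundary coefficients
      passes from \<open>f\<close> to \<open>f ^ k\<close>.\<close>
    let ?F = "laurent_of_poly f ^ k"
    have "lact (int n) ?F z \<in> khclass n ?X 0"
      using eq khclass_self[of z n ?X] khclass_self[of "lact (int n) ?F z" n ?X] unfolding smult zero by blast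
    then obtain x where x: "x \<in> C (int n + 1) M" "lact (int n) ?F z = bd (int n + 1) x"
      unfolding chain_space_int_Suc bd_int_Suc by (auto simp: khclass_def kboundaries_def)
    have "f \<noteq> 0" using assms(3) by auto
    then have "?F \<noteq> 0" by (simp add: laurent_of_poly_eq_0_iff)
    then obtain lam where lam: "\<And>x. lam (?F * x) = x" "\<And>x y. lam (x + y) = lam x + (lam y :: 'k laurent)"
      by (rule laurent_left_inverse) blast
    have bez: "\<exists>A B. A * a v + B * ?F = 1" if v: "v \<in> V" "a v \<noteq> (0 :: 'k laurent)" for v
    proof -
      have "m v \<noteq> 0" using v(2) by auto
      then have "\<exists>A B. A * laurent_of_poly f + B * a v = 1"
        using laurent_bezout[OF assms(3)] assms(5)[OF v(1)] by (simp add: m_def)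
      then obtain A B where "A * (\<Prod>i<k. laurent_of_poly f) + B * a v = 1"
        using bezout_prod[of "{..<k}" "\<lambda>_. laurent_of_poly f" "a v"] by auto
      then have "B * a v + A * ?F = 1" by (simp add: add.commute)
      then show ?thesis by blast
    qed
    have "z \<in> C (int n) M" "bd (int n) z = 0"
      using z by (auto simp: kcycles_def chain_space_int bd_def)
    from torsion_divides[OF M down bez lam this x]
    show ?thesis unfolding chain_space_int_Suc bd_int_Suc by (auto simp: kboundaries_def)
  qed
  show "primary_part (laurent_of_poly f) ?H = {ring.zero ?H}"
  proof (intro subset_antisym subsetI)
    fix A assume "A \<in> primary_part (laurent_of_poly f) ?H"
    then obtain z k where "z \<in> kcycles n ?X" "A = khclass n ?X z"
        "module.smult ?H (laurent_of_poly f ^ k) A = ring.zero ?H"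
      by (auto simp: primary_part_def carrier)
    then show "A \<in> {ring.zero ?H}" using torsion[of z k] khclass_boundary[of z n ?X] by (simp add: zero)
  next
    fix A assume "A \<in> {ring.zero ?H}"
    then have A: "A = khclass n ?X 0" by (simp add: zero)
    have "0 \<in> kcycles n ?X" by (simp add: kcycles_def)
    then have "A \<in> carrier ?H" unfolding carrier A by (rule imageI)
    \<comment> \<open>The zero class enters with exponent 0; it remains to see that 1 acts trivially
      on the boundaries that make up this class.\<close>
    moreover have "module.smult ?H (laurent_of_poly f ^ 0) A = ring.zero ?H"
    proof -
      have "khclass n ?X (lact (int n) 1 y) = khclass n ?X 0" if "y \<in> khclass n ?X 0" for y :: "(('v \<Rightarrow> complex) \<times> real, 'k) kchain"
      proof -
        have y: "y \<in> kboundaries n ?X" using that by (simp add: khclass_def)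
        then have "y \<in> kchains n ?X" by (auto simp: kboundaries_def kchains_kboundary)
        then have "lact (int n) 1 y = y" by (intro lact_one[of _ _ ?X]) (simp add: chain_space_int)
        then show ?thesis using khclass_boundary[OF y] by simp
      qed
      then show ?thesis
        using khclass_self[of 0 n ?X] unfolding smult zero A power_0 by blast
    qed
    ultimately show "A \<in> primary_part (laurent_of_poly f) ?H" unfolding primary_part_def by blast
  qed
qed

end
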